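(* Let $(M,g)$ be a transverse Riemann-Lorentz space with tangent radical and singular hypersurface $\Sigma$. Then: (a) Any admissible connection $D$ on $\Sigma$ satisfies, for all $X,Y\in\mathfrak{X}(\Sigma)$, $$D_XY=\dot D_XY+\sigma(X,Y)R,$$ where $\dot D$ is the main admissible connection and $\sigma$ is some symmetric $(0,2)$-tensor field on $\Sigma$. (b) If there exists a torsion-free metric connection on $\Sigma$, then: (1) it is admissible; (2) all admissible connections on $\Sigma$ are metric; and (3) $\Sigma$ is $II$-flat. (c) If $\Sigma$ is $II$-flat, all admissible connections have the same covariant curvature.
   Context: $M$ is a connected smooth manifold of dimension $m>2$ with a smooth symmetric $(0,2)$-tensor field $g=\langle\cdot,\cdot\rangle$ which fails to have maximal rank exactly on a nonempty set $\Sigma\subset M$. $(M,g)$ is a transverse singular space if in every local coordinate system $\det(g_{ab})$ has nonzero differential at the points of $\Sigma$; then $\Sigma$ is a smooth hypersurface (the singular hypersurface) and the radical $Rad_p=\{v\in T_pM: g(v,\cdot)=0\}$, $p\in\Sigma$, is one-dimensional. Tangent radical: $Rad_p\subset T_p\Sigma$ for all $p\in\Sigma$. Riemann-Lorentz: the signature of $g$ changes from Riemannian to Lorentzian across $\Sigma$. $\mathfrak{X}_\Sigma$: smooth vector fields along $\Sigma$; $\mathfrak{X}(\Sigma)$: those tangent to $\Sigma$. Everything is local around points of $\Sigma$. Dual connection: $2\square_{\mathcal A}\mathcal B(\mathcal C)=\mathcal A\langle\mathcal B,\mathcal C\rangle+\mathcal B\langle\mathcal C,\mathcal A\rangle-\mathcal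 C\langle\mathcal A,\mathcal B\rangle+\langle[\mathcal A,\mathcal B],\mathcal C\rangle-\langle[\mathcal B,\mathcal C],\mathcal A\rangle+\langle[\mathcal C,\mathcal A],\mathcal B\rangle$. For a radical vector field $R'$ along $\Sigma$, $II_{R'}(A,B):=\square_AB(R')$ is a well-defined symmetric $C^\infty(\Sigma)$-bilinear map on $\mathfrak{X}_\Sigma$. The main normal $N\in\mathfrak{X}_\Sigma$ satisfies $\langle N,T\Sigma\rangle=0$, $II_{R'}(N,N)=0$ for radical $R'$, $\langle N,N\rangle=1$ (unique up to sign). Second fundamental form: the symmetric tensor $\mathcal H(X,Y):=\square_XY(N)=-\square_XN(Y)$ on $\Sigma$. The main radical vector field $R\in\mathfrak{X}(\Sigma)$ is in the radical distribution with $\mathcal H(R,R)=-1$ (unique up to sign, the sign of $N$ being chosen to make this possible). $II:=II_R$. Canonical screen distribution: $S_p:=\{v\in T_p\Sigma:\mathcal H(v,R(p))=0\}$, a complement of $Rad_p$ in $T_p\Sigma$ on which $g$ is positive definite; $\Gamma(S)$ is its module of sections. $\Sigma$ is $II$-flat if $II(V,W)=0$ for all $V,W\in\Gamma(S)$ (equivalently $II(X,Y)=0$ for all $X,Y\in\mathfrak{X}(\Sigma)$). The 1-form $\rho$ on $\Sigma$ is $\rho(X):=-\mathcal H(X,R)$, so $X=X^S+\rho(X)R$ with $X^S\in\Gamma(S)$; $d\rho(X,Y)=X(\rho(Y))-Y(\rho(X))-\rho([X,Y])$. Screen connection-operator: for $X\in\mathfrak{X}(\Sigma)$, $A\in\mathfrak{X}_\Sigma$,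 $D^S_XA\in\Gamma(S)$ is the unique section with $\langle D^S_XA,V\rangle=\square_XA(V)$ for all $V\in\Gamma(S)$. A connection $D$ on $\Sigma$ is admissible if it is torsion-free and $(D_XY)^S=D^S_XY$ for all $X,Y\in\mathfrak{X}(\Sigma)$. It is metric if $X\langle Y,Z\rangle=\langle D_XY,Z\rangle+\langle Y,D_XZ\rangle$ for all $X,Y,Z\in\mathfrak{X}(\Sigma)$. The main admissible connection is $\dot D_XY:=D^S_XY+X(\rho(Y))R-\tfrac12d\rho(X,Y)R$. The covariant curvature of $D$ is $\langle R^D(X,Y)Z,T\rangle:=\langle D_X(D_YZ)-D_Y(D_XZ)-D_{[X,Y]}Z,T\rangle$ for $X,Y,Z,T\in\mathfrak{X}(\Sigma)$. *)

theory Defs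
  imports "HOL-Analysis.Analysis" "HOL-Library.Function_Algebras"
begin

text \<open>Differentiability of class \<open>C\<^sup>k\<close> and \<open>C\<^sup>\<infinity>\<close>; the set \<open>S\<close> is always open below.\<close>

fun ck_on :: "nat \<Rightarrow> 'a::euclidean_space set \<Rightarrow> ('a \<Rightarrow> 'b::real_normed_vector) \<Rightarrow> bool" where
  "ck_on 0 S f \<longleftrightarrow> continuous_on S f"
| "ck_on (Suc k) S f \<longleftrightarrow>
     (\<forall>x\<in>S. f differentiable (at x)) \<and> (\<forall>v. ck_on k S (\<lambda>x. frechet_derivative f (at x) v))"

definition smooth_on :: "'a::euclidean_space set \<Rightarrow> ('a \<Rightarrow> 'b::real_normed_vector) \<Rightarrow> bool" where
  "smooth_on S f \<longleftrightarrow> (\<forall>k. ck_on k S f)"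

text \<open>
  The points of the manifold are all the elements of a Hausdorff second countable type.
  A chart is a pair of its domain and its map; the values of the map outside the domain are
  irrelevant.
\<close>

type_synonym ('p, 'm) chart = "'p set \<times> ('p \<Rightarrow> real ^ 'm)"

definition param :: "('p, 'm::finite) chart \<Rightarrow> real ^ 'm \<Rightarrow> 'p" where
  "param c = inv_into (fst c) (snd c)"

definition is_chart :: "('p::topological_space, 'm::finite) chart \<Rightarrow> bool" where
  "is_chart c \<longleftrightarrow> open (fst c) \<and> open (snd c ` fst c) \<and>
     homeomorphism (fst c) (snd c ` fst c) (snd c) (param c)"

definition compatible :: "('p, 'm::finite) chart \<Rightarrow> ('p, 'm) chart \<Rightarrow> bool" where
  "compatible c d \<longleftrightarrow>
     smooth_on (snd c ` (fst c \<inter> fst d)) (snd d \<circ> param c) \<and>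
     smooth_on (snd d ` (fst c \<inter> fst d)) (snd c \<circ> param d)"

definition smooth_structure ::
  "('p::{t2_space, second_countable_topology}, 'm::finite) chart set \<Rightarrow> bool" where
  "smooth_structure \<A> \<longleftrightarrow>
     (\<forall>c\<in>\<A>. is_chart c) \<and> (\<Union>c\<in>\<A>. fst c) = UNIV \<and> (\<forall>c\<in>\<A>. \<forall>d\<in>\<A>. compatible c d) \<and>
     (\<forall>c. is_chart c \<and> (\<forall>d\<in>\<A>. compatible c d) \<longrightarrow> c \<in> \<A>)"

text \<open>
  Smoothness of a real function on a neighbourhood of \<open>p\<close>. As the atlas is maximal, the
  neighbourhood may be taken to be a chart domain.
\<close>

definition smooth_at :: "('p, 'm::finite) chart set \<Rightarrow> 'p \<Rightarrow> ('p \<Rightarrow> real) \<Rightarrow> bool" where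
  "smooth_at \<A> p f \<longleftrightarrow> (\<exists>c\<in>\<A>. p \<in> fst c \<and> smooth_on (snd c ` fst c) (f \<circ> param c))"

text \<open>
  A tangent vector at \<open>p\<close> is the operator of directional derivative on the functions that are
  smooth near \<open>p\<close>. It is put to \<open>0\<close> on all other functions, so that equality of vectors is
  equality of HOL functions. The vector with components \<open>u\<close> in the chart \<open>c\<close> is
  \<open>coord_vec \<A> c p u\<close>. Sums and the zero vector are those of \<open>Function_Algebras\<close>.
\<close>

type_synonym 'p tvec = "('p \<Rightarrow> real) \<Rightarrow> real"
type_synonym 'p vfield = "'p \<Rightarrow> 'p tvec"

definition coord_vec ::
  "('p, 'm::finite) chart set \<Rightarrow> ('p, 'm) chart \<Rightarrow> 'p \<Rightarrow> real ^ 'm \<Rightarrow> 'p tvec" where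
  "coord_vec \<A> c p u = (\<lambda>f. if smooth_at \<A> p f
     then frechet_derivative (f \<circ> param c) (at (snd c p)) u else 0)"

definition tangent :: "('p, 'm::finite) chart set \<Rightarrow> 'p \<Rightarrow> 'p tvec set" where
  "tangent \<A> p = {coord_vec \<A> c p u | c u. c \<in> \<A> \<and> p \<in> fst c}"

definition tscale :: "real \<Rightarrow> 'p tvec \<Rightarrow> 'p tvec" where
  "tscale r v = (\<lambda>f. r * v f)"

definition fscale :: "('p \<Rightarrow> real) \<Rightarrow> 'p vfield \<Rightarrow> 'p vfield" where
  "fscale h X = (\<lambda>p. tscale (h p) (X p))"

text \<open>
  The field need only be tangent and smooth on some neighbourhood of \<open>p\<close> in the manifold;
  smooth means that it maps smooth functions to smooth functions.
\<close>

definition smooth_vf_at ::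
  "('p::topological_space, 'm::finite) chart set \<Rightarrow> 'p \<Rightarrow> 'p vfield \<Rightarrow> bool" where
  "smooth_vf_at \<A> p X \<longleftrightarrow> (\<forall>\<^sub>F q in nhds p. X q \<in> tangent \<A> q \<and>
     (\<forall>f. smooth_at \<A> q f \<longrightarrow> smooth_at \<A> q (\<lambda>r. X r f)))"

definition lie :: "('p, 'm::finite) chart set \<Rightarrow> 'p vfield \<Rightarrow> 'p vfield \<Rightarrow> 'p vfield" where
  "lie \<A> X Y = (\<lambda>p f. if smooth_at \<A> p f
     then X p (\<lambda>q. Y q f) - Y p (\<lambda>q. X q f) else 0)"

type_synonym 'p metric = "'p \<Rightarrow> 'p tvec \<Rightarrow> 'p tvec \<Rightarrow> real"

definition gram ::
  "('p, 'm::finite) chart set \<Rightarrow> 'p metric \<Rightarrow> ('p, 'm) chart \<Rightarrow> 'p \<Rightarrow> real ^ 'm ^ 'm" where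
  "gram \<A> g c p =
     (\<chi> a b. g p (coord_vec \<A> c p (axis a 1)) (coord_vec \<A> c p (axis b 1)))"

definition smooth_sym_tensor :: "('p, 'm::finite) chart set \<Rightarrow> 'p metric \<Rightarrow> bool" where
  "smooth_sym_tensor \<A> g \<longleftrightarrow>
     (\<forall>p. \<forall>u\<in>tangent \<A> p. \<forall>v\<in>tangent \<A> p. \<forall>w\<in>tangent \<A> p. \<forall>r.
        g p (u + v) w = g p u w + g p v w \<and> g p (tscale r u) w = r * g p u w \<and>
        g p u v = g p v u) \<and>
     (\<forall>c\<in>\<A>. \<forall>p\<in>fst c. \<forall>a b. smooth_at \<A> p (\<lambda>q. gram \<A> g c q $ a $ b))"

definition Rad :: "('p, 'm::finite) chart set \<Rightarrow> 'p metric \<Rightarrow> 'p \<Rightarrow> 'p tvec set" where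
  "Rad \<A> g p = {v \<in> tangent \<A> p. \<forall>w\<in>tangent \<A> p. g p v w = 0}"

definition Sing :: "('p, 'm::finite) chart set \<Rightarrow> 'p metric \<Rightarrow> 'p set" where
  "Sing \<A> g = {p. Rad \<A> g p \<noteq> {0}}"

definition transverse :: "('p, 'm::finite) chart set \<Rightarrow> 'p metric \<Rightarrow> bool" where
  "transverse \<A> g \<longleftrightarrow> (\<forall>c\<in>\<A>. \<forall>p \<in> fst c \<inter> Sing \<A> g.
     \<exists>u. frechet_derivative (\<lambda>x. det (gram \<A> g c (param c x))) (at (snd c p)) u \<noteq> 0)"

text \<open>
  \<open>g\<close> is nondegenerate at \<open>p\<close> with \<open>k\<close> negative directions: there is an orthonormal family, as
  large as the dimension, in which exactly \<open>k\<close> vectors are timelike.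
\<close>

definition has_index :: "('p, 'm::finite) chart set \<Rightarrow> 'p metric \<Rightarrow> 'p \<Rightarrow> nat \<Rightarrow> bool" where
  "has_index \<A> g p k \<longleftrightarrow> (\<exists>(E :: 'm \<Rightarrow> 'p tvec) J. card J = k \<and>
     (\<forall>i. E i \<in> tangent \<A> p) \<and>
     (\<forall>i j. g p (E i) (E j) = (if i \<noteq> j then 0 else if i \<in> J then - 1 else 1)))"

definition riemann_lorentz ::
  "('p::topological_space, 'm::finite) chart set \<Rightarrow> 'p metric \<Rightarrow> bool" where
  "riemann_lorentz \<A> g \<longleftrightarrow> (\<forall>p \<in> Sing \<A> g.
     (\<forall>\<^sub>F q in nhds p. q \<notin> Sing \<A> g \<longrightarrow> has_index \<A> g q 0 \<or> has_index \<A> g q 1) \<and>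
     (\<exists>\<^sub>F q in nhds p. has_index \<A> g q 0) \<and> (\<exists>\<^sub>F q in nhds p. has_index \<A> g q 1))"

text \<open>
  The tangent space of the hypersurface consists of the vectors that annihilate every function
  vanishing on the hypersurface near \<open>p\<close>.
\<close>

definition tangentS ::
  "('p::topological_space, 'm::finite) chart set \<Rightarrow> 'p metric \<Rightarrow> 'p \<Rightarrow> 'p tvec set" where
  "tangentS \<A> g p = {v \<in> tangent \<A> p. \<forall>f. smooth_at \<A> p f \<and>
     (\<forall>\<^sub>F q in nhds p. q \<in> Sing \<A> g \<longrightarrow> f q = 0) \<longrightarrow> v f = 0}"

definition tangent_radical ::
  "('p::topological_space, 'm::finite) chart set \<Rightarrow> 'p metric \<Rightarrow> bool" where
  "tangent_radical \<A> g \<longleftrightarrow> (\<forall>p \<in> Sing \<A> g. Rad \<A> g p \<subseteq> tangentS \<A> g p)"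

text \<open>
  Functions and vector fields on the hypersurface are smooth when they have smooth local
  extensions to the manifold. Only the values of functions on the hypersurface matter; fields
  along it are put to \<open>0\<close> elsewhere, so that equality of fields is equality of HOL functions.
\<close>

definition extends_fun :: "('p::topological_space, 'm::finite) chart set \<Rightarrow> 'p metric \<Rightarrow>
    'p \<Rightarrow> ('p \<Rightarrow> real) \<Rightarrow> ('p \<Rightarrow> real) \<Rightarrow> bool" where
  "extends_fun \<A> g p h k \<longleftrightarrow> smooth_at \<A> p k \<and> (\<forall>\<^sub>F q in nhds p. q \<in> Sing \<A> g \<longrightarrow> k q = h q)"

definition extends_vf :: "('p::topological_space, 'm::finite) chart set \<Rightarrow> 'p metric \<Rightarrow>
    'p \<Rightarrow> 'p vfield \<Rightarrow> 'p vfield \<Rightarrow> bool" where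
  "extends_vf \<A> g p A B \<longleftrightarrow> smooth_vf_at \<A> p B \<and> (\<forall>\<^sub>F q in nhds p. q \<in> Sing \<A> g \<longrightarrow> B q = A q)"

definition CinfS ::
  "('p::topological_space, 'm::finite) chart set \<Rightarrow> 'p metric \<Rightarrow> ('p \<Rightarrow> real) set" where
  "CinfS \<A> g = {h. \<forall>p \<in> Sing \<A> g. \<exists>k. extends_fun \<A> g p h k}"

definition fields_along ::
  "('p::topological_space, 'm::finite) chart set \<Rightarrow> 'p metric \<Rightarrow> 'p vfield set" where
  "fields_along \<A> g = {A. (\<forall>p. p \<notin> Sing \<A> g \<longrightarrow> A p = 0) \<and>
     (\<forall>p \<in> Sing \<A> g. A p \<in> tangent \<A> p \<and> (\<exists>B. extends_vf \<A> g p A B))}"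

definition fieldsS ::
  "('p::topological_space, 'm::finite) chart set \<Rightarrow> 'p metric \<Rightarrow> 'p vfield set" where
  "fieldsS \<A> g = {X \<in> fields_along \<A> g. \<forall>p \<in> Sing \<A> g. X p \<in> tangentS \<A> g p}"

text \<open>
  Action of a vector \<open>v\<close> tangent to the hypersurface on a function \<open>h\<close> on the hypersurface; by
  the definition of the tangent space it does not depend on the local extension of \<open>h\<close>.
\<close>

definition actS :: "('p::topological_space, 'm::finite) chart set \<Rightarrow> 'p metric \<Rightarrow>
    'p \<Rightarrow> 'p tvec \<Rightarrow> ('p \<Rightarrow> real) \<Rightarrow> real" where
  "actS \<A> g p v h = (THE r. \<exists>k. extends_fun \<A> g p h k \<and> r = v k)"

definition lieS :: "('p::topological_space, 'm::finite) chart set \<Rightarrow> 'p metric \<Rightarrow>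
    'p vfield \<Rightarrow> 'p vfield \<Rightarrow> 'p vfield" where
  "lieS \<A> g X Y = (\<lambda>p f. if p \<in> Sing \<A> g \<and> smooth_at \<A> p f
     then actS \<A> g p (X p) (\<lambda>q. Y q f) - actS \<A> g p (Y p) (\<lambda>q. X q f) else 0)"

definition koszul :: "('p, 'm::finite) chart set \<Rightarrow> 'p metric \<Rightarrow>
    'p vfield \<Rightarrow> 'p vfield \<Rightarrow> 'p vfield \<Rightarrow> 'p \<Rightarrow> real" where
  "koszul \<A> g A B C p =
     (A p (\<lambda>q. g q (B q) (C q)) + B p (\<lambda>q. g q (C q) (A q)) - C p (\<lambda>q. g q (A q) (B q))
      + g p (lie \<A> A B p) (C p) - g p (lie \<A> B C p) (A p) + g p (lie \<A> C A p) (B p)) / 2"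

text \<open>
  The value of \<open>\<box>\<^sub>A B (C)\<close> at a point \<open>p\<close> of the hypersurface for a vector field \<open>B\<close> along it.
  The Koszul expression is function-linear in \<open>A\<close> and \<open>C\<close>, so that only the vectors \<open>a = A p\<close>
  and \<open>c = C p\<close> enter. It is independent of the extension of \<open>B\<close> if \<open>a\<close> is tangent to the
  hypersurface or if \<open>c\<close> is radical.
\<close>

definition dual_at :: "('p::topological_space, 'm::finite) chart set \<Rightarrow> 'p metric \<Rightarrow>
    'p \<Rightarrow> 'p tvec \<Rightarrow> 'p vfield \<Rightarrow> 'p tvec \<Rightarrow> real" where
  "dual_at \<A> g p a B c = (THE r. \<exists>A' B' C'.
     smooth_vf_at \<A> p A' \<and> A' p = a \<and> extends_vf \<A> g p B B' \<and>
     smooth_vf_at \<A> p C' \<and> C' p = c \<and> r = koszul \<A> g A' B' C' p)"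

definition dual :: "('p::topological_space, 'm::finite) chart set \<Rightarrow> 'p metric \<Rightarrow>
    'p vfield \<Rightarrow> 'p vfield \<Rightarrow> 'p vfield \<Rightarrow> 'p \<Rightarrow> real" where
  "dual \<A> g A B C p = dual_at \<A> g p (A p) B (C p)"

text \<open>
  \<open>II \<A> g R A B\<close> is the form \<open>II\<^sub>R(A, B)\<close> for a radical vector field \<open>R\<close>, and \<open>HH \<A> g N X Y\<close> is
  the second fundamental form for the main normal \<open>N\<close>.
\<close>

definition II :: "('p::topological_space, 'm::finite) chart set \<Rightarrow> 'p metric \<Rightarrow>
    'p vfield \<Rightarrow> 'p vfield \<Rightarrow> 'p vfield \<Rightarrow> 'p \<Rightarrow> real" where
  "II \<A> g R A B = dual \<A> g A B R"

definition HH :: "('p::topological_space, 'm::finite) chart set \<Rightarrow> 'p metric \<Rightarrow>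
    'p vfield \<Rightarrow> 'p vfield \<Rightarrow> 'p vfield \<Rightarrow> 'p \<Rightarrow> real" where
  "HH \<A> g N X Y = dual \<A> g X Y N"

definition main_normal ::
  "('p::topological_space, 'm::finite) chart set \<Rightarrow> 'p metric \<Rightarrow> 'p vfield \<Rightarrow> bool" where
  "main_normal \<A> g N \<longleftrightarrow> N \<in> fields_along \<A> g \<and>
     (\<forall>p \<in> Sing \<A> g. (\<forall>v \<in> tangentS \<A> g p. g p (N p) v = 0) \<and> g p (N p) (N p) = 1) \<and>
     (\<forall>R' \<in> fields_along \<A> g. (\<forall>p \<in> Sing \<A> g. R' p \<in> Rad \<A> g p) \<longrightarrow>
        (\<forall>p \<in> Sing \<A> g. II \<A> g R' N N p = 0))"

definition main_radical ::
  "('p::topological_space, 'm::finite) chart set \<Rightarrow> 'p metric \<Rightarrow> 'p vfield \<Rightarrow> 'p vfield \<Rightarrow> bool"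
  where
  "main_radical \<A> g N R \<longleftrightarrow> R \<in> fieldsS \<A> g \<and>
     (\<forall>p \<in> Sing \<A> g. R p \<in> Rad \<A> g p \<and> HH \<A> g N R R p = - 1)"

text \<open>\<open>HH(v, R)\<close> for a single vector \<open>v\<close> is \<open>dual_at\<close> at \<open>v\<close>.\<close>

definition screen :: "('p::topological_space, 'm::finite) chart set \<Rightarrow> 'p metric \<Rightarrow>
    'p vfield \<Rightarrow> 'p vfield \<Rightarrow> 'p \<Rightarrow> 'p tvec set" where
  "screen \<A> g N R p = {v \<in> tangentS \<A> g p. dual_at \<A> g p v R (N p) = 0}"

definition screen_fields :: "('p::topological_space, 'm::finite) chart set \<Rightarrow> 'p metric \<Rightarrow>
    'p vfield \<Rightarrow> 'p vfield \<Rightarrow> 'p vfield set" where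
  "screen_fields \<A> g N R = {V \<in> fieldsS \<A> g. \<forall>p \<in> Sing \<A> g. V p \<in> screen \<A> g N R p}"

definition II_flat :: "('p::topological_space, 'm::finite) chart set \<Rightarrow> 'p metric \<Rightarrow>
    'p vfield \<Rightarrow> 'p vfield \<Rightarrow> bool" where
  "II_flat \<A> g N R \<longleftrightarrow> (\<forall>V \<in> screen_fields \<A> g N R. \<forall>W \<in> screen_fields \<A> g N R.
     \<forall>p \<in> Sing \<A> g. II \<A> g R V W p = 0)"

definition rho :: "('p::topological_space, 'm::finite) chart set \<Rightarrow> 'p metric \<Rightarrow>
    'p vfield \<Rightarrow> 'p vfield \<Rightarrow> 'p vfield \<Rightarrow> 'p \<Rightarrow> real" where
  "rho \<A> g N R X p = - HH \<A> g N X R p"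

definition drho :: "('p::topological_space, 'm::finite) chart set \<Rightarrow> 'p metric \<Rightarrow>
    'p vfield \<Rightarrow> 'p vfield \<Rightarrow> 'p vfield \<Rightarrow> 'p vfield \<Rightarrow> 'p \<Rightarrow> real" where
  "drho \<A> g N R X Y p = actS \<A> g p (X p) (rho \<A> g N R Y) - actS \<A> g p (Y p) (rho \<A> g N R X)
     - rho \<A> g N R (lieS \<A> g X Y) p"

definition screen_part :: "('p::topological_space, 'm::finite) chart set \<Rightarrow> 'p metric \<Rightarrow>
    'p vfield \<Rightarrow> 'p vfield \<Rightarrow> 'p vfield \<Rightarrow> 'p vfield" where
  "screen_part \<A> g N R X = X - fscale (rho \<A> g N R X) R"

definition screen_conn :: "('p::topological_space, 'm::finite) chart set \<Rightarrow> 'p metric \<Rightarrow>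
    'p vfield \<Rightarrow> 'p vfield \<Rightarrow> 'p vfield \<Rightarrow> 'p vfield \<Rightarrow> 'p vfield" where
  "screen_conn \<A> g N R X A = (THE W. W \<in> screen_fields \<A> g N R \<and>
     (\<forall>V \<in> screen_fields \<A> g N R. \<forall>p \<in> Sing \<A> g. g p (W p) (V p) = dual \<A> g X A V p))"

definition connectionS :: "('p::topological_space, 'm::finite) chart set \<Rightarrow> 'p metric \<Rightarrow>
    ('p vfield \<Rightarrow> 'p vfield \<Rightarrow> 'p vfield) \<Rightarrow> bool" where
  "connectionS \<A> g D \<longleftrightarrow>
     (\<forall>X \<in> fieldsS \<A> g. \<forall>Y \<in> fieldsS \<A> g. D X Y \<in> fieldsS \<A> g) \<and>
     (\<forall>X \<in> fieldsS \<A> g. \<forall>Y \<in> fieldsS \<A> g. \<forall>Z \<in> fieldsS \<A> g.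
        D (X + Y) Z = D X Z + D Y Z \<and> D X (Y + Z) = D X Y + D X Z) \<and>
     (\<forall>h \<in> CinfS \<A> g. \<forall>X \<in> fieldsS \<A> g. \<forall>Y \<in> fieldsS \<A> g.
        D (fscale h X) Y = fscale h (D X Y) \<and>
        D X (fscale h Y) = fscale (\<lambda>p. actS \<A> g p (X p) h) Y + fscale h (D X Y))"

definition torsion_free :: "('p::topological_space, 'm::finite) chart set \<Rightarrow> 'p metric \<Rightarrow>
    ('p vfield \<Rightarrow> 'p vfield \<Rightarrow> 'p vfield) \<Rightarrow> bool" where
  "torsion_free \<A> g D \<longleftrightarrow>
     (\<forall>X \<in> fieldsS \<A> g. \<forall>Y \<in> fieldsS \<A> g. D X Y - D Y X = lieS \<A> g X Y)"

definition admissible :: "('p::topological_space, 'm::finite) chart set \<Rightarrow> 'p metric \<Rightarrow>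
    'p vfield \<Rightarrow> 'p vfield \<Rightarrow> ('p vfield \<Rightarrow> 'p vfield \<Rightarrow> 'p vfield) \<Rightarrow> bool" where
  "admissible \<A> g N R D \<longleftrightarrow> connectionS \<A> g D \<and> torsion_free \<A> g D \<and>
     (\<forall>X \<in> fieldsS \<A> g. \<forall>Y \<in> fieldsS \<A> g.
        screen_part \<A> g N R (D X Y) = screen_conn \<A> g N R X Y)"

definition metric_conn :: "('p::topological_space, 'm::finite) chart set \<Rightarrow> 'p metric \<Rightarrow>
    ('p vfield \<Rightarrow> 'p vfield \<Rightarrow> 'p vfield) \<Rightarrow> bool" where
  "metric_conn \<A> g D \<longleftrightarrow>
     (\<forall>X \<in> fieldsS \<A> g. \<forall>Y \<in> fieldsS \<A> g. \<forall>Z \<in> fieldsS \<A> g. \<forall>p \<in> Sing \<A> g.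
        actS \<A> g p (X p) (\<lambda>q. g q (Y q) (Z q)) = g p (D X Y p) (Z p) + g p (Y p) (D X Z p))"

definition main_conn :: "('p::topological_space, 'm::finite) chart set \<Rightarrow> 'p metric \<Rightarrow>
    'p vfield \<Rightarrow> 'p vfield \<Rightarrow> 'p vfield \<Rightarrow> 'p vfield \<Rightarrow> 'p vfield" where
  "main_conn \<A> g N R X Y = screen_conn \<A> g N R X Y
     + fscale (\<lambda>p. actS \<A> g p (X p) (rho \<A> g N R Y)) R
     - fscale (\<lambda>p. drho \<A> g N R X Y p / 2) R"

definition cov_curv :: "('p::topological_space, 'm::finite) chart set \<Rightarrow> 'p metric \<Rightarrow>
    ('p vfield \<Rightarrow> 'p vfield \<Rightarrow> 'p vfield) \<Rightarrow>
    'p vfield \<Rightarrow> 'p vfield \<Rightarrow> 'p vfield \<Rightarrow> 'p vfield \<Rightarrow> 'p \<Rightarrow> real" where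
  "cov_curv \<A> g D X Y Z T p =
     g p ((D X (D Y Z) - D Y (D X Z) - D (lieS \<A> g X Y) Z) p) (T p)"

text \<open>Tensor fields on the hypersurface are function-bilinear maps on its vector fields.\<close>

definition sym_tensorS :: "('p::topological_space, 'm::finite) chart set \<Rightarrow> 'p metric \<Rightarrow>
    ('p vfield \<Rightarrow> 'p vfield \<Rightarrow> 'p \<Rightarrow> real) \<Rightarrow> bool" where
  "sym_tensorS \<A> g s \<longleftrightarrow>
     (\<forall>X \<in> fieldsS \<A> g. \<forall>Y \<in> fieldsS \<A> g. s X Y \<in> CinfS \<A> g) \<and>
     (\<forall>X \<in> fieldsS \<A> g. \<forall>Y \<in> fieldsS \<A> g. \<forall>Z \<in> fieldsS \<A> g. \<forall>h \<in> CinfS \<A> g.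
        \<forall>p \<in> Sing \<A> g. s (X + Y) Z p = s X Z p + s Y Z p \<and>
          s (fscale h X) Y p = h p * s X Y p \<and> s X Y p = s Y X p)"

end

theory Submission
  imports Defs
begin

text \<open>
  Everything rests on the well-definedness of \<open>\<box>\<^sub>A B (C)\<close> on the hypersurface: the Koszul expression
  vanishes when \<open>A\<close> or \<open>C\<close> vanishes at \<open>p\<close>, and when \<open>B\<close> vanishes on the hypersurface with \<open>A p\<close>
  tangent to it; this follows from \<open>Y\<langle>X, Z\<rangle> = \<langle>[Y, X], Z\<rangle>\<close> at the zeros of \<open>X\<close>. As
  \<open>\<box>\<close> is then torsion-free and metric in the weak sense, a torsion-free metric connection has
  \<open>\<langle>D\<^sub>X Y, Z\<rangle> = \<box>\<^sub>X Y (Z)\<close>, which for \<open>Z = R\<close> gives flatness. Two admissible connections differ by a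
  multiple of \<open>R\<close>, invisible to the metric. In the flat case \<open>\<box>\<^sub>X R\<close> vanishes on the screen, so \<open>D\<^sub>X R\<close> is
  radical and the multiple of \<open>R\<close> does not enter the curvature. The existence of the section \<open>D\<^sup>S\<^sub>X A\<close>
  is never needed, only its uniqueness: \<open>g\<close> is a limit of Riemannian metrics, hence positive
  semidefinite, and its radical is one-dimensional by transversality, so \<open>g\<close> is definite on the screen.
\<close>

section \<open>Smooth functions on Euclidean space\<close>

text \<open>\<open>actS\<close>, \<open>dual_at\<close> and \<open>screen_conn\<close> are definite
  descriptions, so nothing can be computed with them before uniqueness is known.
  \<open>act_eq\<close>, \<open>dual_at_eq\<close> and \<open>screen_conn_eq\<close> supply it, each
  starting from a solution that is already at hand. The hypersurface gets no coordinates of its own: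
  functions and fields on it are replaced near a point by extensions to the manifold, an identity is
  proved for the extensions, and it descends because a vector in \<open>tangentS\<close> sees only
  values on the hypersurface. Tangent vectors are operators on functions, so the Koszul expression
  makes sense only once the bracket of two fields is known to be a tangent vector. Its second-order
  terms cancel by the symmetry of second derivatives, and this is what the calculus for
  \<open>ck_on\<close> has to deliver. In the flat case the hypothesis speaks only of pairs of
  screen fields, whereas the derivative of \<open>R\<close> is needed in every direction tangent to
  the hypersurface. The direction of \<open>R\<close> itself is gained from
  \<open>g(R, R) = 0\<close> and the torsion identity.\<close>

lemma ck_on_subset: "ck_on k S f \<Longrightarrow> T \<subseteq> S \<Longrightarrow> ck_on k T f"
  by (induction k arbitrary: f) (auto intro: continuous_on_subset)

text \<open>On an open set the derivative depends only on the values there. Both functions are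
  generalised in the induction because their derivatives again agree on \<open>S\<close>
  only.\<close>

lemma ck_on_cong:
  assumes "open S" "\<And>x. x \<in> S \<Longrightarrow> f x = g x" "ck_on k S f"
  shows "ck_on k S g"
  using assms(2,3)
proof (induction k arbitrary: f g)
  case 0
  then show ?case by (metis ck_on.simps(1) continuous_on_cong)
next
  case (Suc k)
  have d: "g differentiable (at x)" "frechet_derivative f (at x) = frechet_derivative g (at x)"
    if "x \<in> S" for x
  proof -
    have f: "f differentiable (at x)" using Suc.prems that by auto
    then obtain f' where "(f has_derivative f') (at x)" by (auto simp: differentiable_def)
    then have "(g has_derivative f') (at x)"
      using has_derivative_transform_within_open[OF _ assms(1) that] Suc.prems(1) by blast
    then show "g differentiable (at x)" by (auto simp: differentiable_def)
    show "frechet_derivative f (at x) = frechet_derivative g (at x)"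
      using frechet_derivative_transform_within_open[OF f assms(1) that] Suc.prems(1) by blast
  qed
  have "ck_on k S (\<lambda>x. frechet_derivative g (at x) v)" for v
    by (rule Suc.IH[of "\<lambda>x. frechet_derivative f (at x) v"]) (use d Suc.prems in auto)
  with d show ?case by simp
qed

lemma ck_on_Suc_imp: "ck_on (Suc k) S f \<Longrightarrow> ck_on k S f"
proof (induction k arbitrary: f)
  case 0
  then show ?case
    by (auto intro!: continuous_at_imp_continuous_on differentiable_imp_continuous_within)
qed auto

lemma ck_on_const: "ck_on k S (\<lambda>x. c)"
  by (induction k arbitrary: c) auto

lemma frechet_eq: "(f has_derivative f') (at x) \<Longrightarrow> frechet_derivative f (at x) v = f' v"
  using frechet_derivative_at by metis

lemma ck_on_add:
  assumes "open S" "ck_on k S f" "ck_on k S g"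
  shows "ck_on k S (\<lambda>x. f x + g x)"
  using assms(2,3)
proof (induction k arbitrary: f g)
  case 0
  then show ?case by (auto intro: continuous_intros)
next
  case (Suc k)
  have *: "frechet_derivative (\<lambda>x. f x + g x) (at x) v =
      frechet_derivative f (at x) v + frechet_derivative g (at x) v" if "x \<in> S" for x v
    by (intro frechet_eq has_derivative_add)
      (use Suc.prems that in \<open>auto simp: frechet_derivative_works[symmetric]\<close>)
  have "ck_on k S (\<lambda>x. frechet_derivative (\<lambda>x. f x + g x) (at x) v)" for v
    by (rule ck_on_cong[OF assms(1) *[symmetric]]) (use Suc in auto)
  with Suc.prems show ?case by auto
qed

lemma ck_on_bounded_linear:
  assumes "open S" "bounded_linear L" "ck_on k S f"
  shows "ck_on k S (\<lambda>x. L (f x))"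
  using assms(3)
proof (induction k arbitrary: f)
  case 0
  then show ?case using assms(2) by (simp add: bounded_linear.continuous_on)
next
  case (Suc k)
  have *: "((\<lambda>x. L (f x)) has_derivative (\<lambda>v. L (frechet_derivative f (at x) v))) (at x)"
    if "x \<in> S" for x
    by (intro bounded_linear.has_derivative[OF assms(2)])
      (use Suc.prems that in \<open>auto simp: frechet_derivative_works[symmetric]\<close>)
  have "ck_on k S (\<lambda>x. frechet_derivative (\<lambda>x. L (f x)) (at x) v)" for v
    by (rule ck_on_cong[OF assms(1) frechet_eq[OF *, symmetric]]) (use Suc in auto)
  with * show ?case by (auto simp: differentiable_def)
qed

lemma ck_on_mult:
  fixes f g :: "'a::euclidean_space \<Rightarrow> real"
  assumes "open S" "ck_on k S f" "ck_on k S g"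
  shows "ck_on k S (\<lambda>x. f x * g x)"
  using assms(2,3)
proof (induction k arbitrary: f g)
  case 0
  then show ?case by (auto intro: continuous_intros)
next
  case (Suc k)
  have *: "((\<lambda>x. f x * g x) has_derivative
      (\<lambda>v. f x * frechet_derivative g (at x) v + frechet_derivative f (at x) v * g x)) (at x)"
    if "x \<in> S" for x
    by (intro has_derivative_mult)
      (use Suc.prems that in \<open>auto simp: frechet_derivative_works[symmetric]\<close>)
  have "ck_on k S (\<lambda>x. frechet_derivative (\<lambda>x. f x * g x) (at x) v)" for v
    by (rule ck_on_cong[OF assms(1) frechet_eq[OF *, symmetric]], assumption)
      (use Suc ck_on_Suc_imp[OF Suc.prems(1)] ck_on_Suc_imp[OF Suc.prems(2)] in
        \<open>auto intro!: ck_on_add assms(1)\<close>)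
  with * show ?case by (auto simp: differentiable_def)
qed

lemma ck_on_sum:
  assumes "open S" "\<And>i. i \<in> I \<Longrightarrow> ck_on k S (f i)"
  shows "ck_on k S (\<lambda>x. \<Sum>i\<in>I. f i x)"
  using assms(2)
proof (induction I rule: infinite_finite_induct)
  case (insert i I)
  then show ?case by (auto intro!: ck_on_add assms(1))
qed (auto intro: ck_on_const)

text \<open>Turns the chain rule into a finite sum of products of real functions, a form to which
  \<open>ck_on_sum\<close> and \<open>ck_on_mult\<close> apply.\<close>

lemma linear_frechet_Basis:
  fixes f :: "'a::euclidean_space \<Rightarrow> real"
  assumes "f differentiable (at x)"
  shows "frechet_derivative f (at x) v = (\<Sum>b\<in>Basis. (v \<bullet> b) * frechet_derivative f (at x) b)"
proof -
  interpret linear "frechet_derivative f (at x)"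
    using assms by (rule linear_frechet_derivative)
  have "frechet_derivative f (at x) v = frechet_derivative f (at x) (\<Sum>b\<in>Basis. (v \<bullet> b) *\<^sub>R b)"
    by (simp add: euclidean_representation)
  then show ?thesis by (simp add: sum scale)
qed

text \<open>Induction with \<open>h\<close> fixed and \<open>f\<close> varying: by the chain rule a
  derivative of the composition is a sum of products of components of the derivative of
  \<open>h\<close> with partial derivatives of \<open>f\<close> composed with \<open>h\<close>, and
  the latter fall under the induction hypothesis.\<close>

lemma ck_on_compose:
  fixes f :: "'b::euclidean_space \<Rightarrow> real" and h :: "'a::euclidean_space \<Rightarrow> 'b"
  assumes "open S" "open T" "h ` S \<subseteq> T" "ck_on k S h" "ck_on k T f"
  shows "ck_on k S (\<lambda>x. f (h x))"
  using assms(4,5)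
proof (induction k arbitrary: f)
  case 0
  then show ?case using assms(3) by (auto intro: continuous_on_compose2)
next
  case (Suc k)
  have df: "f differentiable (at (h x))" if "x \<in> S" for x using Suc.prems assms(3) that by auto
  have *: "((\<lambda>x. f (h x)) has_derivative
      (\<lambda>v. \<Sum>b\<in>Basis. (frechet_derivative h (at x) v \<bullet> b) * frechet_derivative f (at (h x)) b)) (at x)"
    if "x \<in> S" for x
    unfolding linear_frechet_Basis[OF df[OF that], symmetric]
    by (rule has_derivative_compose)
     (use Suc.prems df[OF that] that in \<open>auto simp: frechet_derivative_works[symmetric]\<close>)
  have 1: "ck_on k S (\<lambda>x. frechet_derivative f (at (h x)) b)" for b
    by (rule Suc.IH[OF ck_on_Suc_imp[OF Suc.prems(1)]]) (use Suc.prems in auto)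
  have 2: "ck_on k S (\<lambda>x. frechet_derivative h (at x) v \<bullet> b)" for v b
    by (rule ck_on_bounded_linear[OF assms(1) bounded_linear_inner_left]) (use Suc.prems in auto)
  have "ck_on k S (\<lambda>x. frechet_derivative (\<lambda>x. f (h x)) (at x) v)" for v
    by (rule ck_on_cong[OF assms(1) frechet_eq[OF *, symmetric]], assumption)
      (intro ck_on_sum ck_on_mult 1 2 assms(1))
  with * show ?case by (auto simp: differentiable_def)
qed

text \<open>Smoothness of a germ. The neighbourhood is left unspecified so that it can be shrunk at
  will and \<open>F\<close> changed away from \<open>x\<close>.\<close>

definition smooth_near :: "'a::euclidean_space \<Rightarrow> ('a \<Rightarrow> real) \<Rightarrow> bool" where
  "smooth_near x F \<longleftrightarrow> (\<exists>V. open V \<and> x \<in> V \<and> smooth_on V F)"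

lemma smooth_near_cong:
  assumes "smooth_near x F" "\<forall>\<^sub>F y in nhds x. F y = G y"
  shows "smooth_near x G"
proof -
  obtain V where V: "open V" "x \<in> V" "smooth_on V F" using assms unfolding smooth_near_def by blast
  obtain W where W: "open W" "x \<in> W" "\<And>y. y \<in> W \<Longrightarrow> F y = G y"
    using assms(2) unfolding eventually_nhds by blast
  have "ck_on k (V \<inter> W) G" for k
    by (rule ck_on_cong[of _ F]) (use V W ck_on_subset[of k V F "V \<inter> W"] in \<open>auto simp: smooth_on_def\<close>)
  then show ?thesis unfolding smooth_near_def smooth_on_def using V W by (intro exI[of _ "V \<inter> W"]) auto
qed

lemma smooth_near_mono: "open V \<Longrightarrow> x \<in> V \<Longrightarrow> smooth_on V F \<Longrightarrow> smooth_near x F"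
  unfolding smooth_near_def by blast

lemma smooth_near_const: "smooth_near x (\<lambda>y. c)"
  unfolding smooth_near_def smooth_on_def by (auto intro: ck_on_const)

lemma smooth_near_binop:
  fixes x :: "'a::euclidean_space"
  assumes "\<And>S k (f :: 'a \<Rightarrow> real) g. open S \<Longrightarrow> ck_on k S f \<Longrightarrow> ck_on k S g \<Longrightarrow> ck_on k S (\<lambda>x. bop (f x) (g x))"
    and "smooth_near x F" "smooth_near x G"
  shows "smooth_near x (\<lambda>y. bop (F y) (G y))"
proof -
  obtain V W where "open V" "x \<in> V" "smooth_on V F" "open W" "x \<in> W" "smooth_on W G"
    using assms unfolding smooth_near_def by blast
  moreover from this have "ck_on k (V \<inter> W) (\<lambda>y. bop (F y) (G y))" for k
    by (auto simp: smooth_on_def intro!: assms(1)[OF _ ck_on_subset[of k V F] ck_on_subset[of k W G]])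
  ultimately show ?thesis
    unfolding smooth_near_def smooth_on_def by (intro exI[of _ "V \<inter> W"] conjI) auto
qed

lemma smooth_near_add: "smooth_near x F \<Longrightarrow> smooth_near x G \<Longrightarrow> smooth_near x (\<lambda>y. F y + G y)"
  by (rule smooth_near_binop[where bop="(+)"]) (rule ck_on_add)

lemma smooth_near_mult: "smooth_near x F \<Longrightarrow> smooth_near x G \<Longrightarrow> smooth_near x (\<lambda>y. F y * G y)"
  by (rule smooth_near_binop[where bop="(*)"]) (rule ck_on_mult)

lemma smooth_near_inner: "smooth_near x (\<lambda>y. y \<bullet> b)"
proof -
  have "ck_on k UNIV (\<lambda>y. y)" for k :: nat
    by (cases k) (auto intro: ck_on_const continuous_intros)
  then have "ck_on k UNIV (\<lambda>y. y \<bullet> b)" for k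
    by (intro ck_on_bounded_linear[where L="\<lambda>y. y \<bullet> b"] bounded_linear_inner_left) auto
  then show ?thesis unfolding smooth_near_def smooth_on_def by (intro exI[of _ UNIV]) auto
qed

lemma smooth_near_has_derivative:
  assumes "smooth_near x F"
  shows "(F has_derivative frechet_derivative F (at x)) (at x)"
proof -
  obtain V where "open V" "x \<in> V" "ck_on (Suc 0) V F"
    using assms unfolding smooth_near_def smooth_on_def by blast
  then show ?thesis by (simp add: frechet_derivative_works[symmetric])
qed

lemma smooth_near_derivative:
  assumes "smooth_near x F"
  shows "smooth_near x (\<lambda>y. frechet_derivative F (at y) v)"
proof -
  obtain V where V: "open V" "x \<in> V" "\<And>k. ck_on k V F"
    using assms unfolding smooth_near_def smooth_on_def by blast
  have "ck_on k V (\<lambda>y. frechet_derivative F (at y) v)" for k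
    using V(3)[of "Suc k"] by simp
  then show ?thesis
    using V(1,2) unfolding smooth_near_def smooth_on_def by (intro exI[of _ V] conjI) auto
qed

lemma smooth_near_compose:
  assumes "smooth_near (h x) F" "open S" "x \<in> S" "smooth_on S h"
  shows "smooth_near x (\<lambda>y. F (h y))"
proof -
  obtain V where V: "open V" "h x \<in> V" "\<And>k. ck_on k V F"
    using assms unfolding smooth_near_def smooth_on_def by blast
  have ck: "ck_on k S h" for k using assms(4) by (simp add: smooth_on_def)
  then have "continuous_on S h" by (metis ck_on.simps(1))
  then have o: "open (S \<inter> h -` V)" using assms V by (auto intro: continuous_open_preimage)
  have "ck_on k (S \<inter> h -` V) (\<lambda>y. F (h y))" for k
    by (rule ck_on_compose[OF o V(1) _ ck_on_subset[OF ck] V(3)]) auto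
  then show ?thesis
    using o V(2) assms(3) unfolding smooth_near_def smooth_on_def
    by (intro exI[of _ "S \<inter> h -` V"] conjI) auto
qed

lemma smooth_near_continuous: "smooth_near x F \<Longrightarrow> isCont F x"
  using smooth_near_has_derivative has_derivative_continuous by blast

text \<open>Both mixed derivatives are the limit of the second difference quotient; the mean value
  theorem is applied once in each direction.\<close>

lemma second_difference_mvt:
  fixes F :: "'a::euclidean_space \<Rightarrow> real"
  assumes V: "\<And>s t. 0 \<le> s \<Longrightarrow> s \<le> e \<Longrightarrow> 0 \<le> t \<Longrightarrow> t \<le> e \<Longrightarrow> x + s *\<^sub>R u + t *\<^sub>R v \<in> V"
    and V2: "ck_on 2 V F" and e: "0 < e"
  obtains s t where "0 < s" "s < e" "0 < t" "t < e"
    "F (x + e *\<^sub>R u + e *\<^sub>R v) - F (x + e *\<^sub>R u) - F (x + e *\<^sub>R v) + F x =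
     e * e * frechet_derivative (\<lambda>y. frechet_derivative F (at y) u) (at (x + s *\<^sub>R u + t *\<^sub>R v)) v"
proof -
  let ?D = "\<lambda>y. frechet_derivative F (at y) u"
  have ck: "ck_on (Suc (Suc 0)) V F" using V2 by (simp add: numeral_2_eq_2)
  have dF: "(F has_derivative frechet_derivative F (at y)) (at y)"
    "(?D has_derivative frechet_derivative ?D (at y)) (at y)" if "y \<in> V" for y
    using ck that by (auto simp: frechet_derivative_works[symmetric])
  have lin: "linear (frechet_derivative F (at y))" "linear (frechet_derivative ?D (at y))"
    if "y \<in> V" for y
    using dF[OF that] has_derivative_linear by blast+
  have 1: "((\<lambda>s. F (x + s *\<^sub>R u + e *\<^sub>R v) - F (x + s *\<^sub>R u)) has_derivative
     (\<lambda>h. h * (?D (x + s *\<^sub>R u + e *\<^sub>R v) - ?D (x + s *\<^sub>R u)))) (at s)"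
    if "0 \<le> s" "s \<le> e" for s
  proof -
    have in1: "x + s *\<^sub>R u + e *\<^sub>R v \<in> V" "x + s *\<^sub>R u \<in> V"
      using V[of s e] V[of s 0] that e by auto
    have "((\<lambda>s. x + s *\<^sub>R u + e *\<^sub>R v) has_derivative (\<lambda>h. h *\<^sub>R u)) (at s)"
      "((\<lambda>s. x + s *\<^sub>R u) has_derivative (\<lambda>h. h *\<^sub>R u)) (at s)"
      by (auto intro!: derivative_eq_intros)
    from has_derivative_compose[where g=F, OF this(1) dF(1)[OF in1(1)]]
      has_derivative_compose[where g=F, OF this(2) dF(1)[OF in1(2)]]
    show ?thesis
      by (auto intro!: has_derivative_eq_rhs[OF has_derivative_diff]
          simp: fun_eq_iff linear_scale[OF lin(1)] in1 right_diff_distrib)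
  qed
  obtain s where s: "0 < s" "s < e" and
    s_eq: "F (x + e *\<^sub>R u + e *\<^sub>R v) - F (x + e *\<^sub>R u) - (F (x + e *\<^sub>R v) - F x) =
       e * (?D (x + s *\<^sub>R u + e *\<^sub>R v) - ?D (x + s *\<^sub>R u))"
    using mvt_simple[OF e has_derivative_at_withinI[OF 1]] by auto
  have 2: "((\<lambda>t. ?D (x + s *\<^sub>R u + t *\<^sub>R v)) has_derivative
     (\<lambda>h. h * frechet_derivative ?D (at (x + s *\<^sub>R u + t *\<^sub>R v)) v)) (at t)"
    if "0 \<le> t" "t \<le> e" for t
  proof -
    have in1: "x + s *\<^sub>R u + t *\<^sub>R v \<in> V" using V[of s t] that s by auto
    have "((\<lambda>t. x + s *\<^sub>R u + t *\<^sub>R v) has_derivative (\<lambda>h. h *\<^sub>R v)) (at t)"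
      by (auto intro!: derivative_eq_intros)
    from has_derivative_compose[where g="?D", OF this dF(2)[OF in1]]
    show ?thesis by (simp add: linear_scale[OF lin(2)] in1)
  qed
  obtain t where t: "0 < t" "t < e" and
    t_eq: "?D (x + s *\<^sub>R u + e *\<^sub>R v) - ?D (x + s *\<^sub>R u) =
       e * frechet_derivative ?D (at (x + s *\<^sub>R u + t *\<^sub>R v)) v"
    using mvt_simple[OF e has_derivative_at_withinI[OF 2]] by auto
  show ?thesis using that[OF s t] s_eq t_eq by (simp add: algebra_simps)
qed

lemma second_derivative_symmetric:
  assumes "smooth_near x F"
  shows "frechet_derivative (\<lambda>y. frechet_derivative F (at y) u) (at x) v =
         frechet_derivative (\<lambda>y. frechet_derivative F (at y) v) (at x) u"
proof -
  let ?H = "\<lambda>u v y. frechet_derivative (\<lambda>y. frechet_derivative F (at y) u) (at y) v"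
  obtain V where V: "open V" "x \<in> V" "\<And>k. ck_on k V F"
    using assms unfolding smooth_near_def smooth_on_def by blast
  have cont: "isCont (?H u v) x" for u v
    by (intro smooth_near_continuous smooth_near_derivative assms)
  have close: "\<bar>?H u v x - ?H v u x\<bar> < 2 * \<epsilon>" if eps: "\<epsilon> > 0" for \<epsilon>
  proof -
    obtain d1 where d1: "d1 > 0" "\<And>y. dist y x < d1 \<Longrightarrow> dist (?H u v y) (?H u v x) < \<epsilon>"
      using cont[of u v, unfolded continuous_at_eps_delta, rule_format, OF eps] by blast
    obtain d2 where d2: "d2 > 0" "\<And>y. dist y x < d2 \<Longrightarrow> dist (?H v u y) (?H v u x) < \<epsilon>"
      using cont[of v u, unfolded continuous_at_eps_delta, rule_format, OF eps] by blast
    obtain d3 where d3: "d3 > 0" "\<And>y. dist y x < d3 \<Longrightarrow> y \<in> V"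
      using V unfolding open_dist by blast
    \<comment> \<open>\<open>d1\<close> and \<open>d2\<close> control the two mixed derivatives,
      \<open>d3\<close> keeps the parallelogram inside the set where \<open>F\<close> is
      smooth.\<close>
    define d where "d = Min {d1, d2, d3}"
    have d: "d > 0" "d \<le> d1" "d \<le> d2" "d \<le> d3" using d1 d2 d3 by (auto simp: d_def)
    \<comment> \<open>The parallelogram at \<open>x\<close> with sides \<open>e u\<close> and
      \<open>e v\<close> then stays within \<open>d / 2\<close> of \<open>x\<close>. The summand 1
      keeps the denominator positive when \<open>u = v = 0\<close>.\<close>
    define e where "e = d / (2 * (norm u + norm v + 1))"
    have pos: "norm u + norm v + 1 > 0" by (simp add: add_nonneg_pos)
    have e: "e > 0" using d pos by (simp add: e_def)
    have near: "dist (x + s *\<^sub>R u + t *\<^sub>R v) x < d" if "0 \<le> s" "s \<le> e" "0 \<le> t" "t \<le> e" for s t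
    proof -
      have "dist (x + s *\<^sub>R u + t *\<^sub>R v) x \<le> norm (s *\<^sub>R u) + norm (t *\<^sub>R v)"
        by (simp add: dist_norm add.assoc del: norm_scaleR) (rule norm_triangle_ineq)
      also have "\<dots> \<le> e * norm u + e * norm v"
        using that by (auto intro!: add_mono mult_right_mono)
      also have "\<dots> \<le> e * (norm u + norm v + 1)" using e by (simp add: algebra_simps)
      also have "\<dots> = d / 2" using pos by (simp add: e_def field_simps)
      also have "\<dots> < d" using d by simp
      finally show ?thesis .
    qed
    obtain s t where st: "0 < s" "s < e" "0 < t" "t < e" and
      1: "F (x + e *\<^sub>R u + e *\<^sub>R v) - F (x + e *\<^sub>R u) - F (x + e *\<^sub>R v) + F x =
         e * e * ?H u v (x + s *\<^sub>R u + t *\<^sub>R v)"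
    proof (rule second_difference_mvt[of e x u v V F])
      show "x + s *\<^sub>R u + t *\<^sub>R v \<in> V" if "0 \<le> s" "s \<le> e" "0 \<le> t" "t \<le> e" for s t
        using near[of s t] that d d3 by auto
    qed (use V e in auto)
    obtain s' t' where st': "0 < s'" "s' < e" "0 < t'" "t' < e" and
      2: "F (x + e *\<^sub>R v + e *\<^sub>R u) - F (x + e *\<^sub>R v) - F (x + e *\<^sub>R u) + F x =
         e * e * ?H v u (x + s' *\<^sub>R v + t' *\<^sub>R u)"
    proof (rule second_difference_mvt[of e x v u V F])
      show "x + s *\<^sub>R v + t *\<^sub>R u \<in> V" if "0 \<le> s" "s \<le> e" "0 \<le> t" "t \<le> e" for s t
        using near[of t s] that d d3 by (auto simp: algebra_simps)
    qed (use V e in auto)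
    \<comment> \<open>Both sides are the same second difference of \<open>F\<close>, which is
      symmetric in \<open>u\<close> and \<open>v\<close>.\<close>
    have "e * e * ?H u v (x + s *\<^sub>R u + t *\<^sub>R v) = e * e * ?H v u (x + s' *\<^sub>R v + t' *\<^sub>R u)"
      using 1 2 by (simp add: algebra_simps)
    then have "?H u v (x + s *\<^sub>R u + t *\<^sub>R v) = ?H v u (x + s' *\<^sub>R v + t' *\<^sub>R u)" using e by simp
    moreover have "dist (?H u v (x + s *\<^sub>R u + t *\<^sub>R v)) (?H u v x) < \<epsilon>"
      using near[of s t] st d by (intro d1) auto
    moreover have "dist (?H v u (x + s' *\<^sub>R v + t' *\<^sub>R u)) (?H v u x) < \<epsilon>"
      using near[of t' s'] st' d by (intro d2) (auto simp: algebra_simps)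
    ultimately show ?thesis by (simp add: dist_real_def)
  qed
  have "\<bar>?H u v x - ?H v u x\<bar> \<le> 0"
  proof (rule field_le_epsilon)
    fix e :: real assume "e > 0"
    then show "\<bar>?H u v x - ?H v u x\<bar> \<le> 0 + e" using close[of "e/2"] by simp
  qed
  then show ?thesis by simp
qed

section \<open>Tangent vectors and vector fields\<close>

lemma frechet_derivative_cong_eventually:
  assumes "(F has_derivative F') (at x)" "\<forall>\<^sub>F y in nhds x. F y = G y"
  shows "(G has_derivative F') (at x)"
proof -
  obtain W where "open W" "x \<in> W" "\<And>y. y \<in> W \<Longrightarrow> F y = G y"
    using assms(2) unfolding eventually_nhds by blast
  then show ?thesis using has_derivative_transform_within_open[OF assms(1)] by blast
qed

section \<open>Charts, neighbourhoods and smooth functions on the manifold\<close>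

locale manifold =
  fixes \<A> :: "('p::{t2_space, second_countable_topology}, 'm::finite) chart set"
  assumes smooth_structure: "smooth_structure \<A>"
begin

lemma
  assumes "c \<in> \<A>"
  shows open_dom: "open (fst c)" and open_range: "open (snd c ` fst c)"
    and cont_chart: "continuous_on (fst c) (snd c)"
    and cont_param: "continuous_on (snd c ` fst c) (param c)"
    and param_chart: "\<And>q. q \<in> fst c \<Longrightarrow> param c (snd c q) = q"
proof -
  have "is_chart c" using assms smooth_structure[unfolded smooth_structure_def, THEN conjunct1] by blast
  then show "open (fst c)" "open (snd c ` fst c)" "continuous_on (fst c) (snd c)"
    "continuous_on (snd c ` fst c) (param c)" "\<And>q. q \<in> fst c \<Longrightarrow> param c (snd c q) = q"
    unfolding is_chart_def homeomorphism_def by simp_all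
qed

lemma charts_compatible: "c \<in> \<A> \<Longrightarrow> d \<in> \<A> \<Longrightarrow> compatible c d"
  using smooth_structure[unfolded smooth_structure_def, THEN conjunct2, THEN conjunct2, THEN conjunct1]
  by blast

lemma ex_chart: obtains c where "c \<in> \<A>" "p \<in> fst c"
  using smooth_structure[unfolded smooth_structure_def, THEN conjunct2, THEN conjunct1] by blast

lemma open_chart_image:
  assumes "c \<in> \<A>" "open U" "U \<subseteq> fst c"
  shows "open (snd c ` U)"
proof -
  have "snd c ` U = snd c ` fst c \<inter> param c -` U"
    using assms(3) param_chart[OF assms(1)] by force
  then show ?thesis
    using continuous_open_preimage[OF cont_param[OF assms(1)] open_range[OF assms(1)] assms(2)] by simp
qed

text \<open>A chart is a homeomorphism between open sets, so it carries the neighbourhood filter of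
  \<open>p\<close> to that of its image. Local statements can thus be moved freely between the
  manifold and Euclidean space.\<close>

lemma eventually_chart:
  assumes c: "c \<in> \<A>" "p \<in> fst c"
  shows "(\<forall>\<^sub>F q in nhds p. P q) \<longleftrightarrow> (\<forall>\<^sub>F x in nhds (snd c p). P (param c x))"
proof
  assume "\<forall>\<^sub>F q in nhds p. P q"
  then obtain U where U: "open U" "p \<in> U" "\<And>q. q \<in> U \<Longrightarrow> P q"
    unfolding eventually_nhds by blast
  have "open (snd c ` (U \<inter> fst c))"
    using open_chart_image[OF c(1)] U open_dom[OF c(1)] by auto
  then show "\<forall>\<^sub>F x in nhds (snd c p). P (param c x)"
    unfolding eventually_nhds
    by (intro exI[of _ "snd c ` (U \<inter> fst c)"]) (use U c param_chart in auto)
next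
  assume "\<forall>\<^sub>F x in nhds (snd c p). P (param c x)"
  then obtain V where V: "open V" "snd c p \<in> V" "\<And>x. x \<in> V \<Longrightarrow> P (param c x)"
    unfolding eventually_nhds by blast
  have "open (fst c \<inter> snd c -` V)"
    using continuous_open_preimage[OF cont_chart[OF c(1)] open_dom[OF c(1)] V(1)] .
  moreover have "P q" if "q \<in> fst c \<inter> snd c -` V" for q
    using that V(3)[of "snd c q"] param_chart[OF c(1)] by auto
  ultimately show "\<forall>\<^sub>F q in nhds p. P q"
    unfolding eventually_nhds using c V by (intro exI[of _ "fst c \<inter> snd c -` V"]) auto
qed

lemma eventually_dom: "c \<in> \<A> \<Longrightarrow> p \<in> fst c \<Longrightarrow> \<forall>\<^sub>F q in nhds p. q \<in> fst c"
  using open_dom eventually_nhds by blast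

lemma eventually_chart_param:
  assumes c: "c \<in> \<A>" "p \<in> fst c"
  shows "\<forall>\<^sub>F x in nhds (snd c p). snd c (param c x) = x"
proof -
  have "\<forall>\<^sub>F x in nhds (snd c p). x \<in> snd c ` fst c"
    using open_range[OF c(1)] c unfolding eventually_nhds by blast
  then show ?thesis by eventually_elim (use param_chart[OF c(1)] in auto)
qed

text \<open>Maximality of the atlas enters here. The restriction is wanted because
  \<open>smooth_at\<close> asks for a chart on whose whole domain the function is smooth.\<close>

lemma restrict_chart:
  assumes c: "c \<in> \<A>" and U: "open U"
  shows "(fst c \<inter> U, snd c) \<in> \<A>" (is "?c \<in> _")
proof -
  \<comment> \<open>\<open>param\<close> is an \<open>inv_into\<close>, so restricting the domain
    may change it off the new image. Continuity and smoothness therefore have to be transported by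
    congruence on that image.\<close>
  have par: "param ?c x = param c x" if x: "x \<in> snd c ` (fst c \<inter> U)" for x
  proof -
    obtain q where q: "q \<in> fst c \<inter> U" "x = snd c q" using x by auto
    have "inj_on (snd c) (fst c)" by (metis param_chart[OF c] inj_onI)
    then have "inj_on (snd c) (fst c \<inter> U)" by (rule inj_on_subset) auto
    then show ?thesis using q param_chart[OF c] by (simp add: param_def)
  qed
  have o: "open (fst c \<inter> U)" using U open_dom[OF c] by auto
  have o': "open (snd c ` (fst c \<inter> U))" using o open_chart_image[OF c] by auto
  have "is_chart ?c"
    unfolding is_chart_def homeomorphism_def
    using o o' par param_chart[OF c] continuous_on_subset[OF cont_chart[OF c], of "fst c \<inter> U"]
      continuous_on_cong[THEN iffD1, OF refl _ continuous_on_subset[OF cont_param[OF c], of "snd c ` (fst c \<inter> U)"], of "param ?c"]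
    by (auto simp: image_image)
  moreover have "compatible ?c d" if d: "d \<in> \<A>" for d
  proof -
    note comp = charts_compatible[OF c d]
    have o1: "open (snd c ` (fst c \<inter> U \<inter> fst d))" "open (snd d ` (fst c \<inter> U \<inter> fst d))"
      using o open_dom[OF d] by (auto intro!: open_chart_image c d)
    show ?thesis unfolding compatible_def smooth_on_def fst_conv snd_conv
    proof (intro conjI allI)
      fix k
      show "ck_on k (snd c ` (fst c \<inter> U \<inter> fst d)) (snd d \<circ> param ?c)"
      proof (rule ck_on_cong[OF o1(1)])
        show "ck_on k (snd c ` (fst c \<inter> U \<inter> fst d)) (snd d \<circ> param c)"
          by (rule ck_on_subset[of k "snd c ` (fst c \<inter> fst d)"])
            (use comp in \<open>auto simp: compatible_def smooth_on_def\<close>)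
      qed (use par in auto)
      show "ck_on k (snd d ` (fst c \<inter> U \<inter> fst d)) (snd c \<circ> param d)"
        by (rule ck_on_subset[of k "snd d ` (fst c \<inter> fst d)"])
          (use comp in \<open>auto simp: compatible_def smooth_on_def\<close>)
    qed
  qed
  ultimately show ?thesis using smooth_structure[unfolded smooth_structure_def, THEN conjunct2, THEN conjunct2, THEN conjunct2]
    by blast
qed

text \<open>One chart decides. From some chart \<open>d\<close> to \<open>c\<close> one composes
  with the transition map; conversely \<open>c\<close> is cut down to the preimage of the
  neighbourhood on which the function is smooth.\<close>

lemma smooth_at_iff:
  assumes c: "c \<in> \<A>" "p \<in> fst c"
  shows "smooth_at \<A> p f \<longleftrightarrow> smooth_near (snd c p) (f \<circ> param c)"
proof
  assume "smooth_at \<A> p f"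
  then obtain d where d: "d \<in> \<A>" "p \<in> fst d" "smooth_on (snd d ` fst d) (f \<circ> param d)"
    unfolding smooth_at_def by blast
  let ?S = "snd c ` (fst c \<inter> fst d)"
  have "open ?S" by (intro open_chart_image open_Int open_dom c d) auto
  moreover have "smooth_near (snd d p) (f \<circ> param d)"
    using smooth_near_mono[OF open_range[OF d(1)] _ d(3)] d(2) by blast
  moreover have "smooth_on ?S (snd d \<circ> param c)"
    using charts_compatible[OF c(1) d(1)] unfolding compatible_def by (rule conjunct1)
  ultimately have "smooth_near (snd c p) (\<lambda>y. (f \<circ> param d) ((snd d \<circ> param c) y))"
    using smooth_near_compose[of "snd d \<circ> param c" "snd c p" "f \<circ> param d" ?S] c d param_chart[OF c(1) c(2)]
    by simp
  moreover have "\<forall>\<^sub>F x in nhds (snd c p). param c x \<in> fst d"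
    by (rule eventually_chart[OF c, THEN iffD1, OF eventually_dom[OF d(1,2)]])
  then have "\<forall>\<^sub>F x in nhds (snd c p). (f \<circ> param d) ((snd d \<circ> param c) x) = (f \<circ> param c) x"
    by eventually_elim (use param_chart[OF d(1)] in auto)
  ultimately show "smooth_near (snd c p) (f \<circ> param c)" by (rule smooth_near_cong)
next
  assume "smooth_near (snd c p) (f \<circ> param c)"
  then obtain V where V: "open V" "snd c p \<in> V" "smooth_on V (f \<circ> param c)"
    unfolding smooth_near_def by blast
  define U where "U = fst c \<inter> snd c -` V"
  have U: "open U"
    unfolding U_def using continuous_open_preimage[OF cont_chart[OF c(1)] open_dom[OF c(1)] V(1)] .
  let ?c = "(fst c \<inter> U, snd c)"
  have c': "?c \<in> \<A>" using restrict_chart[OF c(1) U] .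
  have par: "param ?c (snd c q) = q" if "q \<in> fst c \<inter> U" for q
    using param_chart[OF c'] that by auto
  have "smooth_on (snd ?c ` fst ?c) (f \<circ> param ?c)"
    unfolding smooth_on_def
  proof (rule allI, rule ck_on_cong[OF open_range[OF c']])
    fix k
    show "ck_on k (snd ?c ` fst ?c) (f \<circ> param c)"
      by (rule ck_on_subset[of k V]) (use V(3) in \<open>auto simp: smooth_on_def U_def\<close>)
  qed (use par param_chart[OF c(1)] in auto)
  then show "smooth_at \<A> p f"
    unfolding smooth_at_def using c' c V by (intro bexI[of _ ?c]) (auto simp: U_def)
qed

lemma smooth_at_cong:
  assumes "smooth_at \<A> p f" "\<forall>\<^sub>F q in nhds p. f q = h q"
  shows "smooth_at \<A> p h"
proof -
  obtain c where c: "c \<in> \<A>" "p \<in> fst c" by (rule ex_chart)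
  show ?thesis
    using assms smooth_near_cong unfolding smooth_at_iff[OF c] eventually_chart[OF c] by force
qed

lemma smooth_at_eventually: "smooth_at \<A> p f \<Longrightarrow> \<forall>\<^sub>F q in nhds p. smooth_at \<A> q f"
  unfolding smooth_at_def eventually_nhds by (metis open_dom)

lemma smooth_at_const: "smooth_at \<A> p (\<lambda>q. r)"
  by (rule ex_chart[of p]) (auto simp: smooth_at_iff o_def intro: smooth_near_const)

lemma smooth_at_add: "smooth_at \<A> p f \<Longrightarrow> smooth_at \<A> p h \<Longrightarrow> smooth_at \<A> p (\<lambda>q. f q + h q)"
  by (rule ex_chart[of p]) (auto simp: smooth_at_iff o_def intro: smooth_near_add)

lemma smooth_at_mult: "smooth_at \<A> p f \<Longrightarrow> smooth_at \<A> p h \<Longrightarrow> smooth_at \<A> p (\<lambda>q. f q * h q)"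
  by (rule ex_chart[of p]) (auto simp: smooth_at_iff o_def intro: smooth_near_mult)

lemma smooth_at_diff: "smooth_at \<A> p f \<Longrightarrow> smooth_at \<A> p h \<Longrightarrow> smooth_at \<A> p (\<lambda>q. f q - h q)"
  using smooth_at_add[OF _ smooth_at_mult[OF smooth_at_const[of p "-1"]], of f h] by simp

lemma smooth_at_sum:
  "(\<And>i. i \<in> I \<Longrightarrow> smooth_at \<A> p (f i)) \<Longrightarrow> smooth_at \<A> p (\<lambda>q. \<Sum>i\<in>I. f i q)"
  by (induction I rule: infinite_finite_induct) (auto intro: smooth_at_const smooth_at_add)

text \<open>Applying a vector to these functions reads off its components. Their values outside the
  chart domain are arbitrary, which is harmless since vectors act on germs.\<close>

definition coord :: "('p, 'm) chart \<Rightarrow> 'm \<Rightarrow> 'p \<Rightarrow> real" where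
  "coord c i = (\<lambda>q. snd c q $ i)"

definition cframe :: "('p, 'm) chart \<Rightarrow> 'm \<Rightarrow> 'p vfield" where
  "cframe c i = (\<lambda>q. coord_vec \<A> c q (axis i 1))"

lemma eventually_coord:
  assumes c: "c \<in> \<A>" "p \<in> fst c"
  shows "\<forall>\<^sub>F x in nhds (snd c p). x $ i = (coord c i \<circ> param c) x"
  using eventually_chart_param[OF c] by eventually_elim (simp add: coord_def)

lemma smooth_coord:
  assumes c: "c \<in> \<A>" "p \<in> fst c"
  shows "smooth_at \<A> p (coord c i)"
  unfolding smooth_at_iff[OF c]
  by (rule smooth_near_cong[OF _ eventually_coord[OF c]])
    (use smooth_near_inner[of _ "axis i (1::real)"] in \<open>simp add: inner_axis inner_real_def\<close>)

lemma coord_vec_eq: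
  assumes c: "c \<in> \<A>" "p \<in> fst c" and f: "smooth_at \<A> p f"
  shows "((f \<circ> param c) has_derivative (\<lambda>u. coord_vec \<A> c p u f)) (at (snd c p))"
  using smooth_near_has_derivative[OF f[unfolded smooth_at_iff[OF c]]] f by (simp add: coord_vec_def)

lemma coord_vec_unique:
  assumes "c \<in> \<A>" "p \<in> fst c" "smooth_at \<A> p f" "((f \<circ> param c) has_derivative F') (at (snd c p))"
  shows "coord_vec \<A> c p u f = F' u"
  using frechet_derivative_at[OF coord_vec_eq[OF assms(1-3)]] frechet_derivative_at[OF assms(4)] by metis

lemma coord_vec_not_smooth: "\<not> smooth_at \<A> p f \<Longrightarrow> coord_vec \<A> c p u f = 0"
  by (simp add: coord_vec_def)

lemma coord_vec_coord:
  assumes c: "c \<in> \<A>" "p \<in> fst c"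
  shows "coord_vec \<A> c p u (coord c i) = u $ i"
proof (rule coord_vec_unique[OF c smooth_coord[OF c], where F'="\<lambda>u. u $ i"])
  show "((coord c i \<circ> param c) has_derivative (\<lambda>u. u $ i)) (at (snd c p))"
    by (rule frechet_derivative_cong_eventually[OF _ eventually_coord[OF c]])
      (rule bounded_linear_imp_has_derivative[OF bounded_linear_vec_nth])
qed

lemma coord_vec_linear:
  assumes c: "c \<in> \<A>" "p \<in> fst c"
  shows "linear (\<lambda>u. coord_vec \<A> c p u f)"
proof (cases "smooth_at \<A> p f")
  case True
  show ?thesis using coord_vec_eq[OF c True] by (rule has_derivative_linear)
next
  case False
  then show ?thesis by (simp add: coord_vec_not_smooth linear_iff)
qed

lemma coord_vec_add:
  assumes c: "c \<in> \<A>" "p \<in> fst c"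
  shows "coord_vec \<A> c p (u + w) = coord_vec \<A> c p u + coord_vec \<A> c p w"
  using linear_add[OF coord_vec_linear[OF c]] by (auto simp: fun_eq_iff)

lemma coord_vec_scale:
  assumes c: "c \<in> \<A>" "p \<in> fst c"
  shows "coord_vec \<A> c p (r *\<^sub>R u) = tscale r (coord_vec \<A> c p u)"
  using linear_scale[OF coord_vec_linear[OF c]] by (auto simp: fun_eq_iff tscale_def)

lemma coord_vec_zero: "c \<in> \<A> \<Longrightarrow> p \<in> fst c \<Longrightarrow> coord_vec \<A> c p 0 = 0"
  using linear_0[OF coord_vec_linear] by (auto simp: fun_eq_iff)

lemma coord_vec_expand:
  assumes c: "c \<in> \<A>" "p \<in> fst c"
  shows "coord_vec \<A> c p u f = (\<Sum>i\<in>UNIV. u $ i * cframe c i p f)"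
proof -
  interpret linear "\<lambda>u. coord_vec \<A> c p u f" by (rule coord_vec_linear[OF c])
  have "coord_vec \<A> c p u f = coord_vec \<A> c p (\<Sum>i\<in>UNIV. u $ i *\<^sub>R axis i 1) f"
    using basis_expansion[of u] by (simp add: scalar_mult_eq_scaleR)
  then show ?thesis by (simp add: sum scale cframe_def)
qed

text \<open>Chain rule for the transition map: \<open>w\<close> is its Jacobian applied to
  \<open>u\<close>. Hence \<open>tangent\<close>, a union over all charts at \<open>p\<close>, is
  exhausted by any single one of them.\<close>

lemma coord_vec_change:
  assumes c: "c \<in> \<A>" "p \<in> fst c" and d: "d \<in> \<A>" "p \<in> fst d"
  shows "\<exists>w. coord_vec \<A> c p u = coord_vec \<A> d p w"
proof -
  let ?S = "snd c ` (fst c \<inter> fst d)" and ?h = "snd d \<circ> param c"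
  have "ck_on (Suc 0) ?S ?h"
    using charts_compatible[OF c(1) d(1)] unfolding compatible_def smooth_on_def by blast
  then have h: "(?h has_derivative frechet_derivative ?h (at (snd c p))) (at (snd c p))"
    using c d by (auto simp: frechet_derivative_works[symmetric])
  have hp: "?h (snd c p) = snd d p" using param_chart[OF c(1)] c by simp
  have "\<forall>\<^sub>F x in nhds (snd c p). param c x \<in> fst d"
    by (rule eventually_chart[OF c, THEN iffD1, OF eventually_dom[OF d]])
  then have ev: "\<forall>\<^sub>F x in nhds (snd c p). (f \<circ> param d) (?h x) = (f \<circ> param c) x" for f :: "'p \<Rightarrow> real"
    by eventually_elim (use param_chart[OF d(1)] in auto)
  have "coord_vec \<A> c p u f = coord_vec \<A> d p (frechet_derivative ?h (at (snd c p)) u) f" for f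
  proof (cases "smooth_at \<A> p f")
    case True
    have *: "((\<lambda>x. (f \<circ> param d) (?h x)) has_derivative
        (\<lambda>u. coord_vec \<A> d p (frechet_derivative ?h (at (snd c p)) u) f)) (at (snd c p))"
      using has_derivative_compose[OF h, unfolded hp, OF coord_vec_eq[OF d True]] .
    show ?thesis
      by (rule coord_vec_unique[OF c True frechet_derivative_cong_eventually[OF * ev]])
  qed (simp add: coord_vec_not_smooth)
  then show ?thesis by blast
qed

lemma tangent_coord_vec:
  assumes c: "c \<in> \<A>" "p \<in> fst c" and v: "v \<in> tangent \<A> p"
  shows "v = coord_vec \<A> c p (\<chi> i. v (coord c i))"
proof -
  obtain w where w: "v = coord_vec \<A> c p w"
    using v coord_vec_change[OF _ _ c] unfolding tangent_def by blast
  have "(\<chi> i. v (coord c i)) = w" using coord_vec_coord[OF c] by (simp add: w vec_eq_iff)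
  then show ?thesis using w by simp
qed

lemma coord_vec_tangent: "c \<in> \<A> \<Longrightarrow> p \<in> fst c \<Longrightarrow> coord_vec \<A> c p u \<in> tangent \<A> p"
  unfolding tangent_def by blast

lemma tangent_expand:
  assumes "c \<in> \<A>" "p \<in> fst c" "v \<in> tangent \<A> p"
  shows "v f = (\<Sum>i\<in>UNIV. v (coord c i) * cframe c i p f)"
  using coord_vec_expand[OF assms(1,2), of "\<chi> i. v (coord c i)" f]
  by (simp add: tangent_coord_vec[OF assms, symmetric])

lemma tangent_add: "v \<in> tangent \<A> p \<Longrightarrow> w \<in> tangent \<A> p \<Longrightarrow> v + w \<in> tangent \<A> p"
  by (rule ex_chart[of p]) (metis tangent_coord_vec coord_vec_tangent coord_vec_add)

lemma tangent_scale: "v \<in> tangent \<A> p \<Longrightarrow> tscale r v \<in> tangent \<A> p"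
  by (rule ex_chart[of p]) (metis tangent_coord_vec coord_vec_tangent coord_vec_scale)

lemma tangent_zero: "0 \<in> tangent \<A> p"
  by (rule ex_chart[of p]) (metis coord_vec_tangent coord_vec_zero)

lemma diff_eq_tscale: "v - w = v + tscale (- 1) w"
  by (simp add: fun_eq_iff tscale_def)

lemma tangent_diff: "v \<in> tangent \<A> p \<Longrightarrow> w \<in> tangent \<A> p \<Longrightarrow> v - w \<in> tangent \<A> p"
  unfolding diff_eq_tscale by (intro tangent_add tangent_scale)

lemma tangent_not_smooth: "v \<in> tangent \<A> p \<Longrightarrow> \<not> smooth_at \<A> p f \<Longrightarrow> v f = 0"
  unfolding tangent_def by (auto simp: coord_vec_not_smooth)

lemma tangent_cong:
  assumes "v \<in> tangent \<A> p" "\<forall>\<^sub>F q in nhds p. f q = h q"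
  shows "v f = v h"
proof (cases "smooth_at \<A> p f")
  case True
  then have h: "smooth_at \<A> p h" using assms smooth_at_cong by blast
  obtain c u where c: "c \<in> \<A>" "p \<in> fst c" "v = coord_vec \<A> c p u"
    using assms(1) unfolding tangent_def by blast
  have "((h \<circ> param c) has_derivative (\<lambda>u. coord_vec \<A> c p u f)) (at (snd c p))"
    by (rule frechet_derivative_cong_eventually[OF coord_vec_eq[OF c(1,2) True]])
      (use assms(2) eventually_chart[OF c(1,2)] in auto)
  then show ?thesis using coord_vec_unique[OF c(1,2) h] c(3) by metis
next
  \<comment> \<open>If \<open>f\<close> is not smooth at \<open>p\<close>, neither is
    \<open>h\<close>, as smoothness is a property of the germ; both values are then the default
    0.\<close>
  case False
  moreover have "\<not> smooth_at \<A> p h"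
    using False smooth_at_cong[of p h f] assms(2) by (auto simp: eq_commute)
  ultimately show ?thesis using tangent_not_smooth[OF assms(1)] by simp
qed

lemma tangent_const: "v \<in> tangent \<A> p \<Longrightarrow> v (\<lambda>q. r) = 0"
  unfolding tangent_def using coord_vec_unique[OF _ _ smooth_at_const, where F'="\<lambda>_. 0"]
  by (auto simp: o_def)

lemma tangent_plus:
  assumes "v \<in> tangent \<A> p" and f: "smooth_at \<A> p f" and h: "smooth_at \<A> p h"
  shows "v (\<lambda>q. f q + h q) = v f + v h"
proof -
  obtain c u where c: "c \<in> \<A>" "p \<in> fst c" "v = coord_vec \<A> c p u"
    using assms(1) unfolding tangent_def by blast
  have "(((\<lambda>q. f q + h q) \<circ> param c) has_derivative
      (\<lambda>u. coord_vec \<A> c p u f + coord_vec \<A> c p u h)) (at (snd c p))"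
    using has_derivative_add[OF coord_vec_eq[OF c(1,2) f] coord_vec_eq[OF c(1,2) h]]
    by (simp add: o_def)
  then show ?thesis using coord_vec_unique[OF c(1,2) smooth_at_add[OF f h]] c(3) by simp
qed

lemma tangent_times:
  assumes "v \<in> tangent \<A> p" and f: "smooth_at \<A> p f" and h: "smooth_at \<A> p h"
  shows "v (\<lambda>q. f q * h q) = f p * v h + v f * h p"
proof -
  obtain c u where c: "c \<in> \<A>" "p \<in> fst c" "v = coord_vec \<A> c p u"
    using assms(1) unfolding tangent_def by blast
  have "(((\<lambda>q. f q * h q) \<circ> param c) has_derivative
      (\<lambda>u. f p * coord_vec \<A> c p u h + coord_vec \<A> c p u f * h p)) (at (snd c p))"
    using has_derivative_mult[OF coord_vec_eq[OF c(1,2) f] coord_vec_eq[OF c(1,2) h]]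
    by (simp add: o_def param_chart[OF c(1) c(2)])
  then show ?thesis using coord_vec_unique[OF c(1,2) smooth_at_mult[OF f h]] c(3) by simp
qed

lemma tangent_cmult:
  "v \<in> tangent \<A> p \<Longrightarrow> smooth_at \<A> p f \<Longrightarrow> v (\<lambda>q. r * f q) = r * v f"
  using tangent_times[OF _ smooth_at_const, of v p f r] tangent_const[of v p r] by simp

lemma tangent_minus:
  assumes "v \<in> tangent \<A> p" "smooth_at \<A> p f" "smooth_at \<A> p h"
  shows "v (\<lambda>q. f q - h q) = v f - v h"
  using tangent_plus[OF assms(1,2) smooth_at_mult[OF smooth_at_const[of p "-1"] assms(3)]]
    tangent_cmult[OF assms(1,3), of "-1"] by simp

lemma tangent_sum:
  assumes "v \<in> tangent \<A> p" "\<And>i. i \<in> I \<Longrightarrow> smooth_at \<A> p (f i)"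
  shows "v (\<lambda>q. \<Sum>i\<in>I. f i q) = (\<Sum>i\<in>I. v (f i))"
  using assms(2)
  by (induction I rule: infinite_finite_induct)
    (auto simp: tangent_const[OF assms(1)] tangent_plus[OF assms(1)] smooth_at_sum)

section \<open>Smooth vector fields and their brackets\<close>

lemma smooth_vf_tangent: "smooth_vf_at \<A> p X \<Longrightarrow> X p \<in> tangent \<A> p"
  unfolding smooth_vf_at_def using eventually_nhds_x_imp_x by blast

lemma smooth_vf_apply: "smooth_vf_at \<A> p X \<Longrightarrow> smooth_at \<A> p f \<Longrightarrow> smooth_at \<A> p (\<lambda>q. X q f)"
  unfolding smooth_vf_at_def using eventually_nhds_x_imp_x by blast

lemma smooth_vf_eventually: "smooth_vf_at \<A> p X \<Longrightarrow> \<forall>\<^sub>F q in nhds p. smooth_vf_at \<A> q X"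
  unfolding smooth_vf_at_def by (simp add: eventually_eventually)

lemma smooth_vfI:
  assumes "\<forall>\<^sub>F q in nhds p. X q \<in> tangent \<A> q"
    and "\<forall>\<^sub>F q in nhds p. \<forall>f. smooth_at \<A> q f \<longrightarrow> smooth_at \<A> q (\<lambda>r. X r f)"
  shows "smooth_vf_at \<A> p X"
  unfolding smooth_vf_at_def using assms by eventually_elim auto

text \<open>Constant components in a chart give a smooth field, since its action on \<open>f\<close>
  is a directional derivative of \<open>f\<close> in the chart. This yields the coordinate frame and
  an extension of every single tangent vector.\<close>

lemma smooth_vf_coord_vec:
  assumes c: "c \<in> \<A>" "p \<in> fst c"
  shows "smooth_vf_at \<A> p (\<lambda>q. coord_vec \<A> c q u)"
proof (rule smooth_vfI)
  show "\<forall>\<^sub>F q in nhds p. coord_vec \<A> c q u \<in> tangent \<A> q"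
    using eventually_dom[OF c] by eventually_elim (use coord_vec_tangent c in auto)
  show "\<forall>\<^sub>F q in nhds p. \<forall>f. smooth_at \<A> q f \<longrightarrow> smooth_at \<A> q (\<lambda>r. coord_vec \<A> c r u f)"
    using eventually_dom[OF c]
  proof (eventually_elim, intro allI impI)
    fix q f assume q: "q \<in> fst c" and f: "smooth_at \<A> q f"
    note cq = c(1) q
    have "\<forall>\<^sub>F x in nhds (snd c q). smooth_at \<A> (param c x) f"
      by (rule eventually_chart[OF cq, THEN iffD1, OF smooth_at_eventually[OF f]])
    with eventually_chart_param[OF cq]
    have "\<forall>\<^sub>F x in nhds (snd c q). frechet_derivative (f \<circ> param c) (at x) u
        = ((\<lambda>r. coord_vec \<A> c r u f) \<circ> param c) x"
      by eventually_elim (simp add: coord_vec_def)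
    then show "smooth_at \<A> q (\<lambda>r. coord_vec \<A> c r u f)"
      using smooth_near_cong smooth_near_derivative f unfolding smooth_at_iff[OF cq] by blast
  qed
qed

lemma smooth_vf_extend:
  assumes "v \<in> tangent \<A> p"
  obtains X where "smooth_vf_at \<A> p X" "X p = v"
  using assms smooth_vf_coord_vec unfolding tangent_def by force

lemma smooth_vf_add:
  assumes "smooth_vf_at \<A> p X" "smooth_vf_at \<A> p Y"
  shows "smooth_vf_at \<A> p (X + Y)"
  unfolding smooth_vf_at_def using smooth_vf_eventually[OF assms(1)] smooth_vf_eventually[OF assms(2)]
  by eventually_elim (simp add: tangent_add smooth_at_add smooth_vf_apply smooth_vf_tangent)

lemma smooth_vf_fscale:
  assumes "smooth_vf_at \<A> p X" "smooth_at \<A> p h"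
  shows "smooth_vf_at \<A> p (fscale h X)"
  unfolding smooth_vf_at_def using smooth_vf_eventually[OF assms(1)] smooth_at_eventually[OF assms(2)]
  by eventually_elim
    (simp add: fscale_def tangent_scale smooth_vf_tangent, simp add: tscale_def smooth_at_mult smooth_vf_apply)

lemma fdiff_eq_fscale: "X - Y = X + fscale (\<lambda>_. - 1) Y"
  by (simp add: fun_eq_iff fscale_def tscale_def)

lemma smooth_vf_diff:
  "smooth_vf_at \<A> p X \<Longrightarrow> smooth_vf_at \<A> p Y \<Longrightarrow> smooth_vf_at \<A> p (X - Y)"
  unfolding fdiff_eq_fscale by (intro smooth_vf_add smooth_vf_fscale smooth_at_const)

lemma smooth_vf_cframe: "c \<in> \<A> \<Longrightarrow> p \<in> fst c \<Longrightarrow> smooth_vf_at \<A> p (cframe c i)"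
  unfolding cframe_def by (rule smooth_vf_coord_vec)

text \<open>In the chart the two sides are the two orders of a mixed second derivative, so
  \<open>second_derivative_symmetric\<close> applies.\<close>

lemma cframe_commute:
  assumes c: "c \<in> \<A>" "p \<in> fst c" and f: "smooth_at \<A> p f"
  shows "cframe c i p (\<lambda>q. cframe c j q f) = cframe c j p (\<lambda>q. cframe c i q f)"
proof -
  have "cframe c i p (\<lambda>q. cframe c j q f) =
      frechet_derivative (\<lambda>x. frechet_derivative (f \<circ> param c) (at x) (axis j 1)) (at (snd c p)) (axis i 1)"
    for i j
  proof -
    have sm: "smooth_near (snd c p) (f \<circ> param c)" using f smooth_at_iff[OF c] by blast
    have "\<forall>\<^sub>F x in nhds (snd c p). smooth_at \<A> (param c x) f"
      by (rule eventually_chart[OF c, THEN iffD1, OF smooth_at_eventually[OF f]])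
    with eventually_chart_param[OF c]
    have ev: "\<forall>\<^sub>F x in nhds (snd c p). frechet_derivative (f \<circ> param c) (at x) (axis j 1)
        = ((\<lambda>q. cframe c j q f) \<circ> param c) x"
      by eventually_elim (simp add: coord_vec_def cframe_def)
    have "smooth_at \<A> p (\<lambda>q. cframe c j q f)"
      by (rule smooth_vf_apply[OF smooth_vf_cframe[OF c] f])
    then show ?thesis
      unfolding cframe_def[of c i]
      by (rule coord_vec_unique[OF c])
        (rule frechet_derivative_cong_eventually[OF
           smooth_near_has_derivative[OF smooth_near_derivative[OF sm]] ev])
  qed
  then show ?thesis using second_derivative_symmetric f smooth_at_iff[OF c] by metis
qed

text \<open>The Leibniz rule in the coordinate frame splits \<open>X (Y f)\<close> into a
  first-order part and a second-order part. By \<open>cframe_commute\<close> the second-order part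
  is symmetric in \<open>X\<close> and \<open>Y\<close>, so it drops out of the bracket.\<close>

lemma lie_expand:
  assumes X: "smooth_vf_at \<A> p X" and Y: "smooth_vf_at \<A> p Y" and f: "smooth_at \<A> p f"
    and c: "c \<in> \<A>" "p \<in> fst c"
  shows "X p (\<lambda>q. Y q f) = (\<Sum>j\<in>UNIV. X p (\<lambda>q. Y q (coord c j)) * cframe c j p f) +
    (\<Sum>j\<in>UNIV. \<Sum>i\<in>UNIV. Y p (coord c j) * X p (coord c i) * cframe c i p (\<lambda>q. cframe c j q f))"
proof -
  note Xp = smooth_vf_tangent[OF X]
  have "\<forall>\<^sub>F q in nhds p. Y q f = (\<Sum>j\<in>UNIV. Y q (coord c j) * cframe c j q f)"
    using smooth_vf_eventually[OF Y] eventually_dom[OF c]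
    by eventually_elim (use tangent_expand c smooth_vf_tangent in blast)
  then have "X p (\<lambda>q. Y q f) = X p (\<lambda>q. \<Sum>j\<in>UNIV. Y q (coord c j) * cframe c j q f)"
    by (rule tangent_cong[OF Xp])
  also have "\<dots> = (\<Sum>j\<in>UNIV. X p (\<lambda>q. Y q (coord c j) * cframe c j q f))"
    by (intro tangent_sum[OF Xp] smooth_at_mult smooth_vf_apply[OF Y] smooth_coord c
        smooth_vf_apply[OF smooth_vf_cframe[OF c] f])
  also have "\<dots> = (\<Sum>j\<in>UNIV. Y p (coord c j) * X p (\<lambda>q. cframe c j q f)
      + X p (\<lambda>q. Y q (coord c j)) * cframe c j p f)"
    by (intro sum.cong refl tangent_times[OF Xp] smooth_vf_apply[OF Y] smooth_coord c
        smooth_vf_apply[OF smooth_vf_cframe[OF c] f])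
  also have "\<dots> = (\<Sum>j\<in>UNIV. X p (\<lambda>q. Y q (coord c j)) * cframe c j p f) +
      (\<Sum>j\<in>UNIV. Y p (coord c j) * X p (\<lambda>q. cframe c j q f))"
    by (simp add: sum.distrib)
  also have "(\<Sum>j\<in>UNIV. Y p (coord c j) * X p (\<lambda>q. cframe c j q f)) =
    (\<Sum>j\<in>UNIV. \<Sum>i\<in>UNIV. Y p (coord c j) * X p (coord c i) * cframe c i p (\<lambda>q. cframe c j q f))"
    by (intro sum.cong refl) (subst tangent_expand[OF c Xp], simp add: sum_distrib_left mult.assoc)
  finally show ?thesis .
qed

lemma lie_coord_vec:
  assumes X: "smooth_vf_at \<A> p X" and Y: "smooth_vf_at \<A> p Y" and c: "c \<in> \<A>" "p \<in> fst c"
  shows "lie \<A> X Y p =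
    coord_vec \<A> c p (\<chi> j. X p (\<lambda>q. Y q (coord c j)) - Y p (\<lambda>q. X q (coord c j)))"
proof
  fix f
  show "lie \<A> X Y p f =
    coord_vec \<A> c p (\<chi> j. X p (\<lambda>q. Y q (coord c j)) - Y p (\<lambda>q. X q (coord c j))) f"
  proof (cases "smooth_at \<A> p f")
    case f: True
    \<comment> \<open>The second-order part for \<open>X, Y\<close> equals that for
      \<open>Y, X\<close>: interchange the sums, then the frame derivatives.\<close>
    have "(\<Sum>j\<in>UNIV. \<Sum>i\<in>UNIV. Y p (coord c j) * X p (coord c i) * cframe c i p (\<lambda>q. cframe c j q f))
        = (\<Sum>i\<in>UNIV. \<Sum>j\<in>UNIV. Y p (coord c j) * X p (coord c i) * cframe c i p (\<lambda>q. cframe c j q f))"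
      by (rule sum.swap)
    also have "\<dots> = (\<Sum>j\<in>UNIV. \<Sum>i\<in>UNIV. X p (coord c j) * Y p (coord c i) *
        cframe c i p (\<lambda>q. cframe c j q f))"
      by (intro sum.cong refl) (simp add: cframe_commute[OF c f] mult.commute)
    finally show ?thesis
      using f by (simp add: lie_def coord_vec_expand[OF c] lie_expand[OF X Y f c] lie_expand[OF Y X f c]
          left_diff_distrib sum_subtractf)
  qed (simp add: lie_def coord_vec_not_smooth)
qed

lemma lie_tangent:
  assumes "smooth_vf_at \<A> p X" "smooth_vf_at \<A> p Y"
  shows "lie \<A> X Y p \<in> tangent \<A> p"
  by (rule ex_chart[of p]) (simp add: lie_coord_vec assms coord_vec_tangent)

lemma smooth_vf_lie:
  assumes X: "smooth_vf_at \<A> p X" and Y: "smooth_vf_at \<A> p Y"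
  shows "smooth_vf_at \<A> p (lie \<A> X Y)"
proof (rule smooth_vfI)
  show "\<forall>\<^sub>F q in nhds p. lie \<A> X Y q \<in> tangent \<A> q"
    using smooth_vf_eventually[OF X] smooth_vf_eventually[OF Y]
    by eventually_elim (rule lie_tangent)
  show "\<forall>\<^sub>F q in nhds p. \<forall>f. smooth_at \<A> q f \<longrightarrow> smooth_at \<A> q (\<lambda>r. lie \<A> X Y r f)"
    using smooth_vf_eventually[OF X] smooth_vf_eventually[OF Y]
  proof (eventually_elim, intro allI impI)
    fix q f assume XY: "smooth_vf_at \<A> q X" "smooth_vf_at \<A> q Y" and f: "smooth_at \<A> q f"
    have "smooth_at \<A> q (\<lambda>r. X r (\<lambda>q. Y q f) - Y r (\<lambda>q. X q f))"
      by (intro smooth_at_diff smooth_vf_apply[OF XY(1)] smooth_vf_apply[OF XY(2)] f)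
    \<comment> \<open>At points where \<open>f\<close> is not smooth \<open>lie\<close> has the
      default value 0; near \<open>q\<close> this does not occur, because smoothness at a point is
      an open condition.\<close>
    moreover have "\<forall>\<^sub>F r in nhds q. X r (\<lambda>q. Y q f) - Y r (\<lambda>q. X q f) = lie \<A> X Y r f"
      using smooth_at_eventually[OF f] by eventually_elim (simp add: lie_def)
    ultimately show "smooth_at \<A> q (\<lambda>r. lie \<A> X Y r f)" by (rule smooth_at_cong)
  qed
qed

lemma lie_swap: "lie \<A> Y X p = tscale (- 1) (lie \<A> X Y p)"
  by (auto simp: lie_def tscale_def fun_eq_iff)

lemma lie_diff_left:
  assumes "smooth_vf_at \<A> p X" "smooth_vf_at \<A> p X'" "smooth_vf_at \<A> p Y"
  shows "lie \<A> (X - X') Y p = lie \<A> X Y p - lie \<A> X' Y p"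
proof
  fix f
  show "lie \<A> (X - X') Y p f = (lie \<A> X Y p - lie \<A> X' Y p) f"
  proof (cases "smooth_at \<A> p f")
    case f: True
    have "Y p (\<lambda>q. X q f - X' q f) = Y p (\<lambda>q. X q f) - Y p (\<lambda>q. X' q f)"
      by (rule tangent_minus) (use assms f smooth_vf_tangent smooth_vf_apply in blast)+
    then show ?thesis using f by (simp add: lie_def)
  qed (simp add: lie_def)
qed

lemma lie_diff_right:
  assumes "smooth_vf_at \<A> p X" "smooth_vf_at \<A> p X'" "smooth_vf_at \<A> p Y"
  shows "lie \<A> Y (X - X') p = lie \<A> Y X p - lie \<A> Y X' p"
  using lie_diff_left[OF assms] by (simp add: lie_swap[of Y] tscale_def fun_eq_iff)

end

section \<open>The Koszul expression of a possibly degenerate metric\<close>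

locale metric_manifold = manifold \<A>
  for \<A> :: "('p::{t2_space, second_countable_topology}, 'm::finite) chart set" +
  fixes g :: "'p metric"
  assumes smooth_sym_tensor: "smooth_sym_tensor \<A> g"
begin

lemma
  assumes "u \<in> tangent \<A> p" "v \<in> tangent \<A> p" "w \<in> tangent \<A> p"
  shows g_add_left: "g p (u + v) w = g p u w + g p v w"
    and g_scale_left: "g p (tscale r u) w = r * g p u w"
    and g_sym: "g p u v = g p v u"
  using smooth_sym_tensor[unfolded smooth_sym_tensor_def, THEN conjunct1, rule_format, OF assms] by auto

lemma
  assumes "u \<in> tangent \<A> p" "v \<in> tangent \<A> p" "w \<in> tangent \<A> p"
  shows g_add_right: "g p w (u + v) = g p w u + g p w v"
    and g_scale_right: "g p w (tscale r u) = r * g p w u"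
  using g_add_left[OF assms] g_scale_left[OF assms] g_sym[OF assms(3) _ assms(1)] tangent_add tangent_scale assms
  by metis+

lemma
  assumes "u \<in> tangent \<A> p" "v \<in> tangent \<A> p" "w \<in> tangent \<A> p"
  shows g_diff_left: "g p (u - v) w = g p u w - g p v w"
    and g_diff_right: "g p w (u - v) = g p w u - g p w v"
  using assms tangent_scale[OF assms(2), of "-1"]
  by (simp_all add: diff_eq_tscale g_add_left g_add_right
      g_scale_left[OF assms(2,2,3)] g_scale_right[OF assms(2,2,3)])

lemma g_zero_left: "w \<in> tangent \<A> p \<Longrightarrow> g p 0 w = 0"
  using g_diff_left[OF tangent_zero tangent_zero, of w p] by simp

lemma g_zero_right: "w \<in> tangent \<A> p \<Longrightarrow> g p w 0 = 0"
  using g_diff_right[OF tangent_zero tangent_zero, of w p] by simp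

lemma cframe_tangent: "c \<in> \<A> \<Longrightarrow> p \<in> fst c \<Longrightarrow> cframe c i p \<in> tangent \<A> p"
  unfolding cframe_def by (rule coord_vec_tangent)

lemma g_expand_left:
  assumes c: "c \<in> \<A>" "p \<in> fst c" and v: "v \<in> tangent \<A> p" and w: "w \<in> tangent \<A> p"
  shows "g p v w = (\<Sum>i\<in>UNIV. v (coord c i) * g p (cframe c i p) w)"
proof -
  interpret linear "\<lambda>u. g p (coord_vec \<A> c p u) w"
    using coord_vec_tangent[OF c] w
    by (simp add: linear_iff coord_vec_add[OF c] coord_vec_scale[OF c] g_add_left
        g_scale_left[where v=w])
  let ?u = "\<chi> i. v (coord c i)"
  have "g p v w = g p (coord_vec \<A> c p ?u) w" using tangent_coord_vec[OF c v] by simp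
  also have "\<dots> = g p (coord_vec \<A> c p (\<Sum>i\<in>UNIV. ?u $ i *\<^sub>R axis i 1)) w"
    using basis_expansion[of ?u] by (simp add: scalar_mult_eq_scaleR)
  also have "\<dots> = (\<Sum>i\<in>UNIV. ?u $ i * g p (cframe c i p) w)"
    by (simp add: sum scale cframe_def del: vec_lambda_beta)
  finally show ?thesis by simp
qed

lemma g_expand:
  assumes c: "c \<in> \<A>" "p \<in> fst c" and v: "v \<in> tangent \<A> p" and w: "w \<in> tangent \<A> p"
  shows "g p v w = (\<Sum>i\<in>UNIV. \<Sum>j\<in>UNIV. v (coord c i) * w (coord c j) * gram \<A> g c p $ i $ j)"
proof -
  have "g p (cframe c i p) w = (\<Sum>j\<in>UNIV. w (coord c j) * gram \<A> g c p $ i $ j)" for i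
    unfolding g_sym[OF cframe_tangent[OF c] w w] g_expand_left[OF c w cframe_tangent[OF c]]
    by (simp add: gram_def cframe_def coord_vec_tangent[OF c]
        g_sym[OF coord_vec_tangent[OF c] coord_vec_tangent[OF c] w])
  then show ?thesis by (simp add: g_expand_left[OF c v w] sum_distrib_left mult.assoc)
qed

lemma smooth_at_gram: "c \<in> \<A> \<Longrightarrow> p \<in> fst c \<Longrightarrow> smooth_at \<A> p (\<lambda>q. gram \<A> g c q $ i $ j)"
  using smooth_sym_tensor unfolding smooth_sym_tensor_def by blast

lemma smooth_at_metric:
  assumes X: "smooth_vf_at \<A> p X" and Y: "smooth_vf_at \<A> p Y"
  shows "smooth_at \<A> p (\<lambda>q. g q (X q) (Y q))"
proof -
  obtain c where c: "c \<in> \<A>" "p \<in> fst c" by (rule ex_chart)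
  have "smooth_at \<A> p (\<lambda>q. \<Sum>i\<in>UNIV. \<Sum>j\<in>UNIV. X q (coord c i) * Y q (coord c j) * gram \<A> g c q $ i $ j)"
    by (intro smooth_at_sum smooth_at_mult smooth_at_gram c smooth_coord
        smooth_vf_apply[OF X] smooth_vf_apply[OF Y])
  moreover have "\<forall>\<^sub>F q in nhds p. (\<Sum>i\<in>UNIV. \<Sum>j\<in>UNIV. X q (coord c i) * Y q (coord c j) *
      gram \<A> g c q $ i $ j) = g q (X q) (Y q)"
    using smooth_vf_eventually[OF X] smooth_vf_eventually[OF Y] eventually_dom[OF c]
    by eventually_elim (use g_expand c(1) smooth_vf_tangent in simp)
  ultimately show ?thesis by (rule smooth_at_cong)
qed

lemma metric_commute:
  assumes "v \<in> tangent \<A> p" "smooth_vf_at \<A> p X" "smooth_vf_at \<A> p Y"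
  shows "v (\<lambda>q. g q (X q) (Y q)) = v (\<lambda>q. g q (Y q) (X q))"
proof (rule tangent_cong[OF assms(1)])
  show "\<forall>\<^sub>F q in nhds p. g q (X q) (Y q) = g q (Y q) (X q)"
    using smooth_vf_eventually[OF assms(2)] smooth_vf_eventually[OF assms(3)]
    by eventually_elim (use g_sym smooth_vf_tangent in blast)
qed

lemma metric_vanishing_field:
  assumes X: "smooth_vf_at \<A> p X" and Y: "smooth_vf_at \<A> p Y" and Z: "smooth_vf_at \<A> p Z"
    and X0: "X p = 0"
  shows "Y p (\<lambda>q. g q (X q) (Z q)) = g p (lie \<A> Y X p) (Z p)"
    and "Y p (\<lambda>q. g q (Z q) (X q)) = g p (lie \<A> Y X p) (Z p)"
proof -
  obtain c where c: "c \<in> \<A>" "p \<in> fst c" by (rule ex_chart)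
  note Yp = smooth_vf_tangent[OF Y] and Zp = smooth_vf_tangent[OF Z]
  have "\<forall>\<^sub>F q in nhds p. g q (X q) (Z q) =
      (\<Sum>i\<in>UNIV. X q (coord c i) * g q (cframe c i q) (Z q))"
    using smooth_vf_eventually[OF X] smooth_vf_eventually[OF Z] eventually_dom[OF c]
    by eventually_elim (use g_expand_left c(1) smooth_vf_tangent in blast)
  then have "Y p (\<lambda>q. g q (X q) (Z q)) =
      Y p (\<lambda>q. \<Sum>i\<in>UNIV. X q (coord c i) * g q (cframe c i q) (Z q))"
    by (rule tangent_cong[OF Yp])
  also have "\<dots> = (\<Sum>i\<in>UNIV. Y p (\<lambda>q. X q (coord c i) * g q (cframe c i q) (Z q)))"
    by (intro tangent_sum[OF Yp] smooth_at_mult smooth_vf_apply[OF X] smooth_coord c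
        smooth_at_metric smooth_vf_cframe Z)
  also have "\<dots> = (\<Sum>i\<in>UNIV. Y p (\<lambda>q. X q (coord c i)) * g p (cframe c i p) (Z p))"
  proof (intro sum.cong refl)
    fix i
    show "Y p (\<lambda>q. X q (coord c i) * g q (cframe c i q) (Z q)) =
        Y p (\<lambda>q. X q (coord c i)) * g p (cframe c i p) (Z p)"
      using tangent_times[OF Yp smooth_vf_apply[OF X smooth_coord[OF c]]
          smooth_at_metric[OF smooth_vf_cframe[OF c] Z], of i i] X0
      by simp
  qed
  \<comment> \<open>The other half of the bracket is an application of
    \<open>X p = 0\<close>.\<close>
  also have "\<dots> = (\<Sum>i\<in>UNIV. lie \<A> Y X p (coord c i) * g p (cframe c i p) (Z p))"
    by (simp add: lie_def smooth_coord[OF c] X0)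
  also have "\<dots> = g p (lie \<A> Y X p) (Z p)"
    using g_expand_left[OF c lie_tangent[OF Y X] Zp] by simp
  finally show "Y p (\<lambda>q. g q (X q) (Z q)) = g p (lie \<A> Y X p) (Z p)" .
  then show "Y p (\<lambda>q. g q (Z q) (X q)) = g p (lie \<A> Y X p) (Z p)"
    using metric_commute[OF Yp X Z] by simp
qed

lemma g_lie_swap:
  assumes "smooth_vf_at \<A> p X" "smooth_vf_at \<A> p Y" "v \<in> tangent \<A> p"
  shows "g p (lie \<A> X Y p) v = - g p (lie \<A> Y X p) v"
  using g_scale_left[OF lie_tangent lie_tangent assms(3), of Y X Y X "-1"] assms
  by (simp add: lie_swap[of X Y])

text \<open>The terms with \<open>A p\<close> are zero; of the other four, each derivative of a
  metric product cancels against a bracket term. Together with additivity this replaces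
  function-linearity: fields with equal values at \<open>p\<close> give equal Koszul values.\<close>

lemma koszul_vanishing_left:
  assumes A: "smooth_vf_at \<A> p A" and B: "smooth_vf_at \<A> p B" and C: "smooth_vf_at \<A> p C"
    and A0: "A p = 0"
  shows "koszul \<A> g A B C p = 0"
  unfolding koszul_def A0 metric_vanishing_field(2)[OF A B C A0] metric_vanishing_field(1)[OF A C B A0]
    g_zero_right[OF lie_tangent[OF B C]] g_lie_swap[OF A B smooth_vf_tangent[OF C]]
  by simp

lemma koszul_vanishing_right:
  assumes A: "smooth_vf_at \<A> p A" and B: "smooth_vf_at \<A> p B" and C: "smooth_vf_at \<A> p C"
    and C0: "C p = 0"
  shows "koszul \<A> g A B C p = 0"
  unfolding koszul_def C0 metric_vanishing_field(2)[OF C A B C0] metric_vanishing_field(1)[OF C B A C0]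
    g_zero_right[OF lie_tangent[OF A B]] g_lie_swap[OF A C smooth_vf_tangent[OF B]]
  by simp

text \<open>Here the derivative along \<open>A\<close> adds a second copy of the term with the
  bracket of \<open>A\<close> and \<open>B\<close>, and the factor 1/2 removes the doubling. The
  surviving term vanishes in \<open>dual_at_eq\<close>, where \<open>A p\<close> is tangent to the
  hypersurface and \<open>B\<close> is zero on it.\<close>

lemma koszul_vanishing_mid:
  assumes A: "smooth_vf_at \<A> p A" and B: "smooth_vf_at \<A> p B" and C: "smooth_vf_at \<A> p C"
    and B0: "B p = 0"
  shows "koszul \<A> g A B C p = g p (lie \<A> A B p) (C p)"
  unfolding koszul_def B0 metric_vanishing_field(1)[OF B A C B0] metric_vanishing_field(2)[OF B C A B0]
    g_zero_right[OF lie_tangent[OF C A]] g_lie_swap[OF B C smooth_vf_tangent[OF A]]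
  by simp

lemma metric_diff_left:
  assumes "smooth_vf_at \<A> p X" "smooth_vf_at \<A> p X'" "smooth_vf_at \<A> p Y" "v \<in> tangent \<A> p"
  shows "v (\<lambda>q. g q (X q - X' q) (Y q)) = v (\<lambda>q. g q (X q) (Y q)) - v (\<lambda>q. g q (X' q) (Y q))"
proof -
  have "v (\<lambda>q. g q (X q - X' q) (Y q)) = v (\<lambda>q. g q (X q) (Y q) - g q (X' q) (Y q))"
  proof (rule tangent_cong[OF assms(4)])
    show "\<forall>\<^sub>F q in nhds p. g q (X q - X' q) (Y q) = g q (X q) (Y q) - g q (X' q) (Y q)"
      using smooth_vf_eventually[OF assms(1)] smooth_vf_eventually[OF assms(2)]
        smooth_vf_eventually[OF assms(3)]
      by eventually_elim (simp add: g_diff_left smooth_vf_tangent)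
  qed
  then show ?thesis
    using tangent_minus[OF assms(4) smooth_at_metric[OF assms(1,3)] smooth_at_metric[OF assms(2,3)]]
    by simp
qed

lemma metric_diff_right:
  assumes "smooth_vf_at \<A> p X" "smooth_vf_at \<A> p X'" "smooth_vf_at \<A> p Y" "v \<in> tangent \<A> p"
  shows "v (\<lambda>q. g q (Y q) (X q - X' q)) = v (\<lambda>q. g q (Y q) (X q)) - v (\<lambda>q. g q (Y q) (X' q))"
  using metric_diff_left[OF assms] metric_commute[OF assms(4,1,3)] metric_commute[OF assms(4,2,3)]
    metric_commute[OF assms(4) smooth_vf_diff[OF assms(1,2)] assms(3)]
  by simp

lemma
  assumes "smooth_vf_at \<A> p A" "smooth_vf_at \<A> p B" "smooth_vf_at \<A> p C" "smooth_vf_at \<A> p E"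
  shows koszul_diff_left: "koszul \<A> g (A - E) B C p = koszul \<A> g A B C p - koszul \<A> g E B C p"
    and koszul_diff_mid: "koszul \<A> g A (B - E) C p = koszul \<A> g A B C p - koszul \<A> g A E C p"
    and koszul_diff_right: "koszul \<A> g A B (C - E) p = koszul \<A> g A B C p - koszul \<A> g A B E p"
  using assms
  by (simp_all add: koszul_def metric_diff_left metric_diff_right lie_diff_left lie_diff_right
      g_diff_left g_diff_right smooth_vf_tangent lie_tangent smooth_vf_diff add_divide_distrib
      diff_divide_distrib)

text \<open>A constant factor suffices: \<open>dual_at\<close> sees the first field only through its
  value at \<open>p\<close>, so a variable factor may be frozen there.\<close>

lemma koszul_scale_left:
  assumes A: "smooth_vf_at \<A> p A" and B: "smooth_vf_at \<A> p B" and C: "smooth_vf_at \<A> p C"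
  shows "koszul \<A> g (fscale (\<lambda>_. r) A) B C p = r * koszul \<A> g A B C p"
proof -
  let ?A = "fscale (\<lambda>_. r) A"
  have A': "smooth_vf_at \<A> p ?A" by (intro smooth_vf_fscale A smooth_at_const)
  have Ap: "?A p = tscale r (A p)" by (simp add: fscale_def)
  have lie1: "lie \<A> ?A X p = tscale r (lie \<A> A X p)" if X: "smooth_vf_at \<A> p X" for X
  proof
    fix f
    show "lie \<A> ?A X p f = tscale r (lie \<A> A X p) f"
    proof (cases "smooth_at \<A> p f")
      case True
      have "X p (\<lambda>q. r * A q f) = r * X p (\<lambda>q. A q f)"
        by (rule tangent_cmult[OF smooth_vf_tangent[OF X] smooth_vf_apply[OF A True]])
      then show ?thesis using True by (simp add: lie_def tscale_def fscale_def algebra_simps)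
    qed (simp add: lie_def tscale_def)
  qed
  have g1: "v (\<lambda>q. g q (?A q) (X q)) = r * v (\<lambda>q. g q (A q) (X q))"
    if X: "smooth_vf_at \<A> p X" and v: "v \<in> tangent \<A> p" for X v
  proof -
    have "\<forall>\<^sub>F q in nhds p. g q (?A q) (X q) = r * g q (A q) (X q)"
      using smooth_vf_eventually[OF A] smooth_vf_eventually[OF X]
      by eventually_elim (simp add: fscale_def g_scale_left[OF smooth_vf_tangent smooth_vf_tangent smooth_vf_tangent])
    then show ?thesis
      using tangent_cong[OF v] tangent_cmult[OF v smooth_at_metric[OF A X]] by simp
  qed
  have "g p (lie \<A> B C p) (tscale r (A p)) = r * g p (lie \<A> B C p) (A p)"
    using g_scale_right[OF smooth_vf_tangent[OF A] smooth_vf_tangent[OF A] lie_tangent[OF B C]] by simp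
  moreover have "g p (lie \<A> ?A B p) (C p) = r * g p (lie \<A> A B p) (C p)"
    unfolding lie1[OF B] using g_scale_left lie_tangent[OF A B] smooth_vf_tangent[OF C] by blast
  moreover have "g p (lie \<A> C ?A p) (B p) = r * g p (lie \<A> C A p) (B p)"
    unfolding lie_swap[of C ?A] lie_swap[of C A] lie1[OF C]
    using g_scale_left[OF lie_tangent[OF A C] lie_tangent[OF A C] smooth_vf_tangent[OF B]]
      g_scale_left[OF tangent_scale[OF lie_tangent[OF A C]] lie_tangent[OF A C] smooth_vf_tangent[OF B]]
    by simp
  moreover have "B p (\<lambda>q. g q (C q) (?A q)) = r * B p (\<lambda>q. g q (C q) (A q))"
    using g1[OF C smooth_vf_tangent[OF B]] metric_commute[OF smooth_vf_tangent[OF B] _ C] A A' by simp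
  ultimately show ?thesis
    by (simp add: koszul_def g1[OF B smooth_vf_tangent[OF C]] Ap)
      (simp add: tscale_def algebra_simps)
qed

section \<open>Metricity, torsion identity and smoothness of the Koszul expression\<close>

lemma koszul_compatible:
  assumes A: "smooth_vf_at \<A> p A" and B: "smooth_vf_at \<A> p B" and C: "smooth_vf_at \<A> p C"
  shows "koszul \<A> g A B C p + koszul \<A> g A C B p = A p (\<lambda>q. g q (B q) (C q))"
proof -
  note T = smooth_vf_tangent[OF A] smooth_vf_tangent[OF B] smooth_vf_tangent[OF C]
  show ?thesis
    unfolding koszul_def metric_commute[OF T(1) B C] metric_commute[OF T(2) A C]
      metric_commute[OF T(3) A B] g_lie_swap[OF A B T(3)] g_lie_swap[OF A C T(2)] g_lie_swap[OF B C T(1)]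
    by (simp add: field_simps)
qed

text \<open>The derivative terms cancel by the symmetry of \<open>g\<close>, and of the brackets
  only two equal halves remain. Being an identity between numbers, it involves no inversion of
  \<open>g\<close>, so it is available at singular points too.\<close>

lemma koszul_torsion:
  assumes A: "smooth_vf_at \<A> p A" and B: "smooth_vf_at \<A> p B" and C: "smooth_vf_at \<A> p C"
  shows "koszul \<A> g A B C p - koszul \<A> g B A C p = g p (lie \<A> A B p) (C p)"
proof -
  note T = smooth_vf_tangent[OF A] smooth_vf_tangent[OF B] smooth_vf_tangent[OF C]
  show ?thesis
    unfolding koszul_def metric_commute[OF T(1) B C] metric_commute[OF T(2) A C]
      metric_commute[OF T(3) A B] g_lie_swap[OF B A T(3)] g_lie_swap[OF A C T(2)] g_lie_swap[OF B C T(1)]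
    by (simp add: field_simps)
qed

lemma smooth_koszul:
  assumes A: "smooth_vf_at \<A> p A" and B: "smooth_vf_at \<A> p B" and C: "smooth_vf_at \<A> p C"
  shows "smooth_at \<A> p (\<lambda>q. koszul \<A> g A B C q)"
proof -
  have "smooth_at \<A> p (\<lambda>q. koszul \<A> g A B C q * 2)"
    unfolding koszul_def divide_inverse mult.assoc
    by simp (intro smooth_at_add smooth_at_diff smooth_at_metric smooth_vf_lie A B C
        smooth_vf_apply[OF A] smooth_vf_apply[OF B] smooth_vf_apply[OF C])
  from smooth_at_mult[OF this smooth_at_const[of p "1/2"]] show ?thesis by simp
qed

end

section \<open>The metric at singular points\<close>

text \<open>If the kernel of \<open>G x\<close> has dimension at least two, two columns of \<open>G\<close> can be replaced by
  columns that vanish at \<open>x\<close> (Cramer's rule), so every term of the determinant vanishes to second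
  order.\<close>

lemma det_derivative_zero:
  fixes G :: "'a::real_normed_vector \<Rightarrow> real^'n^'n"
  assumes diff: "\<And>i j. (\<lambda>y. G y $ i $ j) differentiable (at x)"
    and u: "G x *v u = 0" "u \<noteq> 0" and w: "G x *v w = 0" "\<And>t. w \<noteq> t *\<^sub>R u"
  shows "((\<lambda>y. det (G y)) has_derivative (\<lambda>_. 0)) (at x)"
proof -
  obtain i where i: "u $ i \<noteq> 0" using u(2) by (auto simp: vec_eq_iff)
  \<comment> \<open>Another kernel vector, corrected to have \<open>i\<close>-th component 0. Column
    \<open>i\<close> is then invisible to \<open>z\<close>, so replacing it first does not disturb
    the second replacement.\<close>
  define z where "z = w - (w $ i / u $ i) *\<^sub>R u"
  have "z \<noteq> 0" using w(2)[of "w $ i / u $ i"] by (simp add: z_def)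
  then obtain j where j: "z $ j \<noteq> 0" by (auto simp: vec_eq_iff)
  have zi: "z $ i = 0" using i by (simp add: z_def)
  then have ij: "i \<noteq> j" using j by auto
  have Gz: "G x *v z = 0"
    using u(1) w(1) by (simp add: z_def matrix_vector_mult_diff_distrib matrix_vector_mult_scaleR)
  define G1 where "G1 y = (\<chi> a b. if b = i then (G y *v u) $ a else G y $ a $ b)" for y
  define G2 where "G2 y = (\<chi> a b. if b = j then (G1 y *v z) $ a else G1 y $ a $ b)" for y
  have det2: "det (G2 y) = z $ j * (u $ i * det (G y))" for y
    by (simp only: G2_def cramer_lemma G1_def)
  have G1z: "G1 y *v z = G y *v z" for y
    unfolding vec_eq_iff matrix_vector_mult_def G1_def
    by (auto intro!: sum.cong simp: zi)
  have diff_mv: "(\<lambda>y. (G y *v v) $ a) differentiable (at x)" for v a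
    unfolding matrix_vector_mult_def using diff by (auto intro!: derivative_intros)
  have diff2: "(\<lambda>y. G2 y $ a $ b) differentiable (at x)" for a b
    using diff diff_mv by (cases "b = j"; cases "b = i") (simp_all add: G2_def G1z, simp_all add: G1_def)
  have zero: "G2 x $ a $ i = 0" "G2 x $ a $ j = 0" for a
    using ij by (auto simp: G2_def G1z Gz u(1)) (simp add: G1_def u(1))
  have term0: "((\<lambda>y. \<Prod>k\<in>UNIV. G2 y $ k $ \<pi> k) has_derivative (\<lambda>_. 0)) (at x)"
    if \<pi>: "\<pi> permutes UNIV" for \<pi>
  proof -
    have "((\<lambda>y. \<Prod>k\<in>UNIV. G2 y $ k $ \<pi> k) has_derivative
        (\<lambda>h. \<Sum>k\<in>UNIV. frechet_derivative (\<lambda>y. G2 y $ k $ \<pi> k) (at x) h *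
           (\<Prod>l\<in>UNIV - {k}. G2 x $ l $ \<pi> l))) (at x)"
      using diff2 by (intro has_derivative_prod) (simp add: frechet_derivative_works)
    \<comment> \<open>A permutation picks columns \<open>i\<close> and \<open>j\<close> in two
      different rows. The product rule deletes one factor, so an entry that vanishes at
      \<open>x\<close> always remains.\<close>
    moreover have "(\<Prod>l\<in>UNIV - {k}. G2 x $ l $ \<pi> l) = 0" for k
    proof -
      obtain a b where ab: "\<pi> a = i" "\<pi> b = j" using permutes_surj[OF \<pi>] by (metis surjD)
      then have "a \<in> UNIV - {k} \<or> b \<in> UNIV - {k}" using ij by auto
      then show ?thesis using ab zero by (auto intro!: prod_zero)
    qed
    ultimately show ?thesis by simp
  qed
  have "((\<lambda>y. of_int (sign \<pi>) * (\<Prod>k\<in>UNIV. G2 y $ k $ \<pi> k)) has_derivative (\<lambda>_. 0)) (at x)"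
    if "\<pi> \<in> {\<pi>. \<pi> permutes UNIV}" for \<pi>
    using has_derivative_mult_right[OF term0, of \<pi> "of_int (sign \<pi>)"] that by simp
  from has_derivative_sum[where I="{\<pi>. \<pi> permutes UNIV}" and f'="\<lambda>_ _. 0", OF this]
  have "((\<lambda>y. det (G2 y)) has_derivative (\<lambda>_. 0)) (at x)" by (simp add: det_def)
  then have "((\<lambda>y. det (G2 y) / (z $ j * u $ i)) has_derivative (\<lambda>_. 0)) (at x)"
    by (auto intro!: derivative_eq_intros simp: i j)
  then show ?thesis using i j by (simp add: det2)
qed

context metric_manifold
begin

section \<open>Semidefiniteness and the radical at singular points\<close>

lemma smooth_at_negative:
  assumes "smooth_at \<A> p f" "f p < 0"
  shows "\<forall>\<^sub>F q in nhds p. f q < 0"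
proof -
  obtain c where c: "c \<in> \<A>" "p \<in> fst c" by (rule ex_chart)
  have "isCont (f \<circ> param c) (snd c p)"
    using assms(1) smooth_at_iff[OF c] smooth_near_continuous by blast
  moreover have "(f \<circ> param c) (snd c p) < 0" using assms(2) param_chart[OF c] by simp
  ultimately have "\<forall>\<^sub>F x in nhds (snd c p). (f \<circ> param c) x < 0"
    by (metis isCont_def order_tendstoD(2) tendsto_at_iff_tendsto_nhds)
  then show ?thesis unfolding eventually_chart[OF c] by simp
qed

lemma bilinear_gc:
  assumes "c \<in> \<A>" "p \<in> fst c"
  shows "bilinear (\<lambda>u w. g p (coord_vec \<A> c p u) (coord_vec \<A> c p w))"
  unfolding bilinear_def linear_iff
  using coord_vec_tangent[OF assms]
  by (simp add: coord_vec_add[OF assms] coord_vec_scale[OF assms] g_add_left g_add_right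
      g_scale_left[OF coord_vec_tangent[OF assms] coord_vec_tangent[OF assms] coord_vec_tangent[OF assms]]
      g_scale_right[OF coord_vec_tangent[OF assms] coord_vec_tangent[OF assms] coord_vec_tangent[OF assms]])

text \<open>An orthonormal family without timelike vectors is linearly independent, since the square
  of a combination is the sum of the squared coefficients. As large as the dimension, it spans, so
  every square is such a sum.\<close>

lemma has_index_0_nonneg:
  assumes ind: "has_index \<A> g q 0" and w: "w \<in> tangent \<A> q"
  shows "g q w w \<ge> 0"
proof -
  obtain c where c: "c \<in> \<A>" "q \<in> fst c" by (rule ex_chart)
  obtain E :: "'m \<Rightarrow> 'p tvec" where E: "\<And>i. E i \<in> tangent \<A> q"
    "\<And>i j. g q (E i) (E j) = (if i = j then 1 else 0)"
  proof -
    obtain E :: "'m \<Rightarrow> 'p tvec" and J where *: "card J = 0" "\<And>i. E i \<in> tangent \<A> q"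
      "\<And>i j. g q (E i) (E j) = (if i \<noteq> j then 0 else if i \<in> J then - 1 else 1)"
      using ind unfolding has_index_def by blast
    then have "J = {}" by simp
    with * show ?thesis by (intro that[of E]) simp_all
  qed
  define e where "e i = (\<chi> k. E i (coord c k))" for i
  have Ee: "E i = coord_vec \<A> c q (e i)" for i unfolding e_def by (rule tangent_coord_vec[OF c E(1)])
  let ?L = "\<lambda>x :: real^'m. \<Sum>i\<in>UNIV. (x $ i) *\<^sub>R e i"
  let ?B = "\<lambda>u w. g q (coord_vec \<A> c q u) (coord_vec \<A> c q w)"
  have lin: "linear (\<lambda>u. ?B u w)" "linear (?B w)" for w
    using bilinear_gc[OF c] unfolding bilinear_def by auto
  have B: "?B (?L x) (?L x) = (\<Sum>i\<in>UNIV. (x $ i)\<^sup>2)" for x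
  proof -
    have "?B (?L x) (?L x) = (\<Sum>i\<in>UNIV. \<Sum>j\<in>UNIV. x $ i * (x $ j * ?B (e j) (e i)))"
      by (simp add: linear_sum[OF lin(1)] linear_sum[OF lin(2)] linear_scale[OF lin(1)]
          linear_scale[OF lin(2)] sum_distrib_left)
    also have "\<dots> = (\<Sum>i\<in>UNIV. \<Sum>j\<in>UNIV. if i = j then (x $ i)\<^sup>2 else 0)"
      by (intro sum.cong refl) (auto simp: Ee[symmetric] E(2) power2_eq_square)
    finally show ?thesis by simp
  qed
  have linL: "linear ?L"
    by (simp add: linear_iff scaleR_add_left sum.distrib scaleR_sum_right)
  have "inj ?L"
  proof (rule linear_injective_0[OF linL, THEN iffD2], intro allI impI)
    fix x assume "?L x = 0"
    then have "(\<Sum>i\<in>UNIV. (x $ i)\<^sup>2) = 0"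
      using B[of x] coord_vec_zero[OF c] g_zero_left[OF tangent_zero] by simp
    then show "x = 0" by (simp add: sum_nonneg_eq_0_iff vec_eq_iff)
  qed
  then have "surj ?L" by (intro linear_injective_imp_surjective[OF linL] refl)
  then obtain x where x: "(\<chi> k. w (coord c k)) = ?L x" by (rule surjE)
  have "w = coord_vec \<A> c q (?L x)" unfolding x[symmetric] by (rule tangent_coord_vec[OF c w])
  then show ?thesis using B[of x] by (simp add: sum_nonneg)
qed

text \<open>A vector with negative square would extend to a field with negative squares on a whole
  neighbourhood, which would then contain no Riemannian point.\<close>

lemma metric_nonneg:
  assumes "riemann_lorentz \<A> g" "p \<in> Sing \<A> g" and v: "v \<in> tangent \<A> p"
  shows "g p v v \<ge> 0"
proof (rule ccontr)
  assume neg: "\<not> g p v v \<ge> 0"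
  obtain X where X: "smooth_vf_at \<A> p X" "X p = v" by (rule smooth_vf_extend[OF v])
  have "\<forall>\<^sub>F q in nhds p. g q (X q) (X q) < 0"
    by (rule smooth_at_negative[OF smooth_at_metric[OF X(1) X(1)]]) (use neg X in auto)
  with smooth_vf_eventually[OF X(1)] have "\<forall>\<^sub>F q in nhds p. \<not> has_index \<A> g q 0"
    by eventually_elim (use has_index_0_nonneg smooth_vf_tangent in fastforce)
  moreover have "\<exists>\<^sub>F q in nhds p. has_index \<A> g q 0"
    using assms(1,2) unfolding riemann_lorentz_def by blast
  ultimately show False by (simp add: frequently_def)
qed

lemma null_imp_Rad:
  assumes rl: "riemann_lorentz \<A> g" "p \<in> Sing \<A> g" and v: "v \<in> tangent \<A> p" and v0: "g p v v = 0"
  shows "v \<in> Rad \<A> g p"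
proof -
  have "g p v w = 0" if w: "w \<in> tangent \<A> p" for w
  proof (rule ccontr)
    assume n: "g p v w \<noteq> 0"
    \<comment> \<open>Solves \<open>2 * t * g p v w + g p w w = - 1\<close>, so that
      \<open>t v + w\<close> has square -1, against semidefiniteness.\<close>
    define t where "t = - (g p w w + 1) / (2 * g p v w)"
    have tv: "tscale t v \<in> tangent \<A> p" by (rule tangent_scale[OF v])
    have "g p (tscale t v + w) (tscale t v + w) = t * (t * g p v v) + 2 * t * g p v w + g p w w"
      using tv v w
      by (simp add: g_add_left g_add_right tangent_add g_scale_left[OF v v tv] g_scale_right[OF v v v]
          g_scale_left[OF v v w] g_scale_right[OF v v w] g_sym[OF w v v])
    also have "\<dots> = - 1" using n by (simp add: v0 t_def field_simps)
    finally show False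
      using metric_nonneg[OF rl tangent_add[OF tv w]] by simp
  qed
  then show ?thesis using v by (simp add: Rad_def)
qed

lemma Rad_coords:
  assumes c: "c \<in> \<A>" "p \<in> fst c" and v: "v \<in> Rad \<A> g p"
  shows "gram \<A> g c p *v (\<chi> i. v (coord c i)) = 0"
proof -
  have vt: "v \<in> tangent \<A> p" using v by (simp add: Rad_def)
  have "(gram \<A> g c p *v (\<chi> i. v (coord c i))) $ a = g p v (cframe c a p)" for a
    unfolding g_expand_left[OF c vt cframe_tangent[OF c]]
    by (auto simp: matrix_vector_mult_def gram_def cframe_def mult.commute intro!: sum.cong
       g_sym[OF coord_vec_tangent[OF c] coord_vec_tangent[OF c] coord_vec_tangent[OF c]])
  then show ?thesis using v cframe_tangent[OF c] by (simp add: vec_eq_iff Rad_def)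
qed

text \<open>Two independent radical vectors are independent kernel vectors of the Gram matrix, and
  \<open>det_derivative_zero\<close> would make the differential of the determinant vanish.\<close>

lemma Rad_one_dimensional:
  assumes tr: "transverse \<A> g" and p: "p \<in> Sing \<A> g"
    and r: "r \<in> Rad \<A> g p" "r \<noteq> 0" and v: "v \<in> Rad \<A> g p"
  obtains t where "v = tscale t r"
proof -
  obtain c where c: "c \<in> \<A>" "p \<in> fst c" by (rule ex_chart)
  let ?u = "\<chi> i. r (coord c i)" and ?w = "\<chi> i. v (coord c i)"
  have rv: "r = coord_vec \<A> c p ?u" "v = coord_vec \<A> c p ?w"
    using r v by (auto simp: Rad_def intro!: tangent_coord_vec[OF c])
  let ?G = "\<lambda>x. gram \<A> g c (param c x)"
  have G0: "?G (snd c p) = gram \<A> g c p" by (simp add: param_chart[OF c])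
  have "\<exists>t. ?w = t *\<^sub>R ?u"
  proof (rule ccontr)
    assume n: "\<nexists>t. ?w = t *\<^sub>R ?u"
    have "((\<lambda>x. det (?G x)) has_derivative (\<lambda>_. 0)) (at (snd c p))"
    proof (rule det_derivative_zero[of _ _ ?u ?w])
      fix i j
      have "smooth_near (snd c p) ((\<lambda>q. gram \<A> g c q $ i $ j) \<circ> param c)"
        using smooth_at_gram[OF c] smooth_at_iff[OF c] by blast
      from smooth_near_has_derivative[OF this]
      show "(\<lambda>x. ?G x $ i $ j) differentiable at (snd c p)"
        by (auto simp: differentiable_def o_def)
      show "?u \<noteq> 0" using r(2) rv(1) coord_vec_zero[OF c] by metis
    qed (use Rad_coords[OF c] r v n in \<open>auto simp: G0\<close>)
    then have "frechet_derivative (\<lambda>x. det (?G x)) (at (snd c p)) u = 0" for u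
      by (rule frechet_eq)
    then show False using tr c p unfolding transverse_def by blast
  qed
  then obtain t where "?w = t *\<^sub>R ?u" by blast
  then have "v = tscale t r" using rv coord_vec_scale[OF c] by metis
  then show ?thesis by (rule that)
qed

end

section \<open>Calculus on the singular hypersurface\<close>

context metric_manifold
begin

abbreviation S :: "'p set" where "S \<equiv> Sing \<A> g"
abbreviation TS :: "'p \<Rightarrow> 'p tvec set" where "TS \<equiv> tangentS \<A> g"
abbreviation ext_fun :: "'p \<Rightarrow> ('p \<Rightarrow> real) \<Rightarrow> ('p \<Rightarrow> real) \<Rightarrow> bool" where
  "ext_fun \<equiv> extends_fun \<A> g"
abbreviation ext_vf :: "'p \<Rightarrow> 'p vfield \<Rightarrow> 'p vfield \<Rightarrow> bool" where "ext_vf \<equiv> extends_vf \<A> g"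
abbreviation act :: "'p \<Rightarrow> 'p tvec \<Rightarrow> ('p \<Rightarrow> real) \<Rightarrow> real" where "act \<equiv> actS \<A> g"

lemma TS_tangent: "v \<in> TS p \<Longrightarrow> v \<in> tangent \<A> p"
  by (simp add: tangentS_def)

lemma TS_D: "v \<in> TS p \<Longrightarrow> smooth_at \<A> p f \<Longrightarrow> \<forall>\<^sub>F q in nhds p. q \<in> S \<longrightarrow> f q = 0 \<Longrightarrow> v f = 0"
  by (simp add: tangentS_def)

lemma TS_add: "v \<in> TS p \<Longrightarrow> w \<in> TS p \<Longrightarrow> v + w \<in> TS p"
  by (simp add: tangentS_def tangent_add)

lemma TS_scale: "v \<in> TS p \<Longrightarrow> tscale r v \<in> TS p"
  by (simp add: tangentS_def tangent_scale) (simp add: tscale_def)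

text \<open>The difference \<open>f - h\<close> is one of the functions that \<open>tangentS\<close>
  requires the vector to annihilate. This is the source of independence from extensions.\<close>

lemma TS_cong:
  assumes "v \<in> TS p" "smooth_at \<A> p f" "smooth_at \<A> p h" "\<forall>\<^sub>F q in nhds p. q \<in> S \<longrightarrow> f q = h q"
  shows "v f = v h"
proof -
  have "\<forall>\<^sub>F q in nhds p. q \<in> S \<longrightarrow> f q - h q = 0" using assms(4) by eventually_elim simp
  then have "v (\<lambda>q. f q - h q) = 0" using TS_D[OF assms(1)] smooth_at_diff assms(2,3) by blast
  then show ?thesis using tangent_minus[OF TS_tangent[OF assms(1)] assms(2,3)] by simp
qed

lemma ext_funI:
  "smooth_at \<A> p k \<Longrightarrow> \<forall>\<^sub>F q in nhds p. q \<in> S \<longrightarrow> k q = h q \<Longrightarrow> ext_fun p h k"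
  by (simp add: extends_fun_def)

lemma ext_fun_smooth: "ext_fun p h k \<Longrightarrow> smooth_at \<A> p k"
  by (simp add: extends_fun_def)

lemma ext_fun_eq: "ext_fun p h k \<Longrightarrow> \<forall>\<^sub>F q in nhds p. q \<in> S \<longrightarrow> k q = h q"
  by (simp add: extends_fun_def)

lemma ext_fun_value: "ext_fun p h k \<Longrightarrow> p \<in> S \<Longrightarrow> k p = h p"
  using ext_fun_eq eventually_nhds_x_imp_x by blast

lemma ext_fun_eventually: "ext_fun p h k \<Longrightarrow> \<forall>\<^sub>F q in nhds p. ext_fun q h k"
  unfolding extends_fun_def
  by (intro eventually_conj) (use smooth_at_eventually eventually_eventually in blast)+

lemma ext_vfI:
  "smooth_vf_at \<A> p B \<Longrightarrow> \<forall>\<^sub>F q in nhds p. q \<in> S \<longrightarrow> B q = A q \<Longrightarrow> ext_vf p A B"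
  by (simp add: extends_vf_def)

lemma ext_vf_smooth: "ext_vf p A B \<Longrightarrow> smooth_vf_at \<A> p B"
  by (simp add: extends_vf_def)

lemma ext_vf_eq: "ext_vf p A B \<Longrightarrow> \<forall>\<^sub>F q in nhds p. q \<in> S \<longrightarrow> B q = A q"
  by (simp add: extends_vf_def)

lemma ext_vf_value: "ext_vf p A B \<Longrightarrow> p \<in> S \<Longrightarrow> B p = A p"
  using ext_vf_eq eventually_nhds_x_imp_x by blast

lemma ext_vf_eventually: "ext_vf p A B \<Longrightarrow> \<forall>\<^sub>F q in nhds p. ext_vf q A B"
  unfolding extends_vf_def
  by (intro eventually_conj) (use smooth_vf_eventually eventually_eventually in blast)+

text \<open>Resolves the definite description in \<open>actS\<close>: any two extensions of
  \<open>h\<close> agree on the hypersurface near \<open>p\<close>, so \<open>TS_cong\<close>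
  identifies their derivatives.\<close>

lemma act_eq:
  assumes "v \<in> TS p" "ext_fun p h k"
  shows "act p v h = v k"
  unfolding actS_def
proof (rule the_equality)
  show "\<exists>k'. ext_fun p h k' \<and> v k = v k'" using assms(2) by blast
  show "r = v k" if r: "\<exists>k. ext_fun p h k \<and> r = v k" for r
  proof -
    obtain k' where k': "ext_fun p h k'" "r = v k'" using r by blast
    have "\<forall>\<^sub>F q in nhds p. q \<in> S \<longrightarrow> k' q = k q"
      using ext_fun_eq[OF k'(1)] ext_fun_eq[OF assms(2)] by eventually_elim auto
    then show ?thesis
      using TS_cong[OF assms(1) ext_fun_smooth[OF k'(1)] ext_fun_smooth[OF assms(2)]] k'(2) by simp
  qed
qed

lemma ext_fun_const: "ext_fun p (\<lambda>q. r) (\<lambda>q. r)"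
  by (rule ext_funI[OF smooth_at_const]) simp

lemma ext_fun_add: "ext_fun p h k \<Longrightarrow> ext_fun p h' k' \<Longrightarrow> ext_fun p (\<lambda>q. h q + h' q) (\<lambda>q. k q + k' q)"
  by (rule ext_funI[OF smooth_at_add[OF ext_fun_smooth ext_fun_smooth]])
    (auto dest!: ext_fun_eq elim: eventually_elim2)

lemma ext_fun_diff: "ext_fun p h k \<Longrightarrow> ext_fun p h' k' \<Longrightarrow> ext_fun p (\<lambda>q. h q - h' q) (\<lambda>q. k q - k' q)"
  by (rule ext_funI[OF smooth_at_diff[OF ext_fun_smooth ext_fun_smooth]])
    (auto dest!: ext_fun_eq elim: eventually_elim2)

lemma ext_fun_mult: "ext_fun p h k \<Longrightarrow> ext_fun p h' k' \<Longrightarrow> ext_fun p (\<lambda>q. h q * h' q) (\<lambda>q. k q * k' q)"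
  by (rule ext_funI[OF smooth_at_mult[OF ext_fun_smooth ext_fun_smooth]])
    (auto dest!: ext_fun_eq elim: eventually_elim2)

lemma ext_vf_add: "ext_vf p X X' \<Longrightarrow> ext_vf p Y Y' \<Longrightarrow> ext_vf p (X + Y) (X' + Y')"
  by (rule ext_vfI[OF smooth_vf_add[OF ext_vf_smooth ext_vf_smooth]])
    (auto dest!: ext_vf_eq elim: eventually_elim2)

lemma ext_vf_fscale: "ext_fun p h k \<Longrightarrow> ext_vf p X X' \<Longrightarrow> ext_vf p (fscale h X) (fscale k X')"
  by (rule ext_vfI[OF smooth_vf_fscale[OF ext_vf_smooth ext_fun_smooth]])
    (auto dest!: ext_vf_eq ext_fun_eq elim: eventually_elim2 simp: fscale_def)

lemma ext_vf_apply: "ext_vf p X X' \<Longrightarrow> smooth_at \<A> p f \<Longrightarrow> ext_fun p (\<lambda>q. X q f) (\<lambda>q. X' q f)"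
  by (rule ext_funI[OF smooth_vf_apply[OF ext_vf_smooth]])
    (auto dest!: ext_vf_eq elim: eventually_mono)

lemma ext_metric:
  "ext_vf p X X' \<Longrightarrow> ext_vf p Y Y' \<Longrightarrow> ext_fun p (\<lambda>q. g q (X q) (Y q)) (\<lambda>q. g q (X' q) (Y' q))"
  by (rule ext_funI[OF smooth_at_metric[OF ext_vf_smooth ext_vf_smooth]])
    (auto dest!: ext_vf_eq elim: eventually_elim2)

lemma CinfS_D: "h \<in> CinfS \<A> g \<Longrightarrow> p \<in> S \<Longrightarrow> \<exists>k. ext_fun p h k"
  by (simp add: CinfS_def)

lemma CinfS_I: "(\<And>p. p \<in> S \<Longrightarrow> \<exists>k. ext_fun p h k) \<Longrightarrow> h \<in> CinfS \<A> g"
  by (simp add: CinfS_def)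

lemma CinfS_const: "(\<lambda>q. r) \<in> CinfS \<A> g"
  by (rule CinfS_I, rule exI, rule ext_fun_const)

lemma CinfS_add: "h \<in> CinfS \<A> g \<Longrightarrow> k \<in> CinfS \<A> g \<Longrightarrow> (\<lambda>q. h q + k q) \<in> CinfS \<A> g"
  by (rule CinfS_I) (drule (1) CinfS_D, drule (1) CinfS_D, elim exE, rule exI, rule ext_fun_add)

lemma CinfS_diff: "h \<in> CinfS \<A> g \<Longrightarrow> k \<in> CinfS \<A> g \<Longrightarrow> (\<lambda>q. h q - k q) \<in> CinfS \<A> g"
  by (rule CinfS_I) (drule (1) CinfS_D, drule (1) CinfS_D, elim exE, rule exI, rule ext_fun_diff)

lemma CinfS_mult: "h \<in> CinfS \<A> g \<Longrightarrow> k \<in> CinfS \<A> g \<Longrightarrow> (\<lambda>q. h q * k q) \<in> CinfS \<A> g"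
  by (rule CinfS_I) (drule (1) CinfS_D, drule (1) CinfS_D, elim exE, rule exI, rule ext_fun_mult)

section \<open>Vector fields on the hypersurface: module structure, derivations and brackets\<close>

lemma fieldsS_along: "X \<in> fieldsS \<A> g \<Longrightarrow> X \<in> fields_along \<A> g"
  by (simp add: fieldsS_def)

lemma fieldsS_TS: "X \<in> fieldsS \<A> g \<Longrightarrow> p \<in> S \<Longrightarrow> X p \<in> TS p"
  by (simp add: fieldsS_def)

lemma along_tangent: "X \<in> fields_along \<A> g \<Longrightarrow> X p \<in> tangent \<A> p"
  by (cases "p \<in> S") (auto simp: fields_along_def tangent_zero)

lemma along_zero: "X \<in> fields_along \<A> g \<Longrightarrow> p \<notin> S \<Longrightarrow> X p = 0"
  by (simp add: fields_along_def)

lemma along_ext: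
  assumes "X \<in> fields_along \<A> g" "p \<in> S"
  obtains X' where "ext_vf p X X'"
  using assms by (auto simp: fields_along_def)

lemma fieldsS_I:
  assumes "\<And>p. p \<notin> S \<Longrightarrow> X p = 0" "\<And>p. p \<in> S \<Longrightarrow> X p \<in> TS p" "\<And>p. p \<in> S \<Longrightarrow> \<exists>X'. ext_vf p X X'"
  shows "X \<in> fieldsS \<A> g"
  using assms TS_tangent by (simp add: fieldsS_def fields_along_def)

lemma fieldsS_add:
  assumes "X \<in> fieldsS \<A> g" "Y \<in> fieldsS \<A> g"
  shows "X + Y \<in> fieldsS \<A> g"
proof (rule fieldsS_I)
  show "\<exists>X'. ext_vf p (X + Y) X'" if "p \<in> S" for p
    using along_ext[OF fieldsS_along[OF assms(1)] that] along_ext[OF fieldsS_along[OF assms(2)] that]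
      ext_vf_add by metis
qed (use assms in \<open>auto simp: along_zero fieldsS_along TS_add fieldsS_TS\<close>)

lemma fieldsS_fscale:
  assumes "X \<in> fieldsS \<A> g" "h \<in> CinfS \<A> g"
  shows "fscale h X \<in> fieldsS \<A> g"
proof (rule fieldsS_I)
  show "\<exists>X'. ext_vf p (fscale h X) X'" if "p \<in> S" for p
    using along_ext[OF fieldsS_along[OF assms(1)] that] CinfS_D[OF assms(2) that] ext_vf_fscale by metis
  show "fscale h X p = 0" if "p \<notin> S" for p
    using along_zero[OF fieldsS_along[OF assms(1)] that] by (simp add: fscale_def tscale_def fun_eq_iff)
qed (use assms in \<open>auto simp: TS_scale fieldsS_TS fscale_def\<close>)

lemma fieldsS_diff: "X \<in> fieldsS \<A> g \<Longrightarrow> Y \<in> fieldsS \<A> g \<Longrightarrow> X - Y \<in> fieldsS \<A> g"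
  unfolding fdiff_eq_fscale by (intro fieldsS_add fieldsS_fscale CinfS_const)

lemma act_add:
  assumes "v \<in> TS p" "ext_fun p h k" "ext_fun p h' k'"
  shows "act p v (\<lambda>q. h q + h' q) = act p v h + act p v h'"
  by (simp add: act_eq[OF assms(1) ext_fun_add[OF assms(2,3)]]
      tangent_plus[OF TS_tangent[OF assms(1)] ext_fun_smooth[OF assms(2)] ext_fun_smooth[OF assms(3)]]
      act_eq[OF assms(1,2)] act_eq[OF assms(1,3)])

lemma act_mult:
  assumes "v \<in> TS p" "ext_fun p h k" "ext_fun p h' k'" "p \<in> S"
  shows "act p v (\<lambda>q. h q * h' q) = h p * act p v h' + act p v h * h' p"
  by (simp add: act_eq[OF assms(1) ext_fun_mult[OF assms(2,3)]] act_eq[OF assms(1,2)] act_eq[OF assms(1,3)]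
      tangent_times[OF TS_tangent[OF assms(1)] ext_fun_smooth[OF assms(2)] ext_fun_smooth[OF assms(3)]]
      ext_fun_value[OF assms(2,4)] ext_fun_value[OF assms(3,4)])

text \<open>\<open>act\<close> takes a function on all of the manifold, whereas identities for
  \<rho> and for the metric on fields along the hypersurface are known on the hypersurface
  only.\<close>

lemma act_cong_S:
  assumes "\<And>q. q \<in> S \<Longrightarrow> h q = h' q"
  shows "act p v h = act p v h'"
proof -
  have "ext_fun p h = ext_fun p h'" using assms by (auto simp: extends_fun_def fun_eq_iff elim!: eventually_mono)
  then show ?thesis by (simp add: actS_def)
qed

lemma ext_act:
  assumes X: "X \<in> fieldsS \<A> g" "ext_vf p X X'" and h: "ext_fun p h k"
  shows "ext_fun p (\<lambda>q. act q (X q) h) (\<lambda>q. X' q k)"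
proof (rule ext_funI)
  show "smooth_at \<A> p (\<lambda>q. X' q k)" by (rule smooth_vf_apply[OF ext_vf_smooth[OF X(2)] ext_fun_smooth[OF h]])
  show "\<forall>\<^sub>F q in nhds p. q \<in> S \<longrightarrow> X' q k = act q (X q) h"
    using ext_fun_eventually[OF h] ext_vf_eq[OF X(2)]
    by eventually_elim (auto simp: act_eq fieldsS_TS[OF X(1)])
qed

lemma CinfS_act: "X \<in> fieldsS \<A> g \<Longrightarrow> h \<in> CinfS \<A> g \<Longrightarrow> (\<lambda>q. act q (X q) h) \<in> CinfS \<A> g"
  by (rule CinfS_I, drule (1) CinfS_D, elim exE, rule along_ext[OF fieldsS_along], assumption, assumption,
      rule exI, rule ext_act)

lemma lieS_eq:
  assumes p: "p \<in> S" and X: "X \<in> fieldsS \<A> g" "ext_vf p X X'" and Y: "Y \<in> fieldsS \<A> g" "ext_vf p Y Y'"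
  shows "lieS \<A> g X Y p = lie \<A> X' Y' p"
  using p by (auto simp: lieS_def lie_def fun_eq_iff act_eq[OF fieldsS_TS[OF X(1) p] ext_vf_apply[OF Y(2)]]
      act_eq[OF fieldsS_TS[OF Y(1) p] ext_vf_apply[OF X(2)]] ext_vf_value[OF X(2) p] ext_vf_value[OF Y(2) p])

lemma ext_lieS:
  assumes X: "X \<in> fieldsS \<A> g" "ext_vf p X X'" and Y: "Y \<in> fieldsS \<A> g" "ext_vf p Y Y'"
  shows "ext_vf p (lieS \<A> g X Y) (lie \<A> X' Y')"
proof (rule ext_vfI[OF smooth_vf_lie[OF ext_vf_smooth[OF X(2)] ext_vf_smooth[OF Y(2)]]])
  show "\<forall>\<^sub>F q in nhds p. q \<in> S \<longrightarrow> lie \<A> X' Y' q = lieS \<A> g X Y q"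
    using ext_vf_eventually[OF X(2)] ext_vf_eventually[OF Y(2)]
    by eventually_elim (use lieS_eq X(1) Y(1) in auto)
qed

text \<open>On the hypersurface \<open>X'\<close> is tangent to it, so it sends a function vanishing
  there to another such function, which \<open>v\<close> annihilates. Applied to both orders of
  differentiation, this makes the bracket of tangent fields tangent.\<close>

lemma act_vanishing:
  assumes X: "X \<in> fieldsS \<A> g" "ext_vf p X X'" and f: "smooth_at \<A> p f" "\<forall>\<^sub>F q in nhds p. q \<in> S \<longrightarrow> f q = 0"
    and v: "v \<in> TS p"
  shows "v (\<lambda>q. X' q f) = 0"
proof (rule TS_D[OF v smooth_vf_apply[OF ext_vf_smooth[OF X(2)] f(1)]])
  have "\<forall>\<^sub>F q in nhds p. \<forall>\<^sub>F q in nhds q. q \<in> S \<longrightarrow> f q = 0" using f(2) by (simp add: eventually_eventually)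
  with smooth_at_eventually[OF f(1)] ext_vf_eq[OF X(2)]
  show "\<forall>\<^sub>F q in nhds p. q \<in> S \<longrightarrow> X' q f = 0"
    by eventually_elim (use TS_D fieldsS_TS[OF X(1)] in auto)
qed

lemma fieldsS_lieS:
  assumes X: "X \<in> fieldsS \<A> g" and Y: "Y \<in> fieldsS \<A> g"
  shows "lieS \<A> g X Y \<in> fieldsS \<A> g"
proof (rule fieldsS_I)
  fix p assume p: "p \<in> S"
  obtain X' where X': "ext_vf p X X'" using along_ext[OF fieldsS_along[OF X] p] .
  obtain Y' where Y': "ext_vf p Y Y'" using along_ext[OF fieldsS_along[OF Y] p] .
  show "\<exists>Z. ext_vf p (lieS \<A> g X Y) Z" using ext_lieS X X' Y Y' by blast
  have "lie \<A> X' Y' p f = 0" if f: "smooth_at \<A> p f" "\<forall>\<^sub>F q in nhds p. q \<in> S \<longrightarrow> f q = 0" for f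
    using f act_vanishing[OF X X' f fieldsS_TS[OF Y p]] act_vanishing[OF Y Y' f fieldsS_TS[OF X p]]
    by (simp add: lie_def ext_vf_value[OF X' p] ext_vf_value[OF Y' p])
  then show "lieS \<A> g X Y p \<in> TS p"
    unfolding lieS_eq[OF p X X' Y Y'] tangentS_def
    using lie_tangent[OF ext_vf_smooth[OF X'] ext_vf_smooth[OF Y']] by blast
qed (simp add: lieS_def fun_eq_iff)

lemma lieS_swap: "lieS \<A> g Y X = fscale (\<lambda>_. - 1) (lieS \<A> g X Y)"
  by (auto simp: lieS_def fun_eq_iff fscale_def tscale_def)

lemma lieS_add_left:
  assumes X: "X \<in> fieldsS \<A> g" and Y: "Y \<in> fieldsS \<A> g" and Z: "Z \<in> fieldsS \<A> g"
  shows "lieS \<A> g (X + Y) Z = lieS \<A> g X Z + lieS \<A> g Y Z"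
proof (intro ext)
  fix p f
  show "lieS \<A> g (X + Y) Z p f = (lieS \<A> g X Z + lieS \<A> g Y Z) p f"
  proof (cases "p \<in> S \<and> smooth_at \<A> p f")
    case True
    then have p: "p \<in> S" and f: "smooth_at \<A> p f" by auto
    obtain X' where X': "ext_vf p X X'" using along_ext[OF fieldsS_along[OF X] p] .
    obtain Y' where Y': "ext_vf p Y Y'" using along_ext[OF fieldsS_along[OF Y] p] .
    obtain Z' where Z': "ext_vf p Z Z'" using along_ext[OF fieldsS_along[OF Z] p] .
    note act_Z = act_eq[OF _ ext_vf_apply[OF Z' f]]
    show ?thesis
      using True act_Z[OF fieldsS_TS[OF X p]] act_Z[OF fieldsS_TS[OF Y p]]
        act_Z[OF TS_add[OF fieldsS_TS[OF X p] fieldsS_TS[OF Y p]]]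
        act_add[OF fieldsS_TS[OF Z p] ext_vf_apply[OF X' f] ext_vf_apply[OF Y' f]]
      by (simp add: lieS_def)
  qed (auto simp: lieS_def)
qed

lemma lieS_fscale_left:
  assumes X: "X \<in> fieldsS \<A> g" and Z: "Z \<in> fieldsS \<A> g" and h: "h \<in> CinfS \<A> g"
  shows "lieS \<A> g (fscale h X) Z = fscale h (lieS \<A> g X Z) - fscale (\<lambda>p. act p (Z p) h) X"
proof (intro ext)
  fix p f
  show "lieS \<A> g (fscale h X) Z p f = (fscale h (lieS \<A> g X Z) - fscale (\<lambda>p. act p (Z p) h) X) p f"
  proof (cases "p \<in> S \<and> smooth_at \<A> p f")
    case True
    then have p: "p \<in> S" and f: "smooth_at \<A> p f" by auto
    obtain X' where X': "ext_vf p X X'" using along_ext[OF fieldsS_along[OF X] p] .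
    obtain Z' where Z': "ext_vf p Z Z'" using along_ext[OF fieldsS_along[OF Z] p] .
    obtain k where k: "ext_fun p h k" using CinfS_D[OF h p] by blast
    note act_Z = act_eq[OF _ ext_vf_apply[OF Z' f]]
    show ?thesis
      using True act_Z[OF fieldsS_TS[OF X p]] act_Z[OF TS_scale[OF fieldsS_TS[OF X p]], of "h p"]
        act_mult[OF fieldsS_TS[OF Z p] k ext_vf_apply[OF X' f] p]
      by (simp add: lieS_def fscale_def) (simp add: tscale_def algebra_simps)
  next
    \<comment> \<open>The guard in \<open>lieS\<close> covers only the bracket terms; the last
      summand has to vanish by itself, by the default value 0 off the hypersurface or on functions
      that are not smooth.\<close>
    case False
    have "X p f = 0"
    proof (cases "p \<in> S")
      case True
      then show ?thesis
        using False tangent_not_smooth[OF along_tangent[OF fieldsS_along[OF X]]] by blast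
    qed (simp add: along_zero[OF fieldsS_along[OF X]])
    then show ?thesis using False by (auto simp: lieS_def fscale_def tscale_def)
  qed
qed

text \<open>The three fields are exchanged one at a time. Changing \<open>A\<close> or
  \<open>C\<close> costs a Koszul value of a field vanishing at \<open>p\<close>, which is 0.
  Changing \<open>B\<close> costs the metric product of a bracket with \<open>C'\<close>, and that
  bracket vanishes at \<open>p\<close>.\<close>

lemma dual_at_eq:
  assumes p: "p \<in> S" and a: "a \<in> TS p" and A: "smooth_vf_at \<A> p A'" "A' p = a"
    and B: "ext_vf p B B'" and C: "smooth_vf_at \<A> p C'" "C' p = c"
  shows "dual_at \<A> g p a B c = koszul \<A> g A' B' C' p"
  unfolding dual_at_def
proof (rule the_equality)
  show "\<exists>A'' B'' C''. smooth_vf_at \<A> p A'' \<and> A'' p = a \<and> ext_vf p B B'' \<and> smooth_vf_at \<A> p C'' \<and>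
     C'' p = c \<and> koszul \<A> g A' B' C' p = koszul \<A> g A'' B'' C'' p"
    using assms by blast
next
  fix r
  assume "\<exists>A'' B'' C''. smooth_vf_at \<A> p A'' \<and> A'' p = a \<and> ext_vf p B B'' \<and> smooth_vf_at \<A> p C'' \<and>
     C'' p = c \<and> r = koszul \<A> g A'' B'' C'' p"
  then obtain A'' B'' C'' where A'': "smooth_vf_at \<A> p A''" "A'' p = a" and B'': "ext_vf p B B''"
    and C'': "smooth_vf_at \<A> p C''" "C'' p = c" and r: "r = koszul \<A> g A'' B'' C'' p" by blast
  note sB = ext_vf_smooth[OF B] and sB'' = ext_vf_smooth[OF B'']
  have 1: "koszul \<A> g A'' B'' C'' p = koszul \<A> g A' B'' C'' p"
    using koszul_diff_left[OF A''(1) sB'' C''(1) A(1)]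
      koszul_vanishing_left[OF smooth_vf_diff[OF A''(1) A(1)] sB'' C''(1)] A(2) A''(2) by simp
  have 2: "koszul \<A> g A' B'' C'' p = koszul \<A> g A' B'' C' p"
    using koszul_diff_right[OF A(1) sB'' C''(1) C(1)]
      koszul_vanishing_right[OF A(1) sB'' smooth_vf_diff[OF C''(1) C(1)]] C(2) C''(2) by simp
  let ?E = "B'' - B'"
  have sE: "smooth_vf_at \<A> p ?E" by (rule smooth_vf_diff[OF sB'' sB])
  have Ep: "?E p = 0" using ext_vf_value[OF B p] ext_vf_value[OF B'' p] by simp
  have "lie \<A> A' ?E p f = 0" for f
  proof (cases "smooth_at \<A> p f")
    case f: True
    have "A' p (\<lambda>q. ?E q f) = 0"
    \<comment> \<open>The tangency of \<open>a\<close> is used here: \<open>?E\<close> applied to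
      \<open>f\<close> vanishes on the hypersurface near \<open>p\<close>, so \<open>a\<close>
      annihilates it.\<close>
    proof (rule TS_D[where p=p and v="A' p"])
      show "smooth_at \<A> p (\<lambda>q. ?E q f)" by (rule smooth_vf_apply[OF sE f])
      show "\<forall>\<^sub>F q in nhds p. q \<in> S \<longrightarrow> ?E q f = 0"
        using ext_vf_eq[OF B] ext_vf_eq[OF B''] by eventually_elim simp
    qed (use A a in simp)
    then show ?thesis using f Ep by (simp add: lie_def)
  qed (simp add: lie_def)
  then have lie0: "lie \<A> A' ?E p = 0" by (simp add: fun_eq_iff)
  have "koszul \<A> g A' ?E C' p = 0"
    unfolding koszul_vanishing_mid[OF A(1) sE C(1) Ep] lie0
    by (rule g_zero_left[OF smooth_vf_tangent[OF C(1)]])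
  then have "koszul \<A> g A' B'' C' p = koszul \<A> g A' B' C' p"
    using koszul_diff_mid[OF A(1) sB'' C(1) sB] by simp
  then show "r = koszul \<A> g A' B' C' p" using r 1 2 by simp
qed

lemma dual_eq:
  assumes "p \<in> S" "X \<in> fieldsS \<A> g" "ext_vf p X X'" "ext_vf p B B'" "ext_vf p C C'"
  shows "dual \<A> g X B C p = koszul \<A> g X' B' C' p"
  unfolding dual_def using assms
  by (intro dual_at_eq fieldsS_TS ext_vf_smooth ext_vf_value)

lemma ext_dual:
  assumes X: "X \<in> fieldsS \<A> g" "ext_vf p X X'" and B: "ext_vf p B B'" and C: "ext_vf p C C'"
  shows "ext_fun p (dual \<A> g X B C) (koszul \<A> g X' B' C')"
proof (rule ext_funI[OF smooth_koszul[OF ext_vf_smooth[OF X(2)] ext_vf_smooth[OF B] ext_vf_smooth[OF C]]])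
  show "\<forall>\<^sub>F q in nhds p. q \<in> S \<longrightarrow> koszul \<A> g X' B' C' q = dual \<A> g X B C q"
    using ext_vf_eventually[OF X(2)] ext_vf_eventually[OF B] ext_vf_eventually[OF C]
    by eventually_elim (use dual_eq[OF _ X(1)] in auto)
qed

lemma CinfS_dual:
  assumes "X \<in> fieldsS \<A> g" "B \<in> fields_along \<A> g" "C \<in> fields_along \<A> g"
  shows "dual \<A> g X B C \<in> CinfS \<A> g"
proof (rule CinfS_I)
  fix p assume p: "p \<in> S"
  obtain X' where X': "ext_vf p X X'" using along_ext[OF fieldsS_along[OF assms(1)] p] .
  obtain B' where B': "ext_vf p B B'" using along_ext[OF assms(2) p] .
  obtain C' where C': "ext_vf p C C'" using along_ext[OF assms(3) p] .
  show "\<exists>k. ext_fun p (dual \<A> g X B C) k" using ext_dual[OF assms(1) X' B' C'] by blast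
qed

section \<open>Linearity, metricity and torsion identity of the dual connection on the
  hypersurface\<close>

lemma dual_at_add:
  assumes p: "p \<in> S" and v: "v \<in> TS p" and w: "w \<in> TS p" and B: "B \<in> fields_along \<A> g"
    and c: "c \<in> tangent \<A> p"
  shows "dual_at \<A> g p (v + w) B c = dual_at \<A> g p v B c + dual_at \<A> g p w B c"
proof -
  obtain B' where B': "ext_vf p B B'" using along_ext[OF B p] .
  obtain V where V: "smooth_vf_at \<A> p V" "V p = v" using smooth_vf_extend[OF TS_tangent[OF v]] .
  obtain W where W: "smooth_vf_at \<A> p W" "W p = w" using smooth_vf_extend[OF TS_tangent[OF w]] .
  obtain C where C: "smooth_vf_at \<A> p C" "C p = c" using smooth_vf_extend[OF c] .
  have "dual_at \<A> g p (v + w) B c = koszul \<A> g (V + W) B' C p"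
    using V W by (intro dual_at_eq[OF p TS_add[OF v w] smooth_vf_add[OF V(1) W(1)] _ B' C]) simp
  \<comment> \<open>Additivity is read off from the rule for differences, with \<open>V\<close> as
    \<open>(V + W) - W\<close>.\<close>
  moreover have "koszul \<A> g V B' C p = koszul \<A> g (V + W) B' C p - koszul \<A> g W B' C p"
    using koszul_diff_left[OF smooth_vf_add[OF V(1) W(1)] ext_vf_smooth[OF B'] C(1) W(1)] by simp
  ultimately show ?thesis using dual_at_eq[OF p v V B' C] dual_at_eq[OF p w W B' C] by simp
qed

lemma dual_at_scale:
  assumes p: "p \<in> S" and v: "v \<in> TS p" and B: "B \<in> fields_along \<A> g" and c: "c \<in> tangent \<A> p"
  shows "dual_at \<A> g p (tscale r v) B c = r * dual_at \<A> g p v B c"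
proof -
  obtain B' where B': "ext_vf p B B'" using along_ext[OF B p] .
  obtain V where V: "smooth_vf_at \<A> p V" "V p = v" using smooth_vf_extend[OF TS_tangent[OF v]] .
  obtain C where C: "smooth_vf_at \<A> p C" "C p = c" using smooth_vf_extend[OF c] .
  have "dual_at \<A> g p (tscale r v) B c = koszul \<A> g (fscale (\<lambda>_. r) V) B' C p"
    using V by (intro dual_at_eq[OF p TS_scale[OF v] smooth_vf_fscale[OF V(1) smooth_at_const] _ B' C])
      (simp add: fscale_def)
  then show ?thesis
    using koszul_scale_left[OF V(1) ext_vf_smooth[OF B'] C(1)] dual_at_eq[OF p v V B' C] by simp
qed

lemma dual_compatible:
  assumes p: "p \<in> S" and X: "X \<in> fieldsS \<A> g" and Y: "Y \<in> fields_along \<A> g" and Z: "Z \<in> fields_along \<A> g"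
  shows "dual \<A> g X Y Z p + dual \<A> g X Z Y p = act p (X p) (\<lambda>q. g q (Y q) (Z q))"
proof -
  obtain X' where X': "ext_vf p X X'" using along_ext[OF fieldsS_along[OF X] p] .
  obtain Y' where Y': "ext_vf p Y Y'" using along_ext[OF Y p] .
  obtain Z' where Z': "ext_vf p Z Z'" using along_ext[OF Z p] .
  show ?thesis
    using koszul_compatible[OF ext_vf_smooth[OF X'] ext_vf_smooth[OF Y'] ext_vf_smooth[OF Z']]
    by (simp add: dual_eq[OF p X X' Y' Z'] dual_eq[OF p X X' Z' Y'] ext_vf_value[OF X' p]
        act_eq[OF fieldsS_TS[OF X p] ext_metric[OF Y' Z']])
qed

lemma dual_torsion:
  assumes p: "p \<in> S" and X: "X \<in> fieldsS \<A> g" and Y: "Y \<in> fieldsS \<A> g" and Z: "Z \<in> fields_along \<A> g"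
  shows "dual \<A> g X Y Z p - dual \<A> g Y X Z p = g p (lieS \<A> g X Y p) (Z p)"
proof -
  obtain X' where X': "ext_vf p X X'" using along_ext[OF fieldsS_along[OF X] p] .
  obtain Y' where Y': "ext_vf p Y Y'" using along_ext[OF fieldsS_along[OF Y] p] .
  obtain Z' where Z': "ext_vf p Z Z'" using along_ext[OF Z p] .
  show ?thesis
    using koszul_torsion[OF ext_vf_smooth[OF X'] ext_vf_smooth[OF Y'] ext_vf_smooth[OF Z']]
    by (simp add: dual_eq[OF p X X' Y' Z'] dual_eq[OF p Y Y' X' Z'] ext_vf_value[OF Z' p]
        lieS_eq[OF p X X' Y Y'])
qed

end

section \<open>Admissible connections\<close>

locale singular_space = metric_manifold \<A> g
  for \<A> :: "('p::{t2_space, second_countable_topology}, 'm::finite) chart set" and g :: "'p metric" +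
  fixes N R :: "'p vfield"
  assumes transverse: "transverse \<A> g" and riemann_lorentz: "riemann_lorentz \<A> g"
    and N_along: "N \<in> fields_along \<A> g" and main_radical: "main_radical \<A> g N R"
begin

abbreviation F :: "'p vfield set" where "F \<equiv> fieldsS \<A> g"
abbreviation \<rho> :: "'p vfield \<Rightarrow> 'p \<Rightarrow> real" where "\<rho> \<equiv> rho \<A> g N R"
abbreviation SF :: "'p vfield set" where "SF \<equiv> screen_fields \<A> g N R"
abbreviation spart :: "'p vfield \<Rightarrow> 'p vfield" where "spart \<equiv> screen_part \<A> g N R"

lemma R_field: "R \<in> F"
  using main_radical by (simp add: main_radical_def)

lemma R_Rad: "p \<in> S \<Longrightarrow> R p \<in> Rad \<A> g p"
  using main_radical by (simp add: main_radical_def)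

lemma rho_R: "p \<in> S \<Longrightarrow> \<rho> R p = 1"
  using main_radical by (simp add: main_radical_def rho_def)

text \<open>Shows that \<rho> is pointwise: it depends on \<open>X\<close> only through the vector
  \<open>X p\<close>, so its linearity is that of \<open>dual_at\<close> in the vector
  argument.\<close>

lemma rho_dual_at: "\<rho> X p = - dual_at \<A> g p (X p) R (N p)"
  by (simp add: rho_def HH_def dual_def)

lemma rho_add:
  assumes "p \<in> S" "X \<in> F" "Y \<in> F"
  shows "\<rho> (X + Y) p = \<rho> X p + \<rho> Y p"
  using assms by (simp add: rho_dual_at dual_at_add fieldsS_TS fieldsS_along R_field N_along along_tangent)

lemma rho_fscale:
  assumes "p \<in> S" "X \<in> F"
  shows "\<rho> (fscale h X) p = h p * \<rho> X p"
  using assms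
  by (simp add: rho_dual_at fscale_def dual_at_scale fieldsS_TS fieldsS_along R_field N_along along_tangent)

lemma rho_diff:
  assumes "p \<in> S" "X \<in> F" "Y \<in> F"
  shows "\<rho> (X - Y) p = \<rho> X p - \<rho> Y p"
  unfolding fdiff_eq_fscale using assms by (simp add: rho_add rho_fscale fieldsS_fscale CinfS_const)

lemma CinfS_rho:
  assumes "X \<in> F"
  shows "\<rho> X \<in> CinfS \<A> g"
proof -
  have "(\<lambda>p. (- 1) * dual \<A> g X R N p) \<in> CinfS \<A> g"
    by (intro CinfS_mult CinfS_const CinfS_dual assms fieldsS_along R_field N_along)
  then show ?thesis by (simp add: rho_def[abs_def] HH_def)
qed

lemma g_R_left: "p \<in> S \<Longrightarrow> v \<in> tangent \<A> p \<Longrightarrow> g p (R p) v = 0"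
  using R_Rad by (simp add: Rad_def)

lemma g_R_right: "p \<in> S \<Longrightarrow> v \<in> tangent \<A> p \<Longrightarrow> g p v (R p) = 0"
  using g_R_left g_sym along_tangent[OF fieldsS_along[OF R_field]] by metis

lemma F_tangent: "X \<in> F \<Longrightarrow> X p \<in> tangent \<A> p"
  by (rule along_tangent[OF fieldsS_along])

lemma SF_field: "V \<in> SF \<Longrightarrow> V \<in> F"
  by (simp add: screen_fields_def)

lemma SF_iff: "V \<in> SF \<longleftrightarrow> V \<in> F \<and> (\<forall>p\<in>S. \<rho> V p = 0)"
  by (auto simp: screen_fields_def screen_def rho_dual_at fieldsS_TS)

lemma SF_diff: "V \<in> SF \<Longrightarrow> W \<in> SF \<Longrightarrow> V - W \<in> SF"
  by (simp add: SF_iff fieldsS_diff rho_diff)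

lemma spart_SF: "X \<in> F \<Longrightarrow> spart X \<in> SF"
  by (simp add: SF_iff screen_part_def fieldsS_diff fieldsS_fscale CinfS_rho R_field rho_diff rho_fscale rho_R)

lemma spart_decomp: "X = spart X + fscale (\<rho> X) R"
  by (simp add: screen_part_def)

lemma g_spart:
  assumes "p \<in> S" "X \<in> F" "v \<in> tangent \<A> p"
  shows "g p (spart X p) v = g p (X p) v"
proof -
  have "tscale (\<rho> X p) (R p) \<in> tangent \<A> p" by (intro tangent_scale F_tangent R_field)
  then show ?thesis
    using g_diff_left[OF F_tangent[OF assms(2)] _ assms(3), of "tscale (\<rho> X p) (R p)"]
      g_scale_left[OF F_tangent[OF R_field] F_tangent[OF R_field] assms(3), of "\<rho> X p"]
      g_R_left[OF assms(1,3)]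
    by (simp add: screen_part_def fscale_def)
qed

text \<open>A null vector of the positive semidefinite form is radical, hence a multiple of \<open>R\<close>, and
  \<open>\<rho> R = 1\<close>.\<close>

lemma SF_definite:
  assumes p: "p \<in> S" and V: "V \<in> SF" and null: "g p (V p) (V p) = 0"
  shows "V p = 0"
proof -
  have "V p \<in> Rad \<A> g p"
    by (rule null_imp_Rad[OF riemann_lorentz p F_tangent[OF SF_field[OF V]] null])
  moreover have "R p \<noteq> 0"
  proof
    assume "R p = 0"
    then have "tscale 0 (R p) = R p" by (simp add: tscale_def fun_eq_iff)
    then have "\<rho> R p = 0 * \<rho> R p"
      using rho_fscale[OF p R_field, of "\<lambda>_. 0"] by (simp add: rho_dual_at fscale_def)
    then show False using rho_R[OF p] by simp
  qed
  ultimately obtain t where t: "V p = tscale t (R p)"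
    using Rad_one_dimensional[OF transverse p R_Rad[OF p]] by metis
  then have "\<rho> V p = \<rho> (fscale (\<lambda>_. t) R) p" by (simp add: rho_dual_at fscale_def)
  then have "t = 0" using V p rho_fscale[OF p R_field, of "\<lambda>_. t"] rho_R[OF p] by (simp add: SF_iff)
  then show ?thesis using t by (simp add: tscale_def fun_eq_iff)
qed

text \<open>The difference of two solutions is itself a screen field, so it can be tested against
  itself; it has square 0 and vanishes by \<open>SF_definite\<close>. Off the hypersurface both are
  0 by convention, which makes them equal as functions.\<close>

lemma screen_conn_eq:
  assumes W: "W \<in> SF" and eq: "\<And>V p. V \<in> SF \<Longrightarrow> p \<in> S \<Longrightarrow> g p (W p) (V p) = dual \<A> g X A V p"
  shows "screen_conn \<A> g N R X A = W"
  unfolding screen_conn_def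
proof (rule the_equality)
  show "W \<in> SF \<and> (\<forall>V\<in>SF. \<forall>p\<in>S. g p (W p) (V p) = dual \<A> g X A V p)" using assms by blast
next
  fix W' assume W': "W' \<in> SF \<and> (\<forall>V\<in>SF. \<forall>p\<in>S. g p (W' p) (V p) = dual \<A> g X A V p)"
  show "W' = W"
  proof
    fix p
    show "W' p = W p"
    proof (cases "p \<in> S")
      case p: True
      have D: "W' - W \<in> SF" using W W' SF_diff by blast
      have "g p ((W' - W) p) ((W' - W) p) = g p (W' p) ((W' - W) p) - g p (W p) ((W' - W) p)"
        using g_diff_left[OF _ _ F_tangent[OF SF_field[OF D]]] W W' F_tangent[OF SF_field] by simp
      also have "\<dots> = 0" using W'[THEN conjunct2, rule_format, OF D p] eq[OF D p] by simp
      finally have "(W' - W) p = 0" by (rule SF_definite[OF p D])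
      then show ?thesis by simp
    next
      case False
      then show ?thesis using W W' along_zero[OF fieldsS_along[OF SF_field]] by simp
    qed
  qed
qed

section \<open>Comparison of an admissible connection with the main one\<close>

lemma act_rho_add:
  assumes "p \<in> S" "X \<in> F" "Y \<in> F" "v \<in> TS p"
  shows "act p v (\<rho> (X + Y)) = act p v (\<rho> X) + act p v (\<rho> Y)"
proof -
  obtain k k' where k: "ext_fun p (\<rho> X) k" "ext_fun p (\<rho> Y) k'"
    using CinfS_D[OF CinfS_rho[OF assms(2)] assms(1)] CinfS_D[OF CinfS_rho[OF assms(3)] assms(1)] by blast
  have "act p v (\<rho> (X + Y)) = act p v (\<lambda>q. \<rho> X q + \<rho> Y q)"
    by (rule act_cong_S) (rule rho_add[OF _ assms(2,3)])
  then show ?thesis using act_add[OF assms(4) k] by simp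
qed

lemma act_rho_fscale:
  assumes "p \<in> S" "X \<in> F" "h \<in> CinfS \<A> g" "v \<in> TS p"
  shows "act p v (\<rho> (fscale h X)) = h p * act p v (\<rho> X) + act p v h * \<rho> X p"
proof -
  obtain k k' where k: "ext_fun p (\<rho> X) k" "ext_fun p h k'"
    using CinfS_D[OF CinfS_rho[OF assms(2)] assms(1)] CinfS_D[OF assms(3,1)] by blast
  have "act p v (\<rho> (fscale h X)) = act p v (\<lambda>q. h q * \<rho> X q)"
    by (rule act_cong_S) (rule rho_fscale[OF _ assms(2)])
  then show ?thesis using act_mult[OF assms(4) k(2) k(1) assms(1)] by simp
qed

lemma act_add_left:
  assumes "p \<in> S" "v \<in> TS p" "w \<in> TS p" "h \<in> CinfS \<A> g"
  shows "act p (v + w) h = act p v h + act p w h"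
proof -
  obtain k where "ext_fun p h k" using CinfS_D[OF assms(4,1)] by blast
  then show ?thesis using assms by (simp add: act_eq TS_add)
qed

lemma act_scale_left:
  assumes "p \<in> S" "v \<in> TS p" "h \<in> CinfS \<A> g"
  shows "act p (tscale r v) h = r * act p v h"
proof -
  obtain k where "ext_fun p h k" using CinfS_D[OF assms(3,1)] by blast
  then show ?thesis using assms by (simp add: act_eq TS_scale) (simp add: tscale_def)
qed

lemma admissible_expand:
  assumes "admissible \<A> g N R D" "X \<in> F" "Y \<in> F"
  shows "D X Y = screen_conn \<A> g N R X Y + fscale (\<rho> (D X Y)) R"
  using assms spart_decomp[of "D X Y"] unfolding admissible_def by metis

text \<open>Both connections have the same screen part, so \<sigma> must be the difference of their
  \<open>R\<close>-components. For the main connection, \<open>X(\<rho>(Y)) - d\<rho>(X,Y)/2\<close>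
  equals half the sum of \<open>X(\<rho>(Y))\<close>, \<open>Y(\<rho>(X))\<close> and
  \<open>\<rho>([X,Y])\<close>.\<close>

lemma admissible_main_conn:
  assumes adm: "admissible \<A> g N R D"
  shows "\<exists>\<sigma>. sym_tensorS \<A> g \<sigma> \<and> (\<forall>X\<in>F. \<forall>Y\<in>F. D X Y = main_conn \<A> g N R X Y + fscale (\<sigma> X Y) R)"
proof -
  have D_field: "D X Y \<in> F" if "X \<in> F" "Y \<in> F" for X Y
    using adm that unfolding admissible_def connectionS_def by blast
  have D_add: "D (X + Y) Z = D X Z + D Y Z" if "X \<in> F" "Y \<in> F" "Z \<in> F" for X Y Z
    using adm that unfolding admissible_def connectionS_def by blast
  have D_scale: "D (fscale h X) Y = fscale h (D X Y)" if "X \<in> F" "Y \<in> F" "h \<in> CinfS \<A> g" for X Y h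
    using adm that unfolding admissible_def connectionS_def by blast
  have D_torsion: "D X Y - D Y X = lieS \<A> g X Y" if "X \<in> F" "Y \<in> F" for X Y
    using adm that unfolding admissible_def torsion_free_def by blast
  let ?\<sigma> = "\<lambda>X Y p. \<rho> (D X Y) p -
    1 / 2 * (act p (X p) (\<rho> Y) + act p (Y p) (\<rho> X) + \<rho> (lieS \<A> g X Y) p)"
  have "sym_tensorS \<A> g ?\<sigma>"
    unfolding sym_tensorS_def
  proof (intro conjI ballI)
    fix X Y assume X: "X \<in> F" and Y: "Y \<in> F"
    show "?\<sigma> X Y \<in> CinfS \<A> g"
      by (rule CinfS_diff[OF CinfS_rho CinfS_mult[OF CinfS_const CinfS_add[OF CinfS_add CinfS_rho]]])
        (rule D_field CinfS_act CinfS_rho fieldsS_lieS X Y)+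
    fix Z h p assume Z: "Z \<in> F" and h: "h \<in> CinfS \<A> g" and p: "p \<in> S"
    note TS = fieldsS_TS[OF X p] fieldsS_TS[OF Y p] fieldsS_TS[OF Z p]
    show "?\<sigma> (X + Y) Z p = ?\<sigma> X Z p + ?\<sigma> Y Z p"
      by (simp add: D_add[OF X Y Z] rho_add[OF p D_field[OF X Z] D_field[OF Y Z]]
          act_add_left[OF p TS(1,2) CinfS_rho[OF Z]] act_rho_add[OF p X Y TS(3)] lieS_add_left[OF X Y Z]
          rho_add[OF p fieldsS_lieS[OF X Z] fieldsS_lieS[OF Y Z]] field_simps)
    \<comment> \<open>The derivative of \<open>h\<close> along \<open>Y\<close> in this bracket
      cancels the one produced by \<open>Y(\<rho>(hX))\<close>; this is why \<sigma> is
      tensorial.\<close>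
    have "\<rho> (lieS \<A> g (fscale h X) Y) p = h p * \<rho> (lieS \<A> g X Y) p - act p (Y p) h * \<rho> X p"
      unfolding lieS_fscale_left[OF X Y h]
      using p X Y h by (simp add: rho_diff rho_fscale fieldsS_fscale fieldsS_lieS CinfS_act)
    moreover have "fscale h X p = tscale (h p) (X p)" by (simp add: fscale_def)
    ultimately show "?\<sigma> (fscale h X) Y p = h p * ?\<sigma> X Y p"
      by (simp add: D_scale[OF X Y h] rho_fscale[OF p D_field[OF X Y]] act_rho_fscale[OF p X h TS(2)]
          act_scale_left[OF p TS(1) CinfS_rho[OF Y]] algebra_simps)
    \<comment> \<open>Torsion-freeness makes the skew part of \<open>\<rho>(D X Y)\<close> equal to
      that of \<open>\<rho>([X,Y]) / 2\<close>, so the subtraction leaves a symmetric form.\<close>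
    have "\<rho> (D X Y) p - \<rho> (D Y X) p = \<rho> (lieS \<A> g X Y) p"
      using rho_diff[OF p D_field[OF X Y] D_field[OF Y X]] D_torsion[OF X Y] by simp
    moreover have "\<rho> (lieS \<A> g Y X) p = - \<rho> (lieS \<A> g X Y) p"
      unfolding lieS_swap[of Y X] rho_fscale[OF p fieldsS_lieS[OF X Y]] by simp
    ultimately show "?\<sigma> X Y p = ?\<sigma> Y X p" by (simp add: field_simps)
  qed
  moreover have "D X Y = main_conn \<A> g N R X Y + fscale (?\<sigma> X Y) R" if "X \<in> F" "Y \<in> F" for X Y
  proof -
    have "main_conn \<A> g N R X Y + fscale (?\<sigma> X Y) R = screen_conn \<A> g N R X Y + fscale (\<rho> (D X Y)) R"
      by (simp add: main_conn_def drho_def fun_eq_iff fscale_def tscale_def field_simps)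
    then show ?thesis using admissible_expand[OF adm that] by simp
  qed
  ultimately show ?thesis by (intro exI[of _ ?\<sigma>]) blast
qed

text \<open>The difference of the two sides is symmetric in \<open>X, Y\<close> and skew in \<open>Y, Z\<close>, hence zero.\<close>

lemma metric_conn_dual:
  assumes conn: "connectionS \<A> g D" and tf: "torsion_free \<A> g D" and met: "metric_conn \<A> g D"
    and X: "X \<in> F" and Y: "Y \<in> F" and Z: "Z \<in> F" and p: "p \<in> S"
  shows "g p (D X Y p) (Z p) = dual \<A> g X Y Z p"
proof -
  have D_field: "D X Y \<in> F" if "X \<in> F" "Y \<in> F" for X Y
    using conn that unfolding connectionS_def by blast
  define E where "E X Y Z = g p (D X Y p) (Z p) - dual \<A> g X Y Z p" for X Y Z
  have skew: "E X Y Z = - E X Z Y" if X: "X \<in> F" and Y: "Y \<in> F" and Z: "Z \<in> F" for X Y Z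
  proof -
    have "act p (X p) (\<lambda>q. g q (Y q) (Z q)) = g p (D X Y p) (Z p) + g p (Y p) (D X Z p)"
      using met X Y Z p unfolding metric_conn_def by blast
    then show ?thesis
      using dual_compatible[OF p X fieldsS_along[OF Y] fieldsS_along[OF Z]]
        g_sym[OF F_tangent[OF Y] F_tangent[OF D_field[OF X Z]] F_tangent[OF Y]]
      by (simp add: E_def)
  qed
  have sym: "E X Y Z = E Y X Z" if X: "X \<in> F" and Y: "Y \<in> F" and Z: "Z \<in> F" for X Y Z
  proof -
    have "lieS \<A> g X Y = D X Y - D Y X" using tf X Y unfolding torsion_free_def by simp
    then show ?thesis
      using dual_torsion[OF p X Y fieldsS_along[OF Z]]
        g_diff_left[OF F_tangent[OF D_field[OF X Y]] F_tangent[OF D_field[OF Y X]] F_tangent[OF Z]]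
      by (simp add: E_def)
  qed
  \<comment> \<open>Alternating the two exchanges six times leads back to \<open>E X Y Z\<close>
    with three changes of sign.\<close>
  have "E X Y Z = - E X Y Z"
    using skew[OF X Y Z] sym[OF X Z Y] skew[OF Z X Y] sym[OF Z Y X] skew[OF Y Z X] sym[OF Y X Z] by simp
  then show ?thesis by (simp add: E_def)
qed

text \<open>By \<open>metric_conn_dual\<close> the screen part of \<open>D X Y\<close> solves the
  equation that defines \<open>screen_conn\<close>, as dropping the \<open>R\<close>-component does
  not affect metric products.\<close>

lemma metric_conn_admissible:
  assumes "connectionS \<A> g D" "torsion_free \<A> g D" "metric_conn \<A> g D"
  shows "admissible \<A> g N R D"
  unfolding admissible_def
proof (intro conjI ballI assms)
  fix X Y assume X: "X \<in> F" and Y: "Y \<in> F"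
  have D: "D X Y \<in> F" using assms(1) X Y unfolding connectionS_def by blast
  have "screen_conn \<A> g N R X Y = spart (D X Y)"
    by (rule screen_conn_eq[OF spart_SF[OF D]])
      (use g_spart[OF _ D] metric_conn_dual[OF assms X Y] SF_field F_tangent in simp)
  then show "spart (D X Y) = screen_conn \<A> g N R X Y" by simp
qed

lemma admissible_same_metric:
  assumes adm: "admissible \<A> g N R D" "admissible \<A> g N R D'"
    and X: "X \<in> F" and Y: "Y \<in> F" and p: "p \<in> S" and v: "v \<in> tangent \<A> p"
  shows "g p (D' X Y p) v = g p (D X Y p) v"
proof -
  have "D X Y \<in> F" "D' X Y \<in> F" "spart (D X Y) = spart (D' X Y)"
    using adm X Y unfolding admissible_def connectionS_def by simp_all
  then show ?thesis using g_spart[OF p _ v] by metis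
qed

lemma admissible_metric:
  assumes adm: "admissible \<A> g N R D" "admissible \<A> g N R D'" and met: "metric_conn \<A> g D"
  shows "metric_conn \<A> g D'"
  unfolding metric_conn_def
proof (intro ballI)
  fix X Y Z p assume X: "X \<in> F" and Y: "Y \<in> F" and Z: "Z \<in> F" and p: "p \<in> S"
  have F: "D X Z \<in> F" "D' X Z \<in> F" using adm X Z unfolding admissible_def connectionS_def by simp_all
  have "g p (Y p) (D' X Z p) = g p (Y p) (D X Z p)"
    using admissible_same_metric[OF adm X Z p F_tangent[OF Y]] g_sym F_tangent Y F by metis
  then show "act p (X p) (\<lambda>q. g q (Y q) (Z q)) = g p (D' X Y p) (Z p) + g p (Y p) (D' X Z p)"
    using met X Y Z p admissible_same_metric[OF adm X Y p F_tangent[OF Z]] unfolding metric_conn_def by simp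
qed

lemma metric_conn_flat:
  assumes "connectionS \<A> g D" "torsion_free \<A> g D" "metric_conn \<A> g D"
  shows "II_flat \<A> g N R"
  unfolding II_flat_def II_def
proof (intro ballI)
  fix V W p assume V: "V \<in> SF" and W: "W \<in> SF" and p: "p \<in> S"
  have "D V W \<in> F" using assms(1) SF_field V W unfolding connectionS_def by blast
  then show "dual \<A> g V W R p = 0"
    using metric_conn_dual[OF assms SF_field[OF V] SF_field[OF W] R_field p] g_R_right[OF p F_tangent] by simp
qed

section \<open>Curvature in the flat case\<close>

lemma act_vanish_S: "v \<in> TS p \<Longrightarrow> (\<And>q. q \<in> S \<Longrightarrow> h q = 0) \<Longrightarrow> act p v h = 0"
  using act_cong_S[of h "\<lambda>_. 0" p v] act_eq[OF _ ext_fun_const, of v p 0] tangent_const[OF TS_tangent, of v p 0]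
  by simp

text \<open>Metricity turns the claim into the vanishing of \<open>dual X V R\<close> for screen
  fields \<open>V\<close>. Splitting \<open>X\<close>, flatness handles the screen part, and the
  \<open>R\<close> part reduces by the torsion identity to \<open>dual V R R\<close>. The zero
  section is written \<open>fscale (\<lambda>_. 0) R\<close> so that the rules for multiples of
  \<open>R\<close> put it in the screen.\<close>

lemma flat_screen_conn_R:
  assumes flat: "II_flat \<A> g N R" and X: "X \<in> F"
  shows "screen_conn \<A> g N R X R = fscale (\<lambda>_. 0) R"
proof (rule screen_conn_eq)
  show "fscale (\<lambda>_. 0) R \<in> SF" by (simp add: SF_iff fieldsS_fscale R_field CinfS_const rho_fscale)
next
  fix V p assume V: "V \<in> SF" and p: "p \<in> S"
  note RF = fieldsS_along[OF R_field] and VF = SF_field[OF V]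
  \<comment> \<open>Differentiates \<open>g(R, A) = 0\<close>, which holds all along the
    hypersurface. For \<open>A = R\<close> the value equals its own negative and is 0.\<close>
  have compat: "dual \<A> g Y R A p = - dual \<A> g Y A R p" if "Y \<in> F" "A \<in> F" for Y A
    using dual_compatible[OF p that(1) RF fieldsS_along[OF that(2)]]
      act_vanish_S[OF fieldsS_TS[OF that(1) p], of "\<lambda>q. g q (R q) (A q)"] g_R_left F_tangent[OF that(2)]
    by simp
  have "dual \<A> g R V R p = dual \<A> g V R R p"
    using dual_torsion[OF p R_field VF RF] g_R_right[OF p F_tangent[OF fieldsS_lieS[OF R_field VF]]] by simp
  also have "\<dots> = 0" using compat[OF VF R_field] by simp
  finally have RV: "dual_at \<A> g p (R p) V (R p) = 0" by (simp add: dual_def)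
  have SV: "dual_at \<A> g p (spart X p) V (R p) = 0"
    using flat spart_SF[OF X] V p unfolding II_flat_def II_def dual_def by blast
  have "dual \<A> g X V R p = dual_at \<A> g p (spart X p + tscale (\<rho> X p) (R p)) V (R p)"
    using arg_cong[OF spart_decomp[of X], of "\<lambda>Z. Z p"] by (simp add: dual_def fscale_def)
  also have "\<dots> = 0"
    using RV SV p fieldsS_TS[OF SF_field[OF spart_SF[OF X]] p] fieldsS_TS[OF R_field p]
    by (simp add: dual_at_add dual_at_scale TS_scale fieldsS_along VF F_tangent R_field)
  finally have "dual \<A> g X R V p = 0" using compat[OF X VF] by simp
  moreover have "g p (fscale (\<lambda>_. 0) R p) (V p) = 0"
    unfolding fscale_def
    using g_scale_left[OF F_tangent[OF R_field] F_tangent[OF R_field] F_tangent[OF VF], where r=0] by simp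
  ultimately show "g p (fscale (\<lambda>_. 0) R p) (V p) = dual \<A> g X R V p" by simp
qed

text \<open>With \<open>D' Y Z = D Y Z + \<tau> R\<close>, the Leibniz rule for \<open>D\<close>
  produces the extra terms \<open>X(\<tau>) R\<close> and \<open>\<tau> D X R\<close>. The first is
  radical, and so is the second because \<open>D X R\<close> has zero screen part. The outer
  \<open>D'\<close> can be exchanged for \<open>D\<close> since metric products do not see the
  difference.\<close>

lemma flat_second_derivative:
  assumes flat: "II_flat \<A> g N R" and adm: "admissible \<A> g N R D" "admissible \<A> g N R D'"
    and X: "X \<in> F" and Y: "Y \<in> F" and Z: "Z \<in> F" and p: "p \<in> S" and v: "v \<in> tangent \<A> p"
  shows "g p (D' X (D' Y Z) p) v = g p (D X (D Y Z) p) v"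
proof -
  have D_field: "D X Y \<in> F" "D' X Y \<in> F" if "X \<in> F" "Y \<in> F" for X Y
    using adm that unfolding admissible_def connectionS_def by simp_all
  define \<tau> where "\<tau> = (\<lambda>q. \<rho> (D' Y Z) q - \<rho> (D Y Z) q)"
  \<comment> \<open>The Leibniz rule of a connection is available for smooth factors only.\<close>
  have \<tau>: "\<tau> \<in> CinfS \<A> g" unfolding \<tau>_def by (intro CinfS_diff CinfS_rho D_field Y Z)
  have D': "D' Y Z = D Y Z + fscale \<tau> R"
  proof -
    have "spart (D' Y Z) + fscale (\<rho> (D' Y Z)) R =
        spart (D Y Z) + fscale (\<rho> (D Y Z)) R + fscale \<tau> R"
      using adm Y Z unfolding admissible_def
      by (simp add: fun_eq_iff fscale_def tscale_def \<tau>_def algebra_simps)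
    then show ?thesis by (simp only: spart_decomp[symmetric])
  qed
  have "D X (D Y Z + fscale \<tau> R) = D X (D Y Z) + D X (fscale \<tau> R)"
    using adm(1) X D_field[OF Y Z] fieldsS_fscale[OF R_field \<tau>] unfolding admissible_def connectionS_def by blast
  also have "D X (fscale \<tau> R) = fscale (\<lambda>p. act p (X p) \<tau>) R + fscale \<tau> (D X R)"
    using adm(1) X R_field \<tau> unfolding admissible_def connectionS_def by blast
  finally have "D X (D' Y Z) = D X (D Y Z) + (fscale (\<lambda>p. act p (X p) \<tau>) R + fscale \<tau> (D X R))"
    by (simp only: D')
  from fun_cong[OF this, of p] have 1: "D X (D' Y Z) p = D X (D Y Z) p +
      (tscale (act p (X p) \<tau>) (R p) + tscale (\<tau> p) (D X R p))"
    by (simp only: plus_fun_apply fscale_def)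
  note RT = F_tangent[OF R_field, of p] and DRT = F_tangent[OF D_field(1)[OF X R_field], of p]
  have "spart (D X R) = fscale (\<lambda>_. 0) R"
    using adm(1) X R_field flat_screen_conn_R[OF flat X] unfolding admissible_def by simp
  then have "g p (D X R p) v = g p (tscale 0 (R p)) v"
    using g_spart[OF p D_field(1)[OF X R_field] v] by (simp add: fscale_def)
  then have "g p (D X R p) v = 0" using g_scale_left[OF RT RT v, where r=0] by simp
  then have "g p (D X (D' Y Z) p) v = g p (D X (D Y Z) p) v"
    unfolding 1
    using g_R_left[OF p v] F_tangent[OF D_field(1)[OF X D_field(1)[OF Y Z]], of p] RT DRT v
    by (simp add: g_add_left tangent_add tangent_scale g_scale_left[OF RT RT v] g_scale_left[OF DRT DRT v])
  then show ?thesis using admissible_same_metric[OF adm X D_field(2)[OF Y Z] p v] by simp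
qed

lemma flat_cov_curv:
  assumes flat: "II_flat \<A> g N R" and adm: "admissible \<A> g N R D" "admissible \<A> g N R D'"
    and X: "X \<in> F" and Y: "Y \<in> F" and Z: "Z \<in> F" and T: "T \<in> F" and p: "p \<in> S"
  shows "cov_curv \<A> g D X Y Z T p = cov_curv \<A> g D' X Y Z T p"
proof -
  have D_field: "D X Y \<in> F" "D' X Y \<in> F" if "X \<in> F" "Y \<in> F" for X Y
    using adm that unfolding admissible_def connectionS_def by simp_all
  note Tp = F_tangent[OF T, of p]
  have expand: "cov_curv \<A> g E X Y Z T p =
      g p (E X (E Y Z) p) (T p) - g p (E Y (E X Z) p) (T p) - g p (E (lieS \<A> g X Y) Z p) (T p)"
    if "\<And>X Y. X \<in> F \<Longrightarrow> Y \<in> F \<Longrightarrow> E X Y \<in> F" for E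
    using that X Y Z F_tangent Tp
    by (simp add: cov_curv_def g_diff_left tangent_diff fieldsS_lieS)
  show ?thesis
    using expand[of D] expand[of D'] D_field flat_second_derivative[OF flat adm X Y Z p Tp] flat_second_derivative[OF flat adm Y X Z p Tp]
      admissible_same_metric[OF adm fieldsS_lieS[OF X Y] Z p Tp] by simp
qed

end

theorem theorem6:
  fixes \<A> :: "('p::{t2_space, second_countable_topology}, 'm::finite) chart set"
    and g :: "'p metric" and N R :: "'p vfield"
  assumes "CARD('m) > 2" and "connected (UNIV :: 'p set)" and "smooth_structure \<A>"
    and "smooth_sym_tensor \<A> g" and "Sing \<A> g \<noteq> {}"
    and "transverse \<A> g" and "riemann_lorentz \<A> g" and "tangent_radical \<A> g"
    and "main_normal \<A> g N" and "main_radical \<A> g N R"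
  shows "(\<forall>D. admissible \<A> g N R D \<longrightarrow>
            (\<exists>\<sigma>. sym_tensorS \<A> g \<sigma> \<and> (\<forall>X \<in> fieldsS \<A> g. \<forall>Y \<in> fieldsS \<A> g.
               D X Y = main_conn \<A> g N R X Y + fscale (\<sigma> X Y) R))) \<and>
         (\<forall>D. connectionS \<A> g D \<and> torsion_free \<A> g D \<and> metric_conn \<A> g D \<longrightarrow>
            admissible \<A> g N R D \<and>
            (\<forall>D'. admissible \<A> g N R D' \<longrightarrow> metric_conn \<A> g D') \<and>
            II_flat \<A> g N R) \<and>
         (II_flat \<A> g N R \<longrightarrow> (\<forall>D D'. admissible \<A> g N R D \<and> admissible \<A> g N R D' \<longrightarrow>
            (\<forall>X \<in> fieldsS \<A> g. \<forall>Y \<in> fieldsS \<A> g. \<forall>Z \<in> fieldsS \<A> g. \<forall>T \<in> fieldsS \<A> g.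
               \<forall>p \<in> Sing \<A> g. cov_curv \<A> g D X Y Z T p = cov_curv \<A> g D' X Y Z T p)))"
proof -
  interpret singular_space \<A> g N R
    by standard (use assms in \<open>auto simp: main_normal_def\<close>)
  show ?thesis
    using admissible_main_conn metric_conn_admissible admissible_metric metric_conn_flat flat_cov_curv
    by blast
qed

end
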